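(* Let $G$ be a Feynman graph. The boundary of the copositive cone $\mathcal{C}_G$ is contained in the hypersurface defined by the principal Landau determinant $\mathrm{PLD}_G$. Hence, the algebraic boundary of $\mathcal{C}_G$ is the hypersurface defined by the product of some of the Landau discriminants, i.e. some of the irreducible factors, that appear in the factorization of $\mathrm{PLD}_G$.
   Context: A Feynman graph is a finite connected graph $G$ (parallel edges and loops allowed). An edge incident to a vertex of valency $1$ is external; all other edges are internal. $G$ has $N$ external edges, labelled by $[N]$, and $n$ internal edges, labelled by $[n]=\{1,\dots,n\}$; the variables $x_1,\dots,x_n$ correspond to the internal edges. The kinematic parameters $z$ consist of arbitrary real numbers $m_1,\dots,m_n$ and an arbitrary real symmetric $N\times N$ matrix $(k_{ij})$ with zero row sums; thus $z\in\mathbb{R}^{M}$, $M=\binom N2+n$, with coordinates $m_e$ and $k_{ij}$, $i<j$. A spanning tree is a connected subgraph without cycles containing all vertices; $\mathcal{T}$ is the set of spanning trees, each identified with its set of internal edges where convenient. $\mathcal{U}(x)=\sum_{T\in\mathcal{T}}\prod_{e\notin T}x_e$. A spanning $2$-forest is a subgraph containing all vertices and all external edges, with no cycle, and with exactly two connected components $T_1,T_2$; $\mathcal{W}$ is the set of spanning $2$-forests, and $I_{T_1},I_{T_2}\subset[N]$ are the index sets of external edges attached to $T_1,T_2$. The second Symanzik polynomial is $$\mathcal{F}_z(x)=\sum_{\{T_1,T_2\}\in\mathcal{W}}\Big(\sum_{i\in I_{T_1}}\sum_{j\in I_{T_2}}k_{ij}\Big)\prod_{e\notin T_1\sqcup T_2}x_e+\Big(\sum_{e=1}^n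 m_ex_e\Big)\mathcal{U}(x).$$ The copositive cone is $\mathcal{C}_G=\{z\in\mathbb{R}^{M}:\mathcal{F}_z(u)\ge0\text{ for all }u\in\mathbb{R}^n_{\ge0}\}$. Its algebraic boundary is the Zariski closure in $\mathbb{C}^M$ of its topological boundary in $\mathbb{R}^M$. Let $\mathcal{A}_G\subset\mathbb{N}^n$ be the set of exponent vectors of monomials occurring in $\mathcal{F}_z(x)$ for generic $z$, and $P=\mathrm{conv}(\mathcal{A}_G)$. For a nonempty face $Q$ of $P$ (including $P$ itself), $\mathcal{F}_z|_Q$ is the sum of the terms of $\mathcal{F}_z$ with exponent vector in $Q$. Principal Landau determinant: for each face $Q$ consider the incidence variety $Y_Q$ of all $(x,z)\in(\mathbb{C}^* )^n\times\mathbb{C}^M$ such that $\mathcal{F}_z|_Q$ and all its partial derivatives $\partial\mathcal{F}_z|_Q/\partial x_i$, $i=1,\dots,n$, vanish at $x$ (that is, the hypersurface $\mathcal{F}_z|_Q=0$ is singular at $x$). For each irreducible component of $Y_Q$ take the Zariski closure in $\mathbb{C}^M$ of its image under projection to $z$. $\mathrm{PLD}_G(z)$ is the squarefree polynomial (unique up to scale) whose zero set is the union of all those closures, over all faces $Q$ and all components of $Y_Q$, that have codimension $1$. Its irreducible factors are called Landau discriminants. *)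

theory Defs
  imports
    "HOL-Analysis.Analysis"
    "HOL-Analysis.Finite_Function_Topology"
    "HOL-Library.Poly_Mapping"
    "HOL-Library.Uprod"
    "HOL-Library.Extended_Nat"
    "HOL-Library.Countable"
    "HOL-Computational_Algebra.Squarefree"
begin

section \<open>Multivariate polynomials\<close>

text \<open>
  A polynomial with coefficients in \<open>'a\<close> and variables in \<open>'v\<close> is a finitely supported map from
  exponent vectors to coefficients; its ring structure is that of \<^theory>\<open>HOL-Library.Poly_Mapping\<close>.
\<close>

type_synonym ('v, 'a) mpoly = "('v \<Rightarrow>\<^sub>0 nat) \<Rightarrow>\<^sub>0 'a"

definition mvar :: "'v \<Rightarrow> ('v, 'a::comm_semiring_1) mpoly" where
  "mvar v = Poly_Mapping.single (Poly_Mapping.single v 1) 1"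

definition mconst :: "'a::comm_semiring_1 \<Rightarrow> ('v, 'a) mpoly" where
  "mconst c = Poly_Mapping.single 0 c"

definition meval :: "('v \<Rightarrow> 'a) \<Rightarrow> ('v, 'a::comm_semiring_1) mpoly \<Rightarrow> 'a" where
  "meval x f = (\<Sum>m\<in>Poly_Mapping.keys f.
     Poly_Mapping.lookup f m * (\<Prod>v\<in>Poly_Mapping.keys m. x v ^ Poly_Mapping.lookup m v))"

definition mpderiv :: "'v \<Rightarrow> ('v, 'a::comm_semiring_1) mpoly \<Rightarrow> ('v, 'a) mpoly" where
  "mpderiv v f = (\<Sum>m\<in>Poly_Mapping.keys f.
     Poly_Mapping.single (m - Poly_Mapping.single v 1)
       (of_nat (Poly_Mapping.lookup m v) * Poly_Mapping.lookup f m))"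

definition mpolys :: "'v set \<Rightarrow> ('v, 'a::comm_semiring_1) mpoly set" where
  "mpolys I = {f. \<forall>m\<in>Poly_Mapping.keys f. Poly_Mapping.keys m \<subseteq> I}"


section \<open>Zariski topology on complex affine space\<close>

text \<open>
  Affine space with coordinates indexed by \<open>I\<close>: the functions on \<open>I\<close>, which by the convention of
  \<^const>\<open>PiE\<close> take the value \<^const>\<open>undefined\<close> outside \<open>I\<close>.
\<close>

definition affine_space :: "'v set \<Rightarrow> ('v \<Rightarrow> 'a) set" where
  "affine_space I = (\<Pi>\<^sub>E v\<in>I. UNIV)"

definition hypersurface :: "'v set \<Rightarrow> ('v, complex) mpoly \<Rightarrow> ('v \<Rightarrow> complex) set" where
  "hypersurface I f = {x \<in> affine_space I. meval x f = 0}"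

definition zariski :: "'v set \<Rightarrow> ('v \<Rightarrow> complex) topology" where
  "zariski I = topology_generated_by ((\<lambda>f. affine_space I - hypersurface I f) ` mpolys I)"

definition irreducible_in :: "'a topology \<Rightarrow> 'a set \<Rightarrow> bool" where
  "irreducible_in T S \<longleftrightarrow> S \<subseteq> topspace T \<and> S \<noteq> {} \<and>
     (\<forall>A B. closedin T A \<and> closedin T B \<and> S \<subseteq> A \<union> B \<longrightarrow> S \<subseteq> A \<or> S \<subseteq> B)"

definition irreducible_components :: "'a topology \<Rightarrow> 'a set \<Rightarrow> 'a set set" where
  "irreducible_components T Y =
     {C. C \<subseteq> Y \<and> irreducible_in T C \<and> (\<forall>D. C \<subseteq> D \<and> D \<subseteq> Y \<and> irreducible_in T D \<longrightarrow> D = C)}"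

text \<open>Codimension of an irreducible closed set: the supremum of the lengths of chains
  $V = Z_0 \subset Z_1 \subset \dots \subset Z_k$ of irreducible closed sets.\<close>

definition codimension :: "'a topology \<Rightarrow> 'a set \<Rightarrow> enat" where
  "codimension T V = Sup {enat k | k. \<exists>Z. Z 0 = V \<and>
     (\<forall>i\<le>k. closedin T (Z i) \<and> irreducible_in T (Z i)) \<and> (\<forall>i<k. Z i \<subset> Z (Suc i))}"


section \<open>Feynman graphs\<close>

datatype edge = External nat | Internal nat

record 'v feynman_data =
  verts :: "'v set"
  ends :: "edge \<Rightarrow> 'v uprod"
  num_ext :: nat
  num_int :: nat

definition edges :: "'v feynman_data \<Rightarrow> edge set" where
  "edges G = External ` {1..num_ext G} \<union> Internal ` {1..num_int G}"

text \<open>Loops count twice.\<close>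

definition valency :: "'v feynman_data \<Rightarrow> 'v \<Rightarrow> nat" where
  "valency G v = (\<Sum>e\<in>edges G. if ends G e = Upair v v then 2
                              else if v \<in> set_uprod (ends G e) then 1 else 0)"

text \<open>
  A subgraph that contains all the vertices is given by its set \<open>S\<close> of edges. Its connected
  components are represented by their sets of vertices.
\<close>

definition linked :: "'v feynman_data \<Rightarrow> edge set \<Rightarrow> ('v \<times> 'v) set" where
  "linked G S = {(u, v) \<in> verts G \<times> verts G. (u, v) \<in> {(a, b). \<exists>e\<in>S. ends G e = Upair a b}\<^sup>*}"

definition components_of :: "'v feynman_data \<Rightarrow> edge set \<Rightarrow> 'v set set" where
  "components_of G S = verts G // linked G S"

definition connected_sub :: "'v feynman_data \<Rightarrow> edge set \<Rightarrow> bool" where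
  "connected_sub G S \<longleftrightarrow> verts G \<noteq> {} \<and> (\<forall>u\<in>verts G. \<forall>v\<in>verts G. (u, v) \<in> linked G S)"

text \<open>A cycle runs through distinct vertices along distinct edges; a loop is a cycle of length 1,
  a pair of parallel edges is a cycle of length 2.\<close>

definition is_cycle :: "'v feynman_data \<Rightarrow> edge set \<Rightarrow> 'v list \<Rightarrow> edge list \<Rightarrow> bool" where
  "is_cycle G S vs es \<longleftrightarrow> es \<noteq> [] \<and> length vs = length es \<and> distinct vs \<and> distinct es \<and> set es \<subseteq> S \<and>
     (\<forall>i<length es. ends G (es ! i) = Upair (vs ! i) (vs ! (Suc i mod length es)))"

definition acyclic_sub :: "'v feynman_data \<Rightarrow> edge set \<Rightarrow> bool" where
  "acyclic_sub G S \<longleftrightarrow> (\<nexists>vs es. is_cycle G S vs es)"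

definition feynman_graph :: "'v feynman_data \<Rightarrow> bool" where
  "feynman_graph G \<longleftrightarrow>
     finite (verts G) \<and>
     (\<forall>e\<in>edges G. set_uprod (ends G e) \<subseteq> verts G) \<and>
     connected_sub G (edges G) \<and>
     (\<forall>e\<in>edges G. e \<in> External ` {1..num_ext G} \<longleftrightarrow> (\<exists>v\<in>set_uprod (ends G e). valency G v = 1))"

definition spanning_trees :: "'v feynman_data \<Rightarrow> edge set set" where
  "spanning_trees G = {T. T \<subseteq> edges G \<and> connected_sub G T \<and> acyclic_sub G T}"

definition spanning_2forests :: "'v feynman_data \<Rightarrow> edge set set" where
  "spanning_2forests G = {S. External ` {1..num_ext G} \<subseteq> S \<and> S \<subseteq> edges G \<and> acyclic_sub G S \<and>
     card (components_of G S) = 2}"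

definition legs :: "'v feynman_data \<Rightarrow> 'v set \<Rightarrow> nat set" where
  "legs G C = {i \<in> {1..num_ext G}. set_uprod (ends G (External i)) \<inter> C \<noteq> {}}"


section \<open>Symanzik polynomials\<close>

text \<open>The coordinates: \<open>Schwinger e\<close> is $x_e$, \<open>Mass e\<close> is $m_e$ and \<open>Momentum i j\<close>
  (used for $i < j$ only) is $k_{ij}$.\<close>

datatype var = Schwinger nat | Mass nat | Momentum nat nat

text \<open>A linear order on the variables, so that the polynomial ring is known to be an integral domain.\<close>

instance var :: countable
  by countable_datatype

instantiation var :: linorder
begin

definition less_eq_var :: "var \<Rightarrow> var \<Rightarrow> bool" where
  "less_eq_var a b \<longleftrightarrow> to_nat a \<le> to_nat b"

definition less_var :: "var \<Rightarrow> var \<Rightarrow> bool" where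
  "less_var a b \<longleftrightarrow> to_nat a < to_nat b"

instance
  by standard (auto simp: less_eq_var_def less_var_def)

end

definition kin_vars :: "'v feynman_data \<Rightarrow> var set" where
  "kin_vars G = Mass ` {1..num_int G} \<union> {Momentum i j | i j. 1 \<le> i \<and> i < j \<and> j \<le> num_ext G}"

text \<open>The symmetric matrix with zero row sums whose entries above the diagonal are given by \<open>z\<close>.\<close>

definition kmat :: "'v feynman_data \<Rightarrow> (var \<Rightarrow> 'a::comm_ring_1) \<Rightarrow> nat \<Rightarrow> nat \<Rightarrow> 'a" where
  "kmat G z i j =
     (if i \<noteq> j then z (Momentum (min i j) (max i j))
      else - (\<Sum>l\<in>{1..num_ext G} - {i}. z (Momentum (min i l) (max i l))))"

definition compl_monomial :: "'v feynman_data \<Rightarrow> edge set \<Rightarrow> (nat, 'a::comm_ring_1) mpoly" where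
  "compl_monomial G S = (\<Prod>e\<in>{e \<in> {1..num_int G}. Internal e \<notin> S}. mvar e)"

definition symanzik_U :: "'v feynman_data \<Rightarrow> (nat, 'a::comm_ring_1) mpoly" where
  "symanzik_U G = (\<Sum>T\<in>spanning_trees G. compl_monomial G T)"

text \<open>Unambiguous because \<^const>\<open>kmat\<close> is symmetric.\<close>

definition forest_coeff :: "'v feynman_data \<Rightarrow> (var \<Rightarrow> 'a::comm_ring_1) \<Rightarrow> edge set \<Rightarrow> 'a" where
  "forest_coeff G z S = (THE c. \<exists>C D. components_of G S = {C, D} \<and> C \<noteq> D \<and>
     c = (\<Sum>i\<in>legs G C. \<Sum>j\<in>legs G D. kmat G z i j))"

definition symanzik_F :: "'v feynman_data \<Rightarrow> (var \<Rightarrow> 'a::comm_ring_1) \<Rightarrow> (nat, 'a) mpoly" where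
  "symanzik_F G z =
     (\<Sum>S\<in>spanning_2forests G. mconst (forest_coeff G z S) * compl_monomial G S) +
     (\<Sum>e\<in>{1..num_int G}. mconst (z (Mass e)) * mvar e) * symanzik_U G"


section \<open>The copositive cone and its algebraic boundary\<close>

definition copositive_cone :: "'v feynman_data \<Rightarrow> (var \<Rightarrow> real) set" where
  "copositive_cone G = {z \<in> affine_space (kin_vars G).
     \<forall>u. (\<forall>e\<in>{1..num_int G}. u e \<ge> 0) \<longrightarrow> meval u (symanzik_F G z) \<ge> 0}"

definition copositive_boundary :: "'v feynman_data \<Rightarrow> (var \<Rightarrow> real) set" where
  "copositive_boundary G =
     product_topology (\<lambda>_. euclideanreal) (kin_vars G) frontier_of copositive_cone G"

definition complexify :: "'v set \<Rightarrow> ('v \<Rightarrow> real) \<Rightarrow> ('v \<Rightarrow> complex)" where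
  "complexify I z = restrict (\<lambda>v. complex_of_real (z v)) I"

definition algebraic_boundary :: "'v feynman_data \<Rightarrow> (var \<Rightarrow> complex) set" where
  "algebraic_boundary G =
     zariski (kin_vars G) closure_of (complexify (kin_vars G) ` copositive_boundary G)"


section \<open>The principal Landau determinant\<close>

text \<open>Exponents occurring for generic \<open>z\<close>, i.e. for all \<open>z\<close> in some nonempty Zariski open set.\<close>

definition generic_support :: "'v feynman_data \<Rightarrow> (nat \<Rightarrow>\<^sub>0 nat) set" where
  "generic_support G = {a. \<exists>U. openin (zariski (kin_vars G)) U \<and> U \<noteq> {} \<and>
     (\<forall>z\<in>U. a \<in> Poly_Mapping.keys (symanzik_F G z))}"

definition real_exponent :: "(nat \<Rightarrow>\<^sub>0 nat) \<Rightarrow> (nat \<Rightarrow>\<^sub>0 real)" where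
  "real_exponent a = Poly_Mapping.map real a"

definition newton_polytope :: "'v feynman_data \<Rightarrow> (nat \<Rightarrow>\<^sub>0 real) set" where
  "newton_polytope G = convex hull (real_exponent ` generic_support G)"

definition restrict_poly :: "(nat \<Rightarrow>\<^sub>0 real) set \<Rightarrow> (nat, 'a::comm_ring_1) mpoly \<Rightarrow> (nat, 'a) mpoly" where
  "restrict_poly Q f = (\<Sum>m\<in>{m \<in> Poly_Mapping.keys f. real_exponent m \<in> Q}.
     Poly_Mapping.single m (Poly_Mapping.lookup f m))"

text \<open>A point \<open>p\<close> is a pair $(x, z)$, where $x$ are its \<open>Schwinger\<close> coordinates and $z$ are its
  remaining coordinates.\<close>

definition incidence_vars :: "'v feynman_data \<Rightarrow> var set" where
  "incidence_vars G = Schwinger ` {1..num_int G} \<union> kin_vars G"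

definition incidence_variety ::
  "'v feynman_data \<Rightarrow> (nat \<Rightarrow>\<^sub>0 real) set \<Rightarrow> (var \<Rightarrow> complex) set" where
  "incidence_variety G Q = {p \<in> affine_space (incidence_vars G).
     let x = (\<lambda>e. p (Schwinger e));
         z = restrict p (kin_vars G);
         f = restrict_poly Q (symanzik_F G z)
     in (\<forall>e\<in>{1..num_int G}. x e \<noteq> 0) \<and> meval x f = 0 \<and>
        (\<forall>i\<in>{1..num_int G}. meval x (mpderiv i f) = 0)}"

definition projected_components ::
  "'v feynman_data \<Rightarrow> (nat \<Rightarrow>\<^sub>0 real) set \<Rightarrow> (var \<Rightarrow> complex) set set" where
  "projected_components G Q =
     (\<lambda>C. zariski (kin_vars G) closure_of ((\<lambda>p. restrict p (kin_vars G)) ` C)) `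
       irreducible_components (zariski (incidence_vars G)) (incidence_variety G Q)"

definition landau_locus :: "'v feynman_data \<Rightarrow> (var \<Rightarrow> complex) set" where
  "landau_locus G = \<Union>{V. \<exists>Q. Q face_of newton_polytope G \<and> Q \<noteq> {} \<and>
     V \<in> projected_components G Q \<and> codimension (zariski (kin_vars G)) V = 1}"

text \<open>The principal Landau determinant is only defined up to a scalar, hence a predicate.\<close>

definition is_PLD :: "'v feynman_data \<Rightarrow> (var, complex) mpoly \<Rightarrow> bool" where
  "is_PLD G D \<longleftrightarrow> D \<in> mpolys (kin_vars G) \<and> squarefree D \<and>
     hypersurface (kin_vars G) D = landau_locus G"

definition landau_discriminants :: "(var, complex) mpoly \<Rightarrow> (var, complex) mpoly set" where
  "landau_discriminants D = {f. irreducible f \<and> f dvd D}"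

end

theory Submission
  imports Defs
begin

text \<open>
  The polynomial \<open>\<F>\<^sub>z\<close> is linear in the parameters \<open>z\<close>: \<open>\<F>\<^sub>z = \<Sum>\<^sub>v z\<^sub>v g\<^sub>v\<close>, where the coefficients of
  the \<open>g\<^sub>v\<close> are natural numbers that count spanning trees or forests (\<open>lookup_symanzik_F\<close>). This is all
  that the argument uses of the graph. In particular, the copositive cone is an upper set for the
  coordinatewise order of the parameters.

  Let \<open>z\<close> be a boundary point. Then \<open>\<F>\<^sub>z\<close> is nonnegative on the positive orthant, but at suitable positive
  points its value is arbitrarily small compared with the sum of its monomials. Divide the monomials by
  their sum and pass to a limit. The monomials that survive are those on a face \<open>Q\<close> of the Newton polytope, and
  the restriction of \<open>\<F>\<^sub>z\<close> to \<open>Q\<close> has a zero \<open>x\<close> with positive coordinates. It is a minimum, so \<open>(x, z)\<close> lies in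
  the incidence variety of \<open>Q\<close> (\<open>boundary_point_singular\<close>). Hence \<open>z\<close> lies in one of the finitely many closures
  \<open>V\<close> of projected irreducible components. The point is to see that \<open>V\<close> can be taken of codimension one.

  \<^item> \<open>V\<close> is not the whole space (\<open>component_not_dominant\<close>). This is a theorem of Bertini type: if a component
    \<open>C\<close> dominated the parameter space, then the vector field \<open>\<Sum>\<^sub>v \<partial>/\<partial>z\<^sub>v\<close> would lift to a rational vector field tangent
    to \<open>C\<close> (\<open>tangent_lift\<close>). Differentiating the equation of \<open>Q\<close> along it shows that the sum of the restrictions of
    the \<open>g\<^sub>v\<close> to \<open>Q\<close> vanishes on \<open>C\<close>. But the coefficients of this sum are positive, and \<open>C\<close> contains the point
    \<open>(x, z)\<close> with positive \<open>x\<close>.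

  \<^item> Those \<open>V\<close> of codimension at least two do not cover the boundary near any of its points
    (\<open>boundary_not_covered\<close>). On such a \<open>V\<close> two polynomials \<open>f\<close> and \<open>g\<close> vanish, where \<open>f\<close> is irreducible and does not divide
    \<open>g\<close> (\<open>codimension_1I\<close>). Any parameter can be eliminated from \<open>f\<close> and \<open>g\<close> (\<open>mpoly_elimination\<close>), so that the projection
    of \<open>V\<close> along any coordinate is contained in a hypersurface, whereas the boundary of an upper set projects onto a set with
    interior along some coordinate (\<open>boundary_projects_onto_box\<close>).

  So the points on the \<open>V\<close> of codimension one are dense in the boundary. As the zero set of the principal Landau determinant
  is closed, it contains the whole boundary. The second claim follows by the same density argument, applied to the irreducible
  factors \<open>f\<close> of the determinant: if the hypersurface of \<open>f\<close> is not contained in the algebraic boundary, then some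
  polynomial \<open>g\<close> that is not divisible by \<open>f\<close> vanishes on the boundary. So the other factors already account for a dense
  part of the boundary, and their hypersurfaces make up the algebraic boundary.

  The commutative algebra consists of Hilbert's basis theorem, Gauss's lemma with the elimination that it provides, and the
  extension of derivations. Each is proved for one element adjoined to a subring and then iterated over the variables.
\<close>

section \<open>Adjoining an element to a subring\<close>

definition polys_over :: "'a::idom set \<Rightarrow> 'a poly set" where
  "polys_over R = {p. \<forall>i. coeff p i \<in> R}"

definition adjoin :: "'a::idom set \<Rightarrow> 'a \<Rightarrow> 'a set" where
  "adjoin R Y = (\<lambda>p. poly p Y) ` polys_over R"

definition ideal_of :: "'a::idom set \<Rightarrow> 'a set \<Rightarrow> bool" where
  "ideal_of R I \<longleftrightarrow> I \<subseteq> R \<and> 0 \<in> I \<and> (\<forall>a\<in>I. \<forall>b\<in>I. a + b \<in> I) \<and> (\<forall>r\<in>R. \<forall>a\<in>I. r * a \<in> I)"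

definition noetherian :: "'a::idom set \<Rightarrow> bool" where
  "noetherian R \<longleftrightarrow> (\<forall>I. (\<forall>k. ideal_of R (I k)) \<and> incseq I \<longrightarrow> (\<exists>K. \<forall>k\<ge>K. I k = I K))"

text \<open>
  Divisibility in the ambient ring between nonzero elements of a saturated subring is divisibility in the
  subring. Therefore units, irreducible elements and divisibility are always those of the ambient ring.
\<close>
definition saturated :: "'a::idom set \<Rightarrow> bool" where
  "saturated R \<longleftrightarrow> (\<forall>a b. a * b \<in> R \<longrightarrow> a * b \<noteq> 0 \<longrightarrow> a \<in> R)"

text \<open>
  Primality is relative to \<open>R\<close>, so that it can be proved by adjoining one variable at a time.
\<close>
definition irreducibles_prime :: "'a::idom set \<Rightarrow> bool" where
  "irreducibles_prime R \<longleftrightarrow>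
     (\<forall>p\<in>R. irreducible p \<longrightarrow> (\<forall>a\<in>R. \<forall>b\<in>R. p dvd a * b \<longrightarrow> p dvd a \<or> p dvd b))"

locale subring =
  fixes R :: "'a::idom set"
  assumes zero_mem: "0 \<in> R" and one_mem: "1 \<in> R"
    and add_mem: "a \<in> R \<Longrightarrow> b \<in> R \<Longrightarrow> a + b \<in> R"
    and mult_mem: "a \<in> R \<Longrightarrow> b \<in> R \<Longrightarrow> a * b \<in> R"
    and uminus_mem: "a \<in> R \<Longrightarrow> - a \<in> R"
begin

lemma diff_mem: "a \<in> R \<Longrightarrow> b \<in> R \<Longrightarrow> a - b \<in> R"
  using add_mem[of a "- b"] uminus_mem[of b] by simp

lemma sum_mem: "(\<And>i. i \<in> A \<Longrightarrow> f i \<in> R) \<Longrightarrow> sum f A \<in> R"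
  by (induction A rule: infinite_finite_induct) (auto intro: zero_mem add_mem)

lemma prod_mem: "(\<And>i. i \<in> A \<Longrightarrow> f i \<in> R) \<Longrightarrow> prod f A \<in> R"
  by (induction A rule: infinite_finite_induct) (auto intro: one_mem mult_mem)

lemma power_mem: "a \<in> R \<Longrightarrow> a ^ n \<in> R"
  by (induction n) (auto intro: one_mem mult_mem)

lemma of_nat_mem: "of_nat n \<in> R"
  by (induction n) (auto intro: zero_mem one_mem add_mem)

lemma subring_polys_over: "subring (polys_over R)"
  by unfold_locales
    (auto simp: polys_over_def coeff_mult coeff_1 intro: zero_mem one_mem add_mem mult_mem uminus_mem sum_mem)

lemma smult_mem: "c \<in> R \<Longrightarrow> p \<in> polys_over R \<Longrightarrow> smult c p \<in> polys_over R"
  by (auto simp: polys_over_def intro: mult_mem)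

lemma monom_mem: "c \<in> R \<Longrightarrow> monom c n \<in> polys_over R"
  by (auto simp: polys_over_def intro: zero_mem)

lemma const_mem: "c \<in> R \<Longrightarrow> [:c:] \<in> polys_over R"
  using monom_mem[of c 0] by (simp add: monom_0)

lemma X_mem: "[:0, 1:] \<in> polys_over R"
  using monom_mem[OF one_mem, of 1] by (simp add: monom_altdef)

lemma coeff_mem: "p \<in> polys_over R \<Longrightarrow> coeff p i \<in> R"
  by (simp add: polys_over_def)

lemma pderiv_mem: "p \<in> polys_over R \<Longrightarrow> pderiv p \<in> polys_over R"
  by (auto simp: polys_over_def coeff_pderiv simp del: of_nat_Suc intro: mult_mem of_nat_mem)

lemmas poly_zero_mem = subring.zero_mem[OF subring_polys_over]
lemmas poly_one_mem = subring.one_mem[OF subring_polys_over]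
lemmas poly_add_mem = subring.add_mem[OF subring_polys_over]
lemmas poly_mult_mem = subring.mult_mem[OF subring_polys_over]
lemmas poly_diff_mem = subring.diff_mem[OF subring_polys_over]
lemmas poly_uminus_mem = subring.uminus_mem[OF subring_polys_over]

lemma subring_adjoin: "subring (adjoin R Y)"
proof
  show "0 \<in> adjoin R Y" unfolding adjoin_def by (rule image_eqI[OF _ poly_zero_mem]) simp
  show "1 \<in> adjoin R Y" unfolding adjoin_def by (rule image_eqI[OF _ poly_one_mem]) simp
next
  fix a b assume "a \<in> adjoin R Y" "b \<in> adjoin R Y"
  then obtain p q where pq: "p \<in> polys_over R" "q \<in> polys_over R" "a = poly p Y" "b = poly q Y"
    by (auto simp: adjoin_def)
  show "a + b \<in> adjoin R Y" unfolding adjoin_def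
    by (rule image_eqI[OF _ poly_add_mem[OF pq(1,2)]]) (simp add: pq)
  show "a * b \<in> adjoin R Y" unfolding adjoin_def
    by (rule image_eqI[OF _ poly_mult_mem[OF pq(1,2)]]) (simp add: pq)
next
  fix a assume "a \<in> adjoin R Y"
  then obtain p where pq: "p \<in> polys_over R" "a = poly p Y"
    by (auto simp: adjoin_def)
  show "- a \<in> adjoin R Y" unfolding adjoin_def
    by (rule image_eqI[OF _ poly_uminus_mem[OF pq(1)]]) (simp add: pq)
qed

lemma poly_mem_adjoin: "p \<in> polys_over R \<Longrightarrow> poly p Y \<in> adjoin R Y"
  by (simp add: adjoin_def)

lemma base_subset_adjoin: "R \<subseteq> adjoin R Y"
  unfolding adjoin_def using const_mem by (force intro: image_eqI[of _ _ "[:_:]"])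

lemma pseudo_division:
  assumes m: "m \<in> polys_over R" "m \<noteq> 0" and p: "p \<in> polys_over R"
  shows "\<exists>N s r. s \<in> polys_over R \<and> r \<in> polys_over R \<and> smult (lead_coeff m ^ N) p = m * s + r \<and>
           (r = 0 \<or> degree r < degree m)"
  using p
proof (induction "if p = 0 then 0 else Suc (degree p)" arbitrary: p rule: less_induct)
  case less
  show ?case
  proof (cases "p = 0 \<or> degree p < degree m")
    case True
    then show ?thesis using less.prems
      by (intro exI[of _ 0] exI[of _ 0] exI[of _ p]) (auto intro: poly_zero_mem)
  next
    case False
    define l where "l = lead_coeff m"
    define t where "t = monom (lead_coeff p) (degree p - degree m)"
    define p' where "p' = smult l p - m * t"
    have lR: "l \<in> R" and tR: "t \<in> polys_over R"
      using m less.prems by (auto simp: l_def t_def polys_over_def intro: zero_mem)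
    have p'R: "p' \<in> polys_over R"
      unfolding p'_def by (intro poly_diff_mem smult_mem poly_mult_mem lR tR less.prems m)
    have c: "coeff p' (degree p) = 0"
      using False by (simp add: p'_def t_def l_def mult.commute[of m] coeff_monom_mult)
    have d: "degree p' \<le> degree p"
      unfolding p'_def
    proof (rule degree_diff_le)
      show "degree (smult l p) \<le> degree p" by (rule degree_smult_le)
      have "degree (m * t) \<le> degree m + degree t" by (rule degree_mult_le)
      also have "\<dots> \<le> degree p"
        using False degree_monom_le[of "lead_coeff p" "degree p - degree m"]
        unfolding t_def by linarith
      finally show "degree (m * t) \<le> degree p" .
    qed
    have "p' = 0 \<or> degree p' < degree p"
      using c d by (metis le_neq_implies_less leading_coeff_0_iff)
    then have "(if p' = 0 then 0 else Suc (degree p'))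
        < (if p = 0 then 0 else Suc (degree p))"
      using False by auto
    from less.hyps[OF this p'R] obtain N s r where IH: "s \<in> polys_over R" "r \<in> polys_over R"
        "smult (l ^ N) p' = m * s + r" "r = 0 \<or> degree r < degree m"
      unfolding l_def by blast
    have "smult (l ^ Suc N) p = m * (s + smult (l ^ N) t) + r"
      using IH(3) unfolding p'_def
      by (simp add: smult_diff_right algebra_simps)
    then show ?thesis
      using IH lR tR
      by (intro exI[of _ "Suc N"] exI[of _ "s + smult (l ^ N) t"] exI[of _ r])
         (auto simp: l_def intro!: poly_add_mem smult_mem power_mem)
  qed
qed

section \<open>Hilbert's basis theorem\<close>

text \<open>
  The ideal \<open>L J d\<close> consists of the coefficients of \<open>Y^d\<close> in the polynomials of degree at most \<open>d\<close> whose values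
  lie in \<open>J\<close>. For an ascending chain \<open>I\<close> the diagonal \<open>L (I k) k\<close> becomes stationary, which settles all large \<open>d\<close> at once;
  finitely many \<open>d\<close> remain. Two nested ideals with the same \<open>L\<close> are equal, by descent on the degree.
\<close>
lemma noetherian_adjoin:
  assumes N: "noetherian R"
  shows "noetherian (adjoin R Y)"
  unfolding noetherian_def
proof (intro allI impI)
  fix I assume I: "(\<forall>k. ideal_of (adjoin R Y) (I k)) \<and> incseq I"
  define L where "L J d = {coeff p d | p. p \<in> polys_over R \<and> degree p \<le> d \<and> poly p Y \<in> J}"
    for J :: "'a set" and d
  interpret A: subring "adjoin R Y" by (rule subring_adjoin)
  have L_ideal: "ideal_of R (L (I k) d)" for k d
    unfolding ideal_of_def
  proof (intro conjI ballI)
    have J: "ideal_of (adjoin R Y) (I k)" using I by auto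
    show "L (I k) d \<subseteq> R" by (auto simp: L_def polys_over_def)
    show "0 \<in> L (I k) d" using J poly_zero_mem unfolding L_def ideal_of_def
      by (auto intro!: exI[of _ 0])
    fix a assume "a \<in> L (I k) d"
    then obtain p where p: "p \<in> polys_over R" "degree p \<le> d" "poly p Y \<in> I k" "a = coeff p d"
      by (auto simp: L_def)
    {
      fix b assume "b \<in> L (I k) d"
      then obtain q where q: "q \<in> polys_over R" "degree q \<le> d" "poly q Y \<in> I k" "b = coeff q d"
        by (auto simp: L_def)
      show "a + b \<in> L (I k) d"
        using p q J unfolding L_def ideal_of_def
        by (auto intro!: exI[of _ "p + q"] poly_add_mem degree_add_le)
    }
    fix r assume "r \<in> R"
    then show "r * a \<in> L (I k) d"
      using p J base_subset_adjoin[of Y] unfolding L_def ideal_of_def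
      by (auto intro!: exI[of _ "smult r p"] smult_mem intro: order.trans[OF degree_smult_le])
  qed
  have L_Suc: "L (I k) d \<subseteq> L (I k) (Suc d)" for k d
  proof
    fix a assume "a \<in> L (I k) d"
    then obtain p where p: "p \<in> polys_over R" "degree p \<le> d" "poly p Y \<in> I k" "a = coeff p d"
      by (auto simp: L_def)
    have "Y \<in> adjoin R Y" using poly_mem_adjoin[OF X_mem, of Y] by simp
    then have "Y * poly p Y \<in> I k" using I p unfolding ideal_of_def by auto
    then show "a \<in> L (I k) (Suc d)"
      using p unfolding L_def
      by (auto intro!: exI[of _ "pCons 0 p"] simp: polys_over_def coeff_pCons zero_mem
               split: nat.splits intro: order.trans[OF degree_pCons_le])
  qed
  have L_mono_d: "d \<le> d' \<Longrightarrow> L (I k) d \<subseteq> L (I k) d'" for k d d'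
    using lift_Suc_mono_le[of "L (I k)" d d'] L_Suc by auto
  have L_mono_k: "k \<le> k' \<Longrightarrow> L (I k) d \<subseteq> L (I k') d" for k k' d
    using I unfolding L_def incseq_def by blast
  have "incseq (\<lambda>k. L (I k) k)"
    unfolding incseq_def using L_mono_d L_mono_k by blast
  then obtain K where K: "\<forall>k\<ge>K. L (I k) k = L (I K) K"
    using N L_ideal unfolding noetherian_def by meson
  have "\<exists>Kd. \<forall>k\<ge>Kd. L (I k) d = L (I Kd) d" for d
    using N[unfolded noetherian_def, rule_format, of "\<lambda>k. L (I k) d"] L_ideal L_mono_k
    by (auto simp: incseq_def)
  then obtain Kd where Kd: "\<And>d k. k \<ge> Kd d \<Longrightarrow> L (I k) d = L (I (Kd d)) d" by metis
  define M where "M = Max (insert K (Kd ` {..<K}))"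
  have MK: "K \<le> M" and MKd: "\<And>d. d < K \<Longrightarrow> Kd d \<le> M"
    by (auto simp: M_def)
  have stable: "L (I k) d = L (I M) d" if "k \<ge> M" for k d
  proof (cases "d < K")
    case True
    then show ?thesis using Kd[of d k] Kd[of d M] MKd[of d] that by simp
  next
    case False
    have "L (I k) d \<subseteq> L (I (max k d)) (max k d)"
      by (rule order.trans[OF L_mono_k L_mono_d]) auto
    also have "\<dots> = L (I K) K" by (rule K[rule_format]) (use False in auto)
    also have "\<dots> \<subseteq> L (I M) d" 
      by (rule order.trans[OF L_mono_k L_mono_d]) (use MK False in auto)
    finally show ?thesis using L_mono_k[OF that] by auto
  qed
  show "\<exists>K. \<forall>k\<ge>K. I k = I K"
  proof (intro exI allI impI)
    fix k assume k: "M \<le> k"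
    have "poly p Y \<in> I M" if "p \<in> polys_over R" "poly p Y \<in> I k" for p
      using that
    proof (induction "if p = 0 then 0 else Suc (degree p)" arbitrary: p rule: less_induct)
      case less
      have J: "ideal_of (adjoin R Y) (I k)" "ideal_of (adjoin R Y) (I M)" using I by auto
      show ?case
      proof (cases "p = 0")
        case True then show ?thesis using J by (simp add: ideal_of_def)
      next
        case False
        have "lead_coeff p \<in> L (I k) (degree p)"
          using less.prems by (auto simp: L_def)
        then have "lead_coeff p \<in> L (I M) (degree p)" using stable[OF k] by simp
        then obtain q where q: "q \<in> polys_over R" "degree q \<le> degree p"
            "poly q Y \<in> I M" "lead_coeff p = coeff q (degree p)"
          by (auto simp: L_def)
        have qk: "poly q Y \<in> I k" using q I k by (auto simp: incseq_def)
        have "- 1 * poly q Y \<in> I k" using J(1) qk A.uminus_mem[OF A.one_mem] unfolding ideal_of_def by blast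
        then have "poly p Y + - 1 * poly q Y \<in> I k" using J(1) less.prems unfolding ideal_of_def by blast
        then have 1: "poly (p - q) Y \<in> I k" by simp
        have "degree (p - q) \<le> degree p" using q by (intro degree_diff_le) auto
        moreover have "coeff (p - q) (degree p) = 0" using q by simp
        ultimately have "p - q = 0 \<or> degree (p - q) < degree p"
          by (metis le_neq_implies_less leading_coeff_0_iff)
        then have "poly (p - q) Y \<in> I M"
          using less.hyps[OF _ poly_diff_mem[OF less.prems(1) q(1)] 1] False by auto
        then have "poly (p - q) Y + poly q Y \<in> I M" using q(3) J(2) unfolding ideal_of_def by blast
        then show ?thesis by simp
      qed
    qed
    moreover have "I k \<subseteq> adjoin R Y" using I unfolding ideal_of_def by blast
    ultimately have "I k \<subseteq> I M" unfolding adjoin_def by blast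
    moreover have "I M \<subseteq> I k" using I k unfolding incseq_def by blast
    ultimately show "I k = I M" by (rule subset_antisym)
  qed
qed

end

section \<open>Factorisation into irreducibles\<close>

lemma proper_divisor:
  fixes a b :: "'a::idom"
  assumes "a * b \<noteq> 0" "\<not> b dvd 1"
  shows "\<not> a * b dvd a"
proof
  assume "a * b dvd a"
  then obtain c where "a = a * b * c" by (rule dvdE)
  then have "a * (b * c) = a * 1" by (simp add: mult.assoc)
  then have "b * c = 1" using assms(1) by (metis mult_cancel_left mult_zero_left)
  then show False using assms(2) dvdI by metis
qed

locale factorial_subring = subring R for R :: "'a::idom set" +
  assumes sat: "saturated R" and noeth: "noetherian R"
begin

lemma factor_mem: "a * b \<in> R \<Longrightarrow> a * b \<noteq> 0 \<Longrightarrow> a \<in> R" "a * b \<in> R \<Longrightarrow> a * b \<noteq> 0 \<Longrightarrow> b \<in> R"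
  using sat unfolding saturated_def by (blast, metis mult.commute)

text \<open>
  A descending chain of proper divisors is an ascending chain of principal ideals.
\<close>
lemma wf_proper_divisor:
  "wf {(a, b). a \<in> R \<and> b \<in> R \<and> a dvd b \<and> \<not> b dvd a}"
  unfolding wf_iff_no_infinite_down_chain
proof (rule notI, elim exE)
  fix s assume "\<forall>i. (s (Suc i), s i) \<in> {(a, b). a \<in> R \<and> b \<in> R \<and> a dvd b \<and> \<not> b dvd a}"
  then have s: "\<And>i. s i \<in> R" "\<And>i. s (Suc i) dvd s i" "\<And>i. \<not> s i dvd s (Suc i)" by auto
  define I where "I k = {x \<in> R. s k dvd x}" for k
  have "ideal_of R (I k)" for k
    unfolding ideal_of_def I_def by (auto intro: zero_mem add_mem mult_mem)
  moreover have "incseq I"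
    unfolding incseq_Suc_iff I_def using s(2) by (auto intro: dvd_trans)
  ultimately obtain K where K: "\<forall>k\<ge>K. I k = I K" using noeth unfolding noetherian_def by meson
  have "I (Suc K) = I K" by (rule K[rule_format]) simp
  moreover have "s (Suc K) \<in> I (Suc K)" using s by (simp add: I_def)
  ultimately show False using s(3) by (auto simp: I_def)
qed

lemma irreducible_factor:
  assumes "f \<in> R" "f \<noteq> 0" "\<not> f dvd 1"
  shows "\<exists>p a. p \<in> R \<and> a \<in> R \<and> irreducible p \<and> f = p * a"
  using assms
proof (induction f rule: wf_induct_rule[OF wf_proper_divisor])
  case (1 f)
  show ?case
  proof (cases "irreducible f")
    case True
    then show ?thesis using 1(2) one_mem by (intro exI[of _ f] exI[of _ 1]) auto
  next
    case False
    then obtain a b where ab: "f = a * b" "\<not> a dvd 1" "\<not> b dvd 1"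
      using 1(3,4) unfolding irreducible_def by auto
    have mem: "a \<in> R" "b \<in> R" using factor_mem[of a b] 1(2,3) ab by auto
    have "\<not> f dvd a" unfolding ab(1) by (rule proper_divisor) (use ab 1(3) in auto)
    then have rel: "(a, f) \<in> {(a, b). a \<in> R \<and> b \<in> R \<and> a dvd b \<and> \<not> b dvd a}"
      using mem 1(2) ab(1) by simp
    have "a \<noteq> 0" using ab(1) 1(3) by auto
    from 1(1)[OF rel mem(1) this ab(2)] obtain p c
      where pc: "p \<in> R" "c \<in> R" "irreducible p" "a = p * c" by blast
    have "f = p * (c * b)" unfolding ab(1) pc(4) by (rule mult.assoc)
    then show ?thesis using pc(1,3) mult_mem[OF pc(2) mem(2)] by blast
  qed
qed

lemma factor_induct [consumes 2, case_names unit irreducible]: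
  assumes "f \<in> R" "f \<noteq> 0"
    and unit: "\<And>u. u \<in> R \<Longrightarrow> u dvd 1 \<Longrightarrow> P u"
    and irr: "\<And>p a. p \<in> R \<Longrightarrow> irreducible p \<Longrightarrow> a \<in> R \<Longrightarrow> a \<noteq> 0 \<Longrightarrow> P a \<Longrightarrow> P (p * a)"
  shows "P f"
  using assms(1,2)
proof (induction f rule: wf_induct_rule[OF wf_proper_divisor])
  case (1 f)
  show ?case
  proof (cases "f dvd 1")
    case True then show ?thesis using unit 1(2) by auto
  next
    case False
    then obtain p a where pa: "p \<in> R" "a \<in> R" "irreducible p" "f = p * a"
      using irreducible_factor[of f] 1(2,3) by auto
    have "a \<noteq> 0" using pa(4) 1(3) by auto
    have "\<not> f dvd a"
      unfolding pa(4) mult.commute[of p a]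
      by (rule proper_divisor) (use pa 1(3) in \<open>auto simp: irreducible_def\<close>)
    then have rel: "(a, f) \<in> {(a, b). a \<in> R \<and> b \<in> R \<and> a dvd b \<and> \<not> b dvd a}"
      using pa(2,4) 1(2) by simp
    have "P a" by (rule 1(1)[OF rel pa(2) \<open>a \<noteq> 0\<close>])
    then show ?thesis unfolding pa(4) using irr[OF pa(1,3,2) \<open>a \<noteq> 0\<close>] by blast
  qed
qed

end

section \<open>Gauss's lemma\<close>

definition transcendental_over :: "'a::idom set \<Rightarrow> 'a \<Rightarrow> bool" where
  "transcendental_over R Y \<longleftrightarrow> (\<forall>p\<in>polys_over R. poly p Y = 0 \<longrightarrow> p = 0)"

locale transcendental_extension = factorial_subring R for R :: "'a::idom set" +
  fixes Y :: 'a
  assumes trans: "transcendental_over R Y"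
    and sat_adjoin: "saturated (adjoin R Y)"
    and prime: "irreducibles_prime R"
begin

lemma poly_cancel: "p \<in> polys_over R \<Longrightarrow> q \<in> polys_over R \<Longrightarrow> poly p Y = poly q Y \<Longrightarrow> p = q"
  using trans poly_diff_mem[of p q] unfolding transcendental_over_def by fastforce

lemma poly_factor_mem:
  assumes "poly p Y = a * b" "p \<in> polys_over R" "p \<noteq> 0"
  obtains q r where "q \<in> polys_over R" "r \<in> polys_over R" "a = poly q Y" "b = poly r Y" "p = q * r"
proof -
  have "poly p Y \<noteq> 0" using assms trans unfolding transcendental_over_def by auto
  moreover have "a * b \<in> adjoin R Y" using assms poly_mem_adjoin[of p Y] by simp
  ultimately have "a \<in> adjoin R Y" "b \<in> adjoin R Y"
    using sat_adjoin assms(1) unfolding saturated_def by (metis, metis mult.commute)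
  then obtain q r where qr: "q \<in> polys_over R" "r \<in> polys_over R" "a = poly q Y" "b = poly r Y"
    by (auto simp: adjoin_def)
  moreover have "p = q * r" using poly_cancel[OF assms(2) poly_mult_mem[OF qr(1,2)]] assms(1) qr by simp
  ultimately show ?thesis using that by blast
qed

lemma unit_degree_0:
  assumes "p \<in> polys_over R" "poly p Y dvd 1"
  shows "degree p = 0"
proof -
  obtain w where w: "1 = poly p Y * w" using assms by auto
  obtain q r where qr: "poly p Y = poly q Y" "q \<in> polys_over R" "1 = q * r"
    using poly_factor_mem[of 1 "poly p Y" w] w poly_one_mem by (metis poly_1 one_neq_zero)
  have "q dvd 1" unfolding qr(3) by simp
  then show ?thesis using poly_cancel[OF assms(1) qr(2,1)] is_unit_poly_iff[of q] by auto
qed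

text \<open>
  Gauss's lemma: the product of the first coefficients that \<open>c\<close> does not divide is, up to multiples of \<open>c\<close>,
  a coefficient of the product.
\<close>
lemma const_divides_product:
  assumes c: "c \<in> R" "irreducible c" and pq: "p \<in> polys_over R" "q \<in> polys_over R"
    and dvd: "[:c:] dvd p * q"
  shows "[:c:] dvd p \<or> [:c:] dvd q"
proof (rule ccontr)
  assume "\<not> ?thesis"
  then have ex: "\<exists>i. \<not> c dvd coeff p i" "\<exists>j. \<not> c dvd coeff q j" by (auto simp: const_poly_dvd_iff)
  define i j where "i = (LEAST i. \<not> c dvd coeff p i)" and "j = (LEAST j. \<not> c dvd coeff q j)"
  have ij: "\<not> c dvd coeff p i" "\<not> c dvd coeff q j"
    using LeastI_ex[OF ex(1)] LeastI_ex[OF ex(2)] by (auto simp: i_def j_def)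
  have less: "k < i \<Longrightarrow> c dvd coeff p k" "k < j \<Longrightarrow> c dvd coeff q k" for k
    using not_less_Least[of k] by (auto simp: i_def j_def)
  have "coeff (p * q) (i + j) = (\<Sum>k\<le>i + j. coeff p k * coeff q (i + j - k))"
    by (simp add: coeff_mult)
  also have "\<dots> = coeff p i * coeff q j + (\<Sum>k\<in>{..i + j} - {i}. coeff p k * coeff q (i + j - k))"
    by (subst sum.remove[of _ i]) auto
  finally have eq: "coeff p i * coeff q j =
      coeff (p * q) (i + j) - (\<Sum>k\<in>{..i + j} - {i}. coeff p k * coeff q (i + j - k))" by simp
  have "c dvd coeff p i * coeff q j"
    unfolding eq
  proof (intro dvd_diff dvd_sum)
    show "c dvd coeff (p * q) (i + j)" using dvd by (simp add: const_poly_dvd_iff)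
    fix k assume "k \<in> {..i + j} - {i}"
    then have "k < i \<or> i + j - k < j" by auto
    then show "c dvd coeff p k * coeff q (i + j - k)" using less by auto
  qed
  then show False using ij prime c pq coeff_mem unfolding irreducibles_prime_def by blast
qed

lemma const_quotient_mem:
  assumes "m \<in> polys_over R" "m = smult c n" "c \<noteq> 0"
  shows "n \<in> polys_over R"
  unfolding polys_over_def
proof (intro CollectI allI)
  fix i
  show "coeff n i \<in> R"
    using factor_mem(2)[of c "coeff n i"] assms coeff_mem[of m i] zero_mem by (cases "coeff n i = 0") auto
qed

text \<open>
  A constant factor of a product can be distributed over the two factors, one irreducible constant at a time.
\<close>
lemma clear_constant:
  assumes "k \<in> R" "k \<noteq> 0" "p \<in> polys_over R" "m \<in> polys_over R" "s \<in> polys_over R" "smult k p = m * s"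
  shows "\<exists>k1 k2 m' s'. k1 \<in> R \<and> k2 \<in> R \<and> k1 \<noteq> 0 \<and> k2 \<noteq> 0 \<and> m' \<in> polys_over R \<and> s' \<in> polys_over R \<and>
           m = smult k1 m' \<and> s = smult k2 s' \<and> p = m' * s'"
  using assms
proof (induction k arbitrary: m s rule: factor_induct)
  case (unit u)
  then obtain w where w: "1 = u * w" by auto
  have "u \<noteq> 0" using w by auto
  have "w \<in> R" using factor_mem(2)[of u w] one_mem w by (metis one_neq_zero)
  have "smult w (smult u p) = m * smult w s" using unit by simp
  then have "p = m * smult w s" using w by (simp add: mult.commute)
  moreover have "s = smult u (smult w s)" using w by (simp flip: w)
  ultimately show ?case
    using unit \<open>w \<in> R\<close> \<open>u \<noteq> 0\<close> by (intro exI[of _ 1] exI[of _ u] exI[of _ m] exI[of _ "smult w s"])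
      (auto intro: one_mem smult_mem)
next
  case (irreducible c a)
  have c0: "c \<noteq> 0" using irreducible by auto
  have eq: "smult c (smult a p) = m * s" using irreducible by simp
  have "smult c (smult a p) = [:c:] * smult a p" by (simp add: mult.commute)
  then have "[:c:] dvd m * s" unfolding eq[symmetric] by (metis dvd_triv_left)
  then consider "[:c:] dvd m" | "[:c:] dvd s" using const_divides_product irreducible by blast
  then show ?case
  proof cases
    case 1
    then obtain n where n: "m = smult c n" by (auto elim!: dvdE)
    have nR: "n \<in> polys_over R" using const_quotient_mem[OF _ n c0] irreducible by simp
    have "smult c (smult a p) = smult c (n * s)" using eq n by simp
    then have "smult a p = n * s" using c0 by (metis smult_cancel)
    from irreducible.IH[OF \<open>p \<in> _\<close> nR irreducible.prems(3) this] obtain k1 k2 m' s' where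
      "k1 \<in> R \<and> k2 \<in> R \<and> k1 \<noteq> 0 \<and> k2 \<noteq> 0 \<and> m' \<in> polys_over R \<and> s' \<in> polys_over R \<and>
           n = smult k1 m' \<and> s = smult k2 s' \<and> p = m' * s'" by blast
    then show ?thesis using n c0 irreducible.hyps
      by (intro exI[of _ "c * k1"] exI[of _ k2] exI[of _ m'] exI[of _ s']) (auto intro: mult_mem)
  next
    case 2
    then obtain n where n: "s = smult c n" by (auto elim!: dvdE)
    have nR: "n \<in> polys_over R" using const_quotient_mem[OF _ n c0] irreducible by simp
    have "smult c (smult a p) = smult c (m * n)" using eq n by simp
    then have "smult a p = m * n" using c0 by (metis smult_cancel)
    from irreducible.IH[OF \<open>p \<in> _\<close> irreducible.prems(2) nR this] obtain k1 k2 m' s' where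
      "k1 \<in> R \<and> k2 \<in> R \<and> k1 \<noteq> 0 \<and> k2 \<noteq> 0 \<and> m' \<in> polys_over R \<and> s' \<in> polys_over R \<and>
           m = smult k1 m' \<and> n = smult k2 s' \<and> p = m' * s'" by blast
    then show ?thesis using n c0 irreducible.hyps
      by (intro exI[of _ k1] exI[of _ "c * k2"] exI[of _ m'] exI[of _ s']) (auto intro: mult_mem)
  qed
qed

text \<open>
  An irreducible polynomial of positive degree has no nonunit constant factor, so \<open>k\<close> divides the cofactor.
\<close>
lemma irreducible_dvd_const_mult:
  assumes f: "irreducible (poly p Y)" "p \<in> polys_over R" "degree p > 0"
    and k: "k \<in> R" "k \<noteq> 0" and g: "g \<in> adjoin R Y" and dvd: "poly p Y dvd k * g"
  shows "poly p Y dvd g"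
proof (cases "g = 0")
  case False
  obtain q where q: "q \<in> polys_over R" "g = poly q Y" using g by (auto simp: adjoin_def)
  obtain t where t: "poly (smult k q) Y = poly p Y * t" using dvd q by (auto elim!: dvdE)
  have "smult k q \<noteq> 0" using False q k by auto
  from poly_factor_mem[OF t smult_mem[OF k(1) q(1)] this]
  obtain p1 r where r: "p1 \<in> polys_over R" "r \<in> polys_over R" "poly p Y = poly p1 Y" "smult k q = p1 * r"
    by metis
  have "p1 = p" using poly_cancel r f by metis
  then have eq: "smult k q = p * r" using r by simp
  from clear_constant[OF k q(1) f(2) r(2) eq] obtain k1 k2 p' r' where
    *: "k1 \<in> R" "k1 \<noteq> 0" "p' \<in> polys_over R" "p = smult k1 p'" "q = p' * r'"
    by blast
  have "k1 dvd 1 \<or> poly p' Y dvd 1" using f(1) *(4) unfolding irreducible_def by simp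
  moreover have "\<not> poly p' Y dvd 1"
    using unit_degree_0[OF *(3)] f(3) * by auto
  ultimately obtain u where "1 = k1 * u" by auto
  then have "poly p' Y = poly p Y * u" unfolding *(4) by simp
  then have "poly p Y dvd poly p' Y" by simp
  then show ?thesis unfolding q(2) *(5) poly_mult by (rule dvd_mult2)
qed auto

text \<open>
  Over the fraction field of \<open>R\<close> the two polynomials generate the unit ideal, and denominators can be cleared.
  To avoid fractions, take an element \<open>m\<close> of least degree in the ideal of \<open>R[Y]\<close> that they generate. By pseudo-division it divides
  both of them up to constants, so it is itself a constant as \<open>p\<close> is irreducible and does not divide \<open>q\<close>.
\<close>
lemma elimination:
  assumes f: "irreducible (poly p Y)" "p \<in> polys_over R" "degree p > 0"
    and q: "q \<in> polys_over R" and ndvd: "\<not> poly p Y dvd poly q Y"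
  shows "\<exists>c\<in>R. c \<noteq> 0 \<and> (\<exists>a\<in>adjoin R Y. \<exists>b\<in>adjoin R Y. c = a * poly p Y + b * poly q Y)"
proof -
  define J where "J = {a * p + b * q | a b. a \<in> polys_over R \<and> b \<in> polys_over R}"
  have JR: "J \<subseteq> polys_over R" unfolding J_def using f(2) q by (auto intro!: poly_add_mem poly_mult_mem)
  have pJ: "p \<in> J" unfolding J_def
    by (rule CollectI, rule exI[of _ 1], rule exI[of _ 0]) (auto intro: poly_one_mem poly_zero_mem)
  have qJ: "q \<in> J" unfolding J_def
    by (rule CollectI, rule exI[of _ 0], rule exI[of _ 1]) (auto intro: poly_one_mem poly_zero_mem)
  have J_lin: "smult k x - m * s \<in> J" if "x \<in> J" "m \<in> J" "k \<in> R" "s \<in> polys_over R" for x m k s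
  proof -
    obtain a b where ab: "x = a * p + b * q" "a \<in> polys_over R" "b \<in> polys_over R"
      using \<open>x \<in> J\<close> by (auto simp: J_def)
    obtain c d where cd: "m = c * p + d * q" "c \<in> polys_over R" "d \<in> polys_over R"
      using \<open>m \<in> J\<close> by (auto simp: J_def)
    have "smult k x - m * s = (smult k a - c * s) * p + (smult k b - d * s) * q"
      by (simp add: ab cd algebra_simps smult_add_right)
    moreover have "smult k a - c * s \<in> polys_over R" "smult k b - d * s \<in> polys_over R"
      using that ab cd by (auto intro!: poly_diff_mem smult_mem poly_mult_mem)
    ultimately show ?thesis unfolding J_def by blast
  qed
  have "\<exists>m. m \<in> J \<and> m \<noteq> 0" using pJ f(3) by (intro exI[of _ p]) auto
  then obtain m where m: "m \<in> J" "m \<noteq> 0"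
    and min: "\<And>m'. m' \<in> J \<Longrightarrow> m' \<noteq> 0 \<Longrightarrow> degree m \<le> degree m'"
    using ex_has_least_nat[of "\<lambda>m. m \<in> J \<and> m \<noteq> 0" _ degree] by metis
  have mR: "m \<in> polys_over R" using m JR by auto
  have mult: "\<exists>k s. k \<in> R \<and> k \<noteq> 0 \<and> s \<in> polys_over R \<and> smult k x = m * s" if "x \<in> J" for x
  proof -
    have "x \<in> polys_over R" using that JR by blast
    from pseudo_division[OF mR m(2) this] obtain N s r where
      r: "s \<in> polys_over R" "r \<in> polys_over R" "smult (lead_coeff m ^ N) x = m * s + r"
         "r = 0 \<or> degree r < degree m"
      by blast
    have lm: "lead_coeff m ^ N \<in> R" using coeff_mem[OF mR] power_mem by blast
    have eq: "smult (lead_coeff m ^ N) x - m * s = r" using r(3) by simp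
    have "r \<in> J" using J_lin[OF that m(1) lm r(1)] unfolding eq .
    then have "r = 0" using r(4) min[of r] leD by blast
    then show ?thesis using lm r m by (intro exI[of _ "lead_coeff m ^ N"] exI[of _ s]) auto
  qed
  obtain k s where ks: "k \<in> R" "k \<noteq> 0" "s \<in> polys_over R" "smult k p = m * s" using mult pJ by blast
  obtain k' s' where ks': "k' \<in> R" "k' \<noteq> 0" "s' \<in> polys_over R" "smult k' q = m * s'" using mult qJ by blast
  from clear_constant[OF ks(1,2) f(2) mR ks(3,4)] obtain k1 k2 m1 s1 where
    *: "k1 \<in> R" "k1 \<noteq> 0" "m1 \<in> polys_over R" "s1 \<in> polys_over R" "m = smult k1 m1" "p = m1 * s1"
    by blast
  have "poly m1 Y dvd 1 \<or> poly s1 Y dvd 1" using f(1) *(6) unfolding irreducible_def by simp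
  moreover have "\<not> poly s1 Y dvd 1"
  proof
    assume "poly s1 Y dvd 1"
    then obtain w where w: "1 = poly s1 Y * w" by auto
    have m1: "poly m1 Y = poly p Y * w" unfolding *(6) poly_mult mult.assoc w[symmetric] by simp
    have "k' * poly q Y = poly m Y * poly s' Y"
      using arg_cong[OF ks'(4), of "\<lambda>x. poly x Y"] by simp
    also have "\<dots> = poly p Y * (k1 * w * poly s' Y)"
      unfolding *(5) by (simp only: poly_smult m1 mult_ac)
    finally have "k' * poly q Y = poly p Y * (k1 * w * poly s' Y)" .
    then have "poly p Y dvd poly q Y"
      using irreducible_dvd_const_mult[OF f ks'(1,2) poly_mem_adjoin[OF q]] by (metis dvd_triv_left)
    then show False using ndvd by simp
  qed
  ultimately have "degree m1 = 0" using unit_degree_0 * by blast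
  then have "degree m = 0" using * by simp
  then obtain c where c: "m = [:c:]" by (meson degree_eq_zeroE)
  have "c \<in> R" using coeff_mem[OF mR, of 0] c by simp
  moreover have "c \<noteq> 0" using m c by auto
  moreover obtain a b where ab: "m = a * p + b * q" "a \<in> polys_over R" "b \<in> polys_over R"
    using m(1) by (auto simp: J_def)
  moreover have "c = poly a Y * poly p Y + poly b Y * poly q Y"
    using arg_cong[OF ab(1), of "\<lambda>m. poly m Y"] c by simp
  ultimately show ?thesis using poly_mem_adjoin by blast
qed

text \<open>
  If \<open>f\<close> has positive degree and does not divide \<open>g\<close>, then elimination gives a constant \<open>c = a f + b g\<close>. If \<open>f\<close> divides
  \<open>g h\<close>, then it divides \<open>c h = f (a h) + b (g h)\<close> and hence \<open>h\<close>.
\<close>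
lemma irreducibles_prime_adjoin: "irreducibles_prime (adjoin R Y)"
  unfolding irreducibles_prime_def
proof (intro ballI impI)
  fix f g h assume mem: "f \<in> adjoin R Y" "g \<in> adjoin R Y" "h \<in> adjoin R Y"
    and irr: "irreducible f" and dvd: "f dvd g * h"
  obtain p where p: "p \<in> polys_over R" "f = poly p Y" using mem by (auto simp: adjoin_def)
  obtain q where q: "q \<in> polys_over R" "g = poly q Y" using mem by (auto simp: adjoin_def)
  obtain r where r: "r \<in> polys_over R" "h = poly r Y" using mem by (auto simp: adjoin_def)
  show "f dvd g \<or> f dvd h"
  proof (cases "degree p = 0")
    case True
    then obtain c where c: "p = [:c:]" by (meson degree_eq_zeroE)
    have cR: "c \<in> R" using coeff_mem[OF p(1), of 0] c by simp
    have fc: "f = c" using p c by simp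
    have "[:c:] dvd q * r"
    proof (cases "q * r = 0")
      case False
      obtain t where t: "poly (q * r) Y = f * t" using dvd q r by (auto elim!: dvdE)
      obtain p1 t' where *: "p1 \<in> polys_over R" "f = poly p1 Y" "q * r = p1 * t'"
        using poly_factor_mem[OF t poly_mult_mem[OF q(1) r(1)] False] by metis
      have "p1 = p" using poly_cancel p * by metis
      then show ?thesis unfolding *(3) using c by (simp only: dvd_triv_left)
    qed auto
    then have "[:c:] dvd q \<or> [:c:] dvd r" using const_divides_product cR irr fc q r by blast
    then show ?thesis unfolding fc q r by (auto elim!: dvdE)
  next
    case False
    show ?thesis
    proof (rule ccontr)
      assume "\<not> ?thesis"
      then have nd: "\<not> f dvd g" "\<not> f dvd h" by auto
      from elimination[of p q] irr p q False nd obtain c a b where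
        c: "c \<in> R" "c \<noteq> 0" "c = a * f + b * g" by auto
      have "c * h = f * (a * h) + b * (g * h)" unfolding c(3) by (simp add: algebra_simps)
      then have "f dvd c * h" using dvd by simp
      then show False using irreducible_dvd_const_mult[of p c h] irr p False c mem nd by auto
    qed
  qed
qed

end

section \<open>Extending derivations\<close>

definition derivation :: "('a::idom \<Rightarrow> 'a) \<Rightarrow> bool" where
  "derivation d \<longleftrightarrow> (\<forall>a b. d (a + b) = d a + d b) \<and> (\<forall>a b. d (a * b) = d a * b + a * d b)"

lemma derivation_zero: "derivation d \<Longrightarrow> d 0 = 0"
  unfolding derivation_def by (metis add_cancel_right_right add_0)

lemma derivation_poly:
  assumes "derivation d"
  shows "d (poly p y) = poly (map_poly d p) y + poly (pderiv p) y * d y"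
proof (induction p)
  case 0 then show ?case using derivation_zero[OF assms] by simp
next
  case (pCons a p)
  have "d (poly (pCons a p) y) = d a + (d y * poly p y + y * d (poly p y))"
    using assms by (simp add: derivation_def)
  then show ?case
    using pCons by (simp add: map_poly_pCons[where f = d, OF derivation_zero[OF assms]] pderiv_pCons algebra_simps)
qed

text \<open>
  Here \<open>dY\<close> is the partial derivative with respect to \<open>Y\<close>.
  This is the extension of a derivation of the fraction field of \<open>R\<close> modulo \<open>P\<close> to the field generated
  by one more element \<open>Y\<close>, with denominators cleared. If \<open>Y\<close> is transcendental modulo \<open>P\<close>, every choice of
  the derivative of \<open>Y\<close> works. Otherwise, differentiating a minimal relation for \<open>Y\<close> determines it, and the
  factor \<open>e\<close> is the derivative of that relation with respect to \<open>Y\<close>, nonzero in characteristic zero.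
\<close>
lemma extend_derivation:
  fixes R :: "'a::{idom,ring_char_0} set"
  assumes R: "subring R"
    and P: "ideal_of (adjoin R Y) P"
    and P_prime: "\<And>a b. a \<in> adjoin R Y \<Longrightarrow> b \<in> adjoin R Y \<Longrightarrow> a * b \<in> P \<Longrightarrow> a \<in> P \<or> b \<in> P"
    and P_proper: "\<And>n. n > 0 \<Longrightarrow> of_nat n \<notin> P"
    and d: "derivation d" "\<And>h. h \<in> R \<inter> P \<Longrightarrow> d h \<in> P" "\<And>h. h \<in> adjoin R Y \<Longrightarrow> d h \<in> adjoin R Y"
    and dY: "derivation dY" "\<And>h. h \<in> R \<Longrightarrow> dY h = 0" "dY Y = 1"
            "\<And>h. h \<in> adjoin R Y \<Longrightarrow> dY h \<in> adjoin R Y"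
  shows "\<exists>e b. e \<in> adjoin R Y \<and> b \<in> adjoin R Y \<and> e \<notin> P \<and> (\<forall>h\<in>P. e * d h + b * dY h \<in> P)"
proof -
  interpret subring R by (rule R)
  interpret A: subring "adjoin R Y" by (rule subring_adjoin)
  have P0: "0 \<in> P" and Padd: "\<And>a b. a \<in> P \<Longrightarrow> b \<in> P \<Longrightarrow> a + b \<in> P"
    and Pmul: "\<And>r a. r \<in> adjoin R Y \<Longrightarrow> a \<in> P \<Longrightarrow> r * a \<in> P" and PA: "P \<subseteq> adjoin R Y"
    using P by (auto simp: ideal_of_def)
  have Pmul': "\<And>r a. r \<in> adjoin R Y \<Longrightarrow> a \<in> P \<Longrightarrow> a * r \<in> P" using Pmul by (simp add: mult.commute)
  have Psub: "a - b \<in> P" if "a \<in> P" "b \<in> P" for a b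
    using Padd[OF that(1) Pmul[OF A.uminus_mem[OF A.one_mem] that(2)]] by simp
  have RA: "\<And>r. r \<in> R \<Longrightarrow> r \<in> adjoin R Y" using base_subset_adjoin by blast
  have YA: "Y \<in> adjoin R Y" using poly_mem_adjoin[OF X_mem, of Y] by simp
  have Pcoeffs: "poly p Y \<in> P" if "\<And>i. coeff p i \<in> P" for p
    using that
  proof (induction p)
    case 0 then show ?case using P0 by simp
  next
    case (pCons a p)
    have "a \<in> P" using pCons.prems[of 0] by simp
    moreover have "coeff p i \<in> P" for i using pCons.prems[of "Suc i"] by simp
    ultimately show ?case using pCons.IH Padd Pmul YA by simp
  qed
  have dcoeffs: "d (poly p Y) \<in> P" if "p \<in> polys_over R" "\<And>i. coeff p i \<in> P" for p
  proof -
    have "poly (map_poly d p) Y \<in> P"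
      using that d coeff_mem by (intro Pcoeffs) (auto simp: coeff_map_poly derivation_zero)
    moreover have "poly (pderiv p) Y \<in> P"
    proof (rule Pcoeffs)
      fix i show "coeff (pderiv p) i \<in> P"
        unfolding coeff_pderiv using that A.of_nat_mem[of "Suc i"] by (intro Pmul) (auto simp del: of_nat_Suc)
    qed
    ultimately show ?thesis
      unfolding derivation_poly[OF d(1)] using d(3)[OF YA] by (intro Padd Pmul') auto
  qed
  have dY_poly: "dY (poly p Y) = poly (pderiv p) Y" if "p \<in> polys_over R" for p
  proof -
    have "map_poly dY p = 0"
      using dY(2) coeff_mem[OF that] by (intro poly_eqI) (simp add: coeff_map_poly derivation_zero[OF dY(1)])
    then show ?thesis using derivation_poly[OF dY(1)] dY(3) by simp
  qed
  define rel where "rel p \<longleftrightarrow> p \<in> polys_over R \<and> poly p Y \<in> P \<and> (\<exists>i. coeff p i \<notin> P)" for p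
  show ?thesis
  proof (cases "\<exists>p. rel p")
    case False
    have "1 * d h + 0 * dY h \<in> P" if "h \<in> P" for h
    proof -
      obtain p where "p \<in> polys_over R" "h = poly p Y" using PA \<open>h \<in> P\<close> by (auto simp: adjoin_def)
      then show ?thesis using dcoeffs[of p] False \<open>h \<in> P\<close> unfolding rel_def by auto
    qed
    moreover have "1 \<notin> P" using P_proper[of 1] by simp
    ultimately show ?thesis using A.one_mem A.zero_mem by blast
  next
    case True
    then obtain p where p: "rel p" and min: "\<And>q. rel q \<Longrightarrow> degree p \<le> degree q"
      using ex_has_least_nat[of rel _ degree] by metis
    have pR: "p \<in> polys_over R" and pP: "poly p Y \<in> P" using p by (auto simp: rel_def)
    have small: "\<forall>i. coeff q i \<in> P" if "q \<in> polys_over R" "poly q Y \<in> P"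
        "q = 0 \<or> degree q < degree p" for q
      using that min[of q] P0 unfolding rel_def by fastforce
    \<comment> \<open>otherwise the leading term could be dropped\<close>
    have lead: "lead_coeff p \<notin> P"
    proof
      assume lP: "lead_coeff p \<in> P"
      define t where "t = monom (lead_coeff p) (degree p)"
      have tR: "t \<in> polys_over R" unfolding t_def using coeff_mem[OF pR] by (rule monom_mem)
      have tP: "\<And>i. coeff t i \<in> P" using lP P0 by (auto simp: t_def)
      have "degree (p - t) \<le> degree p"
        by (intro degree_diff_le) (auto simp: t_def degree_monom_le)
      moreover have "coeff (p - t) (degree p) = 0" by (simp add: t_def)
      ultimately have "p - t = 0 \<or> degree (p - t) < degree p"
        by (metis le_neq_implies_less leading_coeff_0_iff)
      moreover have "poly (p - t) Y \<in> P" using Psub[OF pP Pcoeffs[OF tP]] by simp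
      ultimately have "\<forall>i. coeff (p - t) i \<in> P" using small poly_diff_mem[OF pR tR] by blast
      then have "coeff (p - t) i + coeff t i \<in> P" for i using Padd tP by blast
      then show False using p by (simp add: rel_def)
    qed
    have deg: "degree p > 0"
    proof (rule ccontr)
      assume "\<not> ?thesis"
      then obtain c where "p = [:c:]" by (meson degree_eq_zeroE neq0_conv)
      then show False using pP lead by simp
    qed
    \<comment> \<open>chosen so that \<open>e d + b dY\<close> annihilates the value of the minimal relation \<open>p\<close>\<close>
    define e b where "e = poly (pderiv p) Y" and "b = - d (poly p Y)"
    have eA: "e \<in> adjoin R Y" unfolding e_def by (rule poly_mem_adjoin[OF pderiv_mem[OF pR]])
    have bA: "b \<in> adjoin R Y" unfolding b_def using d(3) poly_mem_adjoin[OF pR] A.uminus_mem by blast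
    have eP: "e \<notin> P"
    proof
      assume "e \<in> P"
      then have "coeff (pderiv p) (degree p - 1) \<in> P"
        using small[of "pderiv p"] pderiv_mem[OF pR] deg by (simp add: e_def degree_pderiv)
      then have "of_nat (degree p) * lead_coeff p \<in> P" using deg by (simp add: coeff_pderiv)
      then show False
        using P_prime[OF A.of_nat_mem RA[OF coeff_mem[OF pR]]] P_proper[OF deg] lead by blast
    qed
    define D where "D h = e * d h + b * dY h" for h
    have D_add: "D (x + y) = D x + D y" for x y
      using d(1) dY(1) by (simp add: D_def derivation_def algebra_simps)
    have D_mult: "D (x * y) = D x * y + x * D y" for x y
      using d(1) dY(1) by (simp add: D_def derivation_def algebra_simps)
    have DA: "D x \<in> adjoin R Y" if "x \<in> adjoin R Y" for x
      unfolding D_def using that d(3) dY(4) eA bA by (intro A.add_mem A.mult_mem) auto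
    have Dp: "D (poly p Y) = 0" unfolding D_def b_def dY_poly[OF pR] e_def by (simp add: algebra_simps)
    have "D h \<in> P" if "h \<in> P" for h
    proof -
      obtain q where q: "q \<in> polys_over R" "h = poly q Y" using PA \<open>h \<in> P\<close> by (auto simp: adjoin_def)
      have "p \<noteq> 0" using deg by auto
      from pseudo_division[OF pR this q(1)] obtain N s r where
        r: "s \<in> polys_over R" "r \<in> polys_over R" "smult (lead_coeff p ^ N) q = p * s + r"
           "r = 0 \<or> degree r < degree p" by blast
      define l where "l = lead_coeff p ^ N"
      have lA: "l \<in> adjoin R Y" unfolding l_def using RA[OF coeff_mem[OF pR]] by (rule A.power_mem)
      have eq: "l * h = poly p Y * poly s Y + poly r Y"
        using arg_cong[OF r(3), of "\<lambda>q. poly q Y"] q by (simp add: l_def)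
      have "poly r Y = l * h - poly p Y * poly s Y" using eq by simp
      then have rP: "poly r Y \<in> P"
        using Psub[OF Pmul[OF lA \<open>h \<in> P\<close>] Pmul'[OF poly_mem_adjoin[OF r(1)] pP]] by simp
      then have rc: "\<forall>i. coeff r i \<in> P" using small r by blast
      have "D (poly r Y) \<in> P" unfolding D_def
      proof (intro Padd Pmul eA bA)
        show "d (poly r Y) \<in> P" using dcoeffs r(2) rc by blast
        show "dY (poly r Y) \<in> P" unfolding dY_poly[OF r(2)]
        proof (rule Pcoeffs)
          fix i show "coeff (pderiv r) i \<in> P"
            unfolding coeff_pderiv using rc A.of_nat_mem[of "Suc i"] by (intro Pmul) (auto simp del: of_nat_Suc)
        qed
      qed
      then have "D (l * h) \<in> P"
        unfolding eq D_add D_mult Dp using Pmul'[OF DA[OF poly_mem_adjoin[OF r(1)]] pP] Padd by simp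
      then have "D l * h + l * D h \<in> P" by (simp add: D_mult)
      then have "D l * h + l * D h - D l * h \<in> P" using Psub Pmul[OF DA[OF lA] \<open>h \<in> P\<close>] by blast
      then have "l * D h \<in> P" by simp
      moreover have "l \<notin> P"
        unfolding l_def
      proof (induction N)
        case 0 then show ?case using P_proper[of 1] by simp
      next
        case (Suc N)
        then show ?case
          using P_prime[OF RA[OF coeff_mem[OF pR]] A.power_mem[OF RA[OF coeff_mem[OF pR]]]] lead by auto
      qed
      moreover have "D h \<in> adjoin R Y" using DA PA \<open>h \<in> P\<close> by auto
      ultimately show ?thesis using P_prime[OF lA] by blast
    qed
    then show ?thesis using eA bA eP unfolding D_def by blast
  qed
qed

section \<open>Evaluation of multivariate polynomials\<close>

definition mono_eval :: "('v \<Rightarrow> 'b::comm_ring_1) \<Rightarrow> ('v \<Rightarrow>\<^sub>0 nat) \<Rightarrow> 'b" where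
  "mono_eval s m = (\<Prod>v\<in>Poly_Mapping.keys m. s v ^ Poly_Mapping.lookup m v)"

lemma mono_eval_superset:
  assumes "finite A" "Poly_Mapping.keys m \<subseteq> A"
  shows "mono_eval s m = (\<Prod>v\<in>A. s v ^ Poly_Mapping.lookup m v)"
  unfolding mono_eval_def using assms
  by (intro prod.mono_neutral_left) (auto simp: not_in_keys_iff_lookup_eq_zero)

lemma mono_eval_0 [simp]: "mono_eval s 0 = 1"
  by (simp add: mono_eval_def)

lemma mono_eval_add: "mono_eval s (m + m') = mono_eval s m * mono_eval s m'"
proof -
  have "Poly_Mapping.keys (m + m') \<subseteq> Poly_Mapping.keys m \<union> Poly_Mapping.keys m'" by (rule keys_add)
  then show ?thesis
    by (subst (1 2 3) mono_eval_superset[of "Poly_Mapping.keys m \<union> Poly_Mapping.keys m'"])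
       (auto simp: lookup_add power_add prod.distrib)
qed

lemma mono_eval_single [simp]: "mono_eval s (Poly_Mapping.single v n) = s v ^ n"
  by (cases "n = 0") (auto simp: mono_eval_def)

locale coeff_hom =
  fixes \<kappa> :: "'a::comm_ring_1 \<Rightarrow> 'b::comm_ring_1"
  assumes hom_zero: "\<kappa> 0 = 0" and hom_one: "\<kappa> 1 = 1"
    and hom_add: "\<kappa> (a + b) = \<kappa> a + \<kappa> b" and hom_mult: "\<kappa> (a * b) = \<kappa> a * \<kappa> b"
begin

definition heval :: "('v \<Rightarrow> 'b) \<Rightarrow> ('v, 'a) mpoly \<Rightarrow> 'b" where
  "heval s f = (\<Sum>m\<in>Poly_Mapping.keys f. \<kappa> (Poly_Mapping.lookup f m) * mono_eval s m)"

lemma heval_superset: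
  assumes "finite A" "Poly_Mapping.keys f \<subseteq> A"
  shows "heval s f = (\<Sum>m\<in>A. \<kappa> (Poly_Mapping.lookup f m) * mono_eval s m)"
  unfolding heval_def using assms
  by (intro sum.mono_neutral_left) (auto simp: not_in_keys_iff_lookup_eq_zero hom_zero)

lemma heval_0 [simp]: "heval s 0 = 0"
  by (simp add: heval_def)

lemma heval_add [simp]: "heval s (f + g) = heval s f + heval s g"
proof -
  have "Poly_Mapping.keys (f + g) \<subseteq> Poly_Mapping.keys f \<union> Poly_Mapping.keys g" by (rule keys_add)
  then show ?thesis
    by (subst (1 2 3) heval_superset[of "Poly_Mapping.keys f \<union> Poly_Mapping.keys g"])
       (auto simp: lookup_add hom_add algebra_simps sum.distrib)
qed

lemma heval_sum [simp]: "heval s (sum f A) = (\<Sum>i\<in>A. heval s (f i))"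
  by (induction A rule: infinite_finite_induct) auto

lemma heval_single [simp]: "heval s (Poly_Mapping.single m c) = \<kappa> c * mono_eval s m"
  by (subst heval_superset[of "{m}"]) auto

end

lemma mpoly_as_sum:
  fixes f :: "('v, 'a::comm_ring_1) mpoly"
  shows "f = (\<Sum>m\<in>Poly_Mapping.keys f. Poly_Mapping.single m (Poly_Mapping.lookup f m))"
proof (rule poly_mapping_eqI)
  fix k
  show "Poly_Mapping.lookup f k =
      Poly_Mapping.lookup (\<Sum>m\<in>Poly_Mapping.keys f. Poly_Mapping.single m (Poly_Mapping.lookup f m)) k"
    by (auto simp: lookup_sum lookup_single when_def not_in_keys_iff_lookup_eq_zero)
qed

lemma mpoly_sum_induct [case_names zero single add]:
  fixes f :: "('v, 'a::comm_ring_1) mpoly"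
  assumes "P 0" "\<And>m c. P (Poly_Mapping.single m c)" "\<And>f g. P f \<Longrightarrow> P g \<Longrightarrow> P (f + g)"
  shows "P f"
proof -
  have "P (\<Sum>m\<in>A. Poly_Mapping.single m (Poly_Mapping.lookup f m))" if "finite A" for A
    using that by (induction A rule: finite_induct) (auto intro: assms)
  then show ?thesis using mpoly_as_sum[of f] by (metis finite_keys)
qed

context coeff_hom begin

lemma heval_mult [simp]: "heval s (f * g) = heval s f * heval s g"
proof (induction f rule: mpoly_sum_induct)
  case (single m c)
  show ?case
    by (induction g rule: mpoly_sum_induct)
       (auto simp: mult_single hom_mult mono_eval_add distrib_left algebra_simps)
qed (auto simp: distrib_right)

lemma heval_mconst [simp]: "heval s (mconst c) = \<kappa> c"
  by (simp add: mconst_def)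

lemma heval_mvar [simp]: "heval s (mvar v) = s v"
  by (simp add: mvar_def hom_one)

lemma heval_1 [simp]: "heval s 1 = 1"
  using heval_mconst[of s 1] by (simp add: mconst_def hom_one)

lemma heval_prod [simp]: "heval s (prod f A) = (\<Prod>i\<in>A. heval s (f i))"
  by (induction A rule: infinite_finite_induct) auto

lemma heval_power [simp]: "heval s (f ^ n) = heval s f ^ n"
  by (induction n) auto

lemma heval_cong:
  assumes "f \<in> mpolys I" "\<And>v. v \<in> I \<Longrightarrow> s v = s' v"
  shows "heval s f = heval s' f"
proof -
  have "s v = s' v" if "m \<in> Poly_Mapping.keys f" "v \<in> Poly_Mapping.keys m" for m v
    using assms that unfolding mpolys_def by blast
  then show ?thesis
    unfolding heval_def mono_eval_def by (intro sum.cong refl arg_cong[of _ _ "(*) _"] prod.cong) auto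
qed

end

interpretation meval: coeff_hom "\<lambda>c. c"
  rewrites "coeff_hom.heval (\<lambda>c. c) = meval"
proof -
  show h: "coeff_hom (\<lambda>c::'a. c)" by unfold_locales auto
  show "coeff_hom.heval (\<lambda>c::'a. c) = meval"
    by (intro ext) (simp add: coeff_hom.heval_def[OF h] meval_def mono_eval_def)
qed

interpretation mconst: coeff_hom mconst
  by unfold_locales (auto simp: mconst_def single_add mult_single)

lemma mvar_power: "mvar v ^ n = Poly_Mapping.single (Poly_Mapping.single v n) 1"
  by (induction n) (auto simp: mvar_def mult_single single_add[symmetric])

lemma mono_eval_mvar: "mono_eval mvar m = Poly_Mapping.single m (1::'a::comm_ring_1)"
proof -
  have "(\<Prod>v\<in>A. mvar v ^ Poly_Mapping.lookup m v) =
      Poly_Mapping.single (\<Sum>v\<in>A. Poly_Mapping.single v (Poly_Mapping.lookup m v)) (1::'a)" if "finite A" for A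
    using that by (induction A rule: finite_induct) (auto simp: mvar_power mult_single)
  moreover have "(\<Sum>v\<in>Poly_Mapping.keys m. Poly_Mapping.single v (Poly_Mapping.lookup m v)) = m"
    by (rule poly_mapping_eqI) (auto simp: lookup_sum lookup_single when_def not_in_keys_iff_lookup_eq_zero)
  ultimately show ?thesis unfolding mono_eval_def by simp
qed

lemma heval_mconst_mvar: "mconst.heval mvar f = f"
proof (induction f rule: mpoly_sum_induct)
  case (single m c)
  then show ?case by (simp add: mono_eval_mvar) (simp add: mconst_def mult_single)
qed auto

section \<open>Polynomials in a given set of variables\<close>

lemma mconst_mem: "mconst c \<in> mpolys I"
  by (auto simp: mpolys_def mconst_def)

lemma mvar_mem: "v \<in> I \<Longrightarrow> mvar v \<in> mpolys I"
  by (auto simp: mpolys_def mvar_def)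

lemma mpolys_mono: "I \<subseteq> J \<Longrightarrow> mpolys I \<subseteq> mpolys J"
  by (auto simp: mpolys_def)

interpretation mpolys: subring "mpolys I :: ('v::linorder, 'a::idom) mpoly set"
proof
  show "0 \<in> mpolys I" "1 \<in> mpolys I" by (auto simp: mpolys_def)
next
  fix a b :: "('v, 'a) mpoly" assume ab: "a \<in> mpolys I" "b \<in> mpolys I"
  show "a + b \<in> mpolys I" using ab keys_add[of a b] unfolding mpolys_def by blast
  show "a * b \<in> mpolys I"
    unfolding mpolys_def
  proof (intro CollectI ballI)
    fix m assume "m \<in> Poly_Mapping.keys (a * b)"
    then obtain m1 m2 where "m = m1 + m2" "m1 \<in> Poly_Mapping.keys a" "m2 \<in> Poly_Mapping.keys b"
      using keys_mult[of a b] by blast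
    then show "Poly_Mapping.keys m \<subseteq> I" using ab keys_add[of m1 m2] unfolding mpolys_def by blast
  qed
next
  fix a :: "('v, 'a) mpoly" assume "a \<in> mpolys I"
  then show "- a \<in> mpolys I" by (simp add: mpolys_def in_keys_iff)
qed

lemma mpolys_finite_vars:
  assumes "finite F"
  obtains J where "finite J" "F \<subseteq> mpolys J"
proof
  show "finite (\<Union>f\<in>F. \<Union>m\<in>Poly_Mapping.keys f. Poly_Mapping.keys m)" using assms by auto
  show "F \<subseteq> mpolys (\<Union>f\<in>F. \<Union>m\<in>Poly_Mapping.keys f. Poly_Mapping.keys m)" by (auto simp: mpolys_def)
qed

lemma mpolys_induct [consumes 1, case_names const var add mult]:
  fixes f :: "('v::linorder, 'a::idom) mpoly"
  assumes f: "f \<in> mpolys I"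
    and const: "\<And>c. P (mconst c)" and var: "\<And>v. v \<in> I \<Longrightarrow> P (mvar v)"
    and add: "\<And>f g. f \<in> mpolys I \<Longrightarrow> g \<in> mpolys I \<Longrightarrow> P f \<Longrightarrow> P g \<Longrightarrow> P (f + g)"
    and mult: "\<And>f g. f \<in> mpolys I \<Longrightarrow> g \<in> mpolys I \<Longrightarrow> P f \<Longrightarrow> P g \<Longrightarrow> P (f * g)"
  shows "P f"
proof -
  define Q where "Q f \<longleftrightarrow> f \<in> mpolys I \<and> P f" for f
  have c: "Q (mconst c)" for c using const mconst_mem by (auto simp: Q_def)
  have 0: "Q 0" "Q 1" using c[of 0] c[of 1] unfolding mconst.hom_zero mconst.hom_one by auto
  have m: "Q (f * g)" if "Q f" "Q g" for f g
    using that mult mpolys.mult_mem unfolding Q_def by blast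
  have a: "Q (f + g)" if "Q f" "Q g" for f g
    using that add mpolys.add_mem unfolding Q_def by blast
  have pw: "Q (mvar v ^ n)" if "v \<in> I" for v n
  proof -
    have "Q (mvar v)" using that var mvar_mem by (auto simp: Q_def)
    then show ?thesis by (induction n) (auto intro: m 0)
  qed
  have "Q (\<Prod>v\<in>A. mvar v ^ e v)" if "finite A" "A \<subseteq> I" for A e
    using that by (induction A rule: finite_induct) (auto intro: m pw 0)
  then have mono: "Q (mono_eval mvar m)" if "m \<in> Poly_Mapping.keys f" for m
    using that f unfolding mono_eval_def mpolys_def by auto
  have "Q (\<Sum>m\<in>A. mconst (Poly_Mapping.lookup f m) * mono_eval mvar m)"
    if "finite A" "A \<subseteq> Poly_Mapping.keys f" for A
    using that by (induction A rule: finite_induct) (auto intro: a m c mono 0)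
  then have "Q (mconst.heval mvar f)" unfolding mconst.heval_def by auto
  then show ?thesis by (simp add: heval_mconst_mvar Q_def)
qed

lemma adjoin_mvar: "adjoin (mpolys I) (mvar y) = (mpolys (insert y I) :: ('v::linorder, 'a::idom) mpoly set)"
proof
  show "adjoin (mpolys I) (mvar y) \<subseteq> (mpolys (insert y I) :: ('v, 'a) mpoly set)"
  proof
    fix f :: "('v, 'a) mpoly" assume "f \<in> adjoin (mpolys I) (mvar y)"
    then obtain p where p: "p \<in> polys_over (mpolys I)" "f = poly p (mvar y)" by (auto simp: adjoin_def)
    have "coeff p i \<in> mpolys (insert y I)" for i
      using p(1) mpolys_mono[of I "insert y I"] by (auto simp: polys_over_def)
    then show "f \<in> mpolys (insert y I)" unfolding p(2) poly_altdef
      by (intro mpolys.sum_mem mpolys.mult_mem mpolys.power_mem mvar_mem) auto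
  qed
  show "(mpolys (insert y I) :: ('v, 'a) mpoly set) \<subseteq> adjoin (mpolys I) (mvar y)"
  proof
    interpret A: subring "adjoin (mpolys I) (mvar y) :: ('v, 'a) mpoly set" by (rule mpolys.subring_adjoin)
    fix f :: "('v, 'a) mpoly" assume "f \<in> mpolys (insert y I)"
    then show "f \<in> adjoin (mpolys I) (mvar y)"
    proof (induction rule: mpolys_induct)
      case (const c)
      show ?case by (rule subsetD[OF mpolys.base_subset_adjoin mconst_mem])
    next
      case (var v)
      show ?case
      proof (cases "v = y")
        case True
        then show ?thesis using mpolys.poly_mem_adjoin[OF mpolys.X_mem, of "mvar y"] by simp
      next
        case False
        then have "mvar v \<in> (mpolys I :: ('v, 'a) mpoly set)" using var by (intro mvar_mem) auto
        then show ?thesis by (rule subsetD[OF mpolys.base_subset_adjoin])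
      qed
    qed (auto intro: A.add_mem A.mult_mem)
  qed
qed

text \<open>
  The homomorphism \<open>\<Theta>\<close> reads a polynomial as a polynomial in the single variable \<open>y\<close>;
  it is a left inverse of the evaluation at \<open>y\<close>.
\<close>
lemma transcendental_mvar:
  assumes "y \<notin> I"
  shows "transcendental_over (mpolys I :: ('v::linorder, 'a::idom) mpoly set) (mvar y)"
  unfolding transcendental_over_def
proof (intro ballI impI)
  fix p :: "('v, 'a) mpoly poly" assume p: "p \<in> polys_over (mpolys I)" "poly p (mvar y) = 0"
  interpret \<Theta>: coeff_hom "\<lambda>c::'a. [:mconst c :: ('v, 'a) mpoly:]"
    by unfold_locales (auto simp: mconst.hom_zero mconst.hom_one mconst.hom_add mconst.hom_mult one_pCons)
  define s where "s v = (if v = y then [:0, 1:] else [:mvar v :: ('v, 'a) mpoly:])" for v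
  have s_y: "s y = [:0, 1:]" by (simp add: s_def)
  have base: "\<Theta>.heval s c = [:c:]" if "c \<in> mpolys I" for c
    using that
    by (induction rule: mpolys_induct) (use assms in \<open>auto simp: s_def\<close>)
  have "\<Theta>.heval s (poly p (mvar y)) = p" if "\<forall>i. coeff p i \<in> mpolys I" for p
    using that
  proof (induction p)
    case (pCons a p)
    have "a \<in> mpolys I" "\<forall>i. coeff p i \<in> mpolys I"
      using pCons.prems[rule_format, of 0] pCons.prems[rule_format, of "Suc _"] by auto
    then show ?case using pCons.IH base by (simp add: s_y)
  qed simp
  from this[of p] have "\<Theta>.heval s 0 = p" using p by (simp add: polys_over_def)
  then show "p = 0" by simp
qed

text \<open>
  The factors involve only finitely many further variables. Remove these one at a time: a product has degree
  zero in a variable only if both factors have.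
\<close>
lemma saturated_mpolys: "saturated (mpolys I :: ('v::linorder, 'a::idom) mpoly set)"
  unfolding saturated_def
proof (intro allI impI)
  fix f g :: "('v, 'a) mpoly" assume fg: "f * g \<in> mpolys I" "f * g \<noteq> 0"
  obtain F where F: "finite F" "{f, g} \<subseteq> mpolys F" using mpolys_finite_vars[of "{f, g}"] by auto
  have "f \<in> mpolys I \<and> g \<in> mpolys I" if "finite F" "f \<in> mpolys (I \<union> F)" "g \<in> mpolys (I \<union> F)" for F
    using that
  proof (induction F rule: finite_induct)
    case (insert y F)
    show ?case
    proof (cases "y \<in> I \<union> F")
      case True
      then show ?thesis using insert by (simp add: insert_absorb)
    next
      case False
      have "f \<in> adjoin (mpolys (I \<union> F)) (mvar y)" "g \<in> adjoin (mpolys (I \<union> F)) (mvar y)"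
        using insert.prems by (simp_all add: adjoin_mvar)
      then obtain p q where p: "p \<in> polys_over (mpolys (I \<union> F))" "f = poly p (mvar y)"
        and q: "q \<in> polys_over (mpolys (I \<union> F))" "g = poly q (mvar y)"
        by (auto simp: adjoin_def)
      have m: "f * g \<in> mpolys (I \<union> F)" using fg(1) mpolys_mono[of I "I \<union> F"] by auto
      have "poly (p * q - [:f * g:]) (mvar y) = 0" using p q by simp
      moreover have "p * q - [:f * g:] \<in> polys_over (mpolys (I \<union> F))"
        using p q m by (intro mpolys.poly_diff_mem mpolys.poly_mult_mem mpolys.const_mem)
      ultimately have "p * q = [:f * g:]"
        using transcendental_mvar[OF False] unfolding transcendental_over_def by auto
      moreover have "p \<noteq> 0" "q \<noteq> 0" using p q fg by auto
      ultimately have "degree p = 0" "degree q = 0"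
        using degree_mult_eq[of p q] by auto
      then obtain c d where "p = [:c:]" "q = [:d:]" by (meson degree_eq_zeroE)
      then have "f \<in> mpolys (I \<union> F)" "g \<in> mpolys (I \<union> F)"
        using p q mpolys.coeff_mem[of p _ 0] mpolys.coeff_mem[of q _ 0] by auto
      then show ?thesis using insert.IH by blast
    qed
  qed simp
  moreover have "f \<in> mpolys (I \<union> F)" "g \<in> mpolys (I \<union> F)" using F mpolys_mono[of F "I \<union> F"] by auto
  ultimately show "f \<in> mpolys I" using F by blast
qed

lemma mpolys_empty: "(mpolys {} :: ('v, 'a::comm_ring_1) mpoly set) = range mconst"
proof
  show "range mconst \<subseteq> (mpolys {} :: ('v, 'a) mpoly set)" using mconst_mem by blast
  show "(mpolys {} :: ('v, 'a) mpoly set) \<subseteq> range mconst"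
  proof
    fix f :: "('v, 'a) mpoly" assume f: "f \<in> mpolys {}"
    have "f = mconst (Poly_Mapping.lookup f 0)"
    proof (rule poly_mapping_eqI)
      fix k
      have "Poly_Mapping.lookup f k = 0" if "k \<noteq> 0"
        using f that unfolding mpolys_def by (metis (mono_tags, lifting) in_keys_iff keys_eq_empty mem_Collect_eq subset_empty)
      then show "Poly_Mapping.lookup f k = Poly_Mapping.lookup (mconst (Poly_Mapping.lookup f 0)) k"
        by (auto simp: mconst_def lookup_single when_def)
    qed
    then show "f \<in> range mconst" by blast
  qed
qed

lemma mconst_unit: "(c::'a::field) \<noteq> 0 \<Longrightarrow> mconst c dvd 1"
  by (rule dvdI[of _ _ "mconst (inverse c)"]) (simp flip: mconst.hom_mult mconst.hom_one)

lemma noetherian_constants: "noetherian (mpolys {} :: ('v::linorder, 'a::field) mpoly set)"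
  unfolding noetherian_def
proof (intro allI impI)
  fix I :: "nat \<Rightarrow> ('v, 'a) mpoly set"
  assume I: "(\<forall>k. ideal_of (mpolys {}) (I k)) \<and> incseq I"
  show "\<exists>K. \<forall>k\<ge>K. I k = I K"
  proof (cases "\<exists>K. \<exists>f\<in>I K. f \<noteq> 0")
    case True
    then obtain K f where f: "f \<in> I K" "f \<noteq> 0" by auto
    have full: "I k = mpolys {}" if "k \<ge> K" for k
    proof
      have J: "ideal_of (mpolys {}) (I k)" "f \<in> I k" using I f that by (auto simp: incseq_def)
      then show "I k \<subseteq> mpolys {}" unfolding ideal_of_def by blast
      obtain c where c: "f = mconst c" using J by (auto simp: ideal_of_def mpolys_empty)
      have "c \<noteq> 0" using c f mconst.hom_zero by auto
      show "mpolys {} \<subseteq> I k"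
      proof
        fix g :: "('v, 'a) mpoly" assume "g \<in> mpolys {}"
        then obtain d where "g = mconst d" by (auto simp: mpolys_empty)
        then have "g = mconst (d / c) * f" using \<open>c \<noteq> 0\<close> by (simp add: c flip: mconst.hom_mult)
        then show "g \<in> I k" using J mconst_mem unfolding ideal_of_def by blast
      qed
    qed
    then show ?thesis by (intro exI[of _ K]) auto
  next
    case False
    then have "I k = {0}" for k using I unfolding ideal_of_def by blast
    then show ?thesis by simp
  qed
qed

lemma noetherian_mpolys:
  "finite I \<Longrightarrow> noetherian (mpolys I :: ('v::linorder, 'a::field) mpoly set)"
proof (induction I rule: finite_induct)
  case (insert y I)
  then show ?case using mpolys.noetherian_adjoin[OF insert.IH, of "mvar y"] by (simp add: adjoin_mvar)
qed (rule noetherian_constants)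

lemma factorial_mpolys:
  "finite I \<Longrightarrow> factorial_subring (mpolys I :: ('v::linorder, 'a::field) mpoly set)"
  by unfold_locales (auto simp: saturated_mpolys noetherian_mpolys)

lemma irreducibles_prime_mpolys:
  "finite I \<Longrightarrow> irreducibles_prime (mpolys I :: ('v::linorder, 'a::field) mpoly set)"
proof (induction I rule: finite_induct)
  case empty
  have "\<not> irreducible f" if f: "f \<in> mpolys {}" for f :: "('v, 'a) mpoly"
  proof -
    obtain c where c: "f = mconst c" using f unfolding mpolys_empty by blast
    show ?thesis
    proof (cases "c = 0")
      case True then show ?thesis by (simp add: c mconst.hom_zero)
    next
      case False then show ?thesis using mconst_unit[OF False] by (auto simp: c irreducible_def)
    qed
  qed
  then show ?case unfolding irreducibles_prime_def by blast
next
  case (insert y I)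
  interpret factorial_subring "mpolys I :: ('v::linorder, 'a::field) mpoly set"
    using insert by (intro factorial_mpolys)
  interpret transcendental_extension "mpolys I :: ('v::linorder, 'a::field) mpoly set" "mvar y"
    by unfold_locales (use insert in \<open>auto simp: transcendental_mvar adjoin_mvar saturated_mpolys\<close>)
  show ?case using irreducibles_prime_adjoin by (simp add: adjoin_mvar)
qed

lemma mpoly_elimination:
  fixes f g :: "('v::linorder, 'a::field) mpoly"
  assumes I: "finite I" "y \<notin> I" and f: "f \<in> mpolys (insert y I)" "irreducible f"
    and g: "g \<in> mpolys (insert y I)" "\<not> f dvd g"
  shows "\<exists>c\<in>mpolys I. c \<noteq> 0 \<and> (\<exists>a b. c = a * f + b * g)"
proof -
  interpret factorial_subring "mpolys I :: ('v::linorder, 'a::field) mpoly set"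
    using I by (intro factorial_mpolys)
  interpret transcendental_extension "mpolys I :: ('v::linorder, 'a::field) mpoly set" "mvar y"
    by unfold_locales
      (use I in \<open>auto simp: transcendental_mvar adjoin_mvar saturated_mpolys irreducibles_prime_mpolys\<close>)
  obtain p q where p: "p \<in> polys_over (mpolys I)" "f = poly p (mvar y)"
    and q: "q \<in> polys_over (mpolys I)" "g = poly q (mvar y)"
    using f g by (auto simp: adjoin_def simp flip: adjoin_mvar)
  show ?thesis
  proof (cases "degree p = 0")
    case True
    then obtain c where "p = [:c:]" by (meson degree_eq_zeroE)
    then have "f \<in> mpolys I" using p mpolys.coeff_mem[of p I 0] by simp
    then show ?thesis using f by (intro bexI[of _ f] conjI exI[of _ 1] exI[of _ 0]) auto
  next
    case False
    then show ?thesis using elimination[of p q] p q f g by auto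
  qed
qed

section \<open>Partial derivatives\<close>

lemma mpderiv_superset:
  assumes "finite A" "Poly_Mapping.keys f \<subseteq> A"
  shows "mpderiv v f = (\<Sum>m\<in>A. Poly_Mapping.single (m - Poly_Mapping.single v 1)
       (of_nat (Poly_Mapping.lookup m v) * Poly_Mapping.lookup f m))"
  unfolding mpderiv_def using assms
  by (intro sum.mono_neutral_left) (auto simp: not_in_keys_iff_lookup_eq_zero)

lemma mpderiv_add: "mpderiv v (f + g) = mpderiv v f + mpderiv v g"
proof -
  have "Poly_Mapping.keys (f + g) \<subseteq> Poly_Mapping.keys f \<union> Poly_Mapping.keys g" by (rule keys_add)
  then show ?thesis
    by (subst (1 2 3) mpderiv_superset[of "Poly_Mapping.keys f \<union> Poly_Mapping.keys g"])
       (auto simp: lookup_add algebra_simps sum.distrib single_add)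
qed

lemma mpderiv_0 [simp]: "mpderiv v 0 = 0"
  by (simp add: mpderiv_def)

lemma mpderiv_single: "mpderiv v (Poly_Mapping.single m c) =
    Poly_Mapping.single (m - Poly_Mapping.single v 1) (of_nat (Poly_Mapping.lookup m v) * c)"
  by (subst mpderiv_superset[of "{m}"]) auto

lemma mpderiv_mult:
  fixes f g :: "('v, 'a::comm_ring_1) mpoly"
  shows "mpderiv v (f * g) = mpderiv v f * g + f * mpderiv v g"
proof (induction f rule: mpoly_sum_induct)
  case (single m c)
  show ?case
  proof (induction g rule: mpoly_sum_induct)
    case (single m' c')
    define e where "e = Poly_Mapping.single v (1::nat)"
    have shift: "a + b - e = (a - e) + b" if "Poly_Mapping.lookup a v \<noteq> 0" for a b
      using that by (intro poly_mapping_eqI) (auto simp: e_def lookup_add lookup_minus lookup_single when_def)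
    have 1: "Poly_Mapping.single (m + m' - e) (of_nat (Poly_Mapping.lookup m v) * c * c')
        = Poly_Mapping.single (m - e + m') (of_nat (Poly_Mapping.lookup m v) * c * c')"
      by (cases "Poly_Mapping.lookup m v = 0") (auto simp: shift)
    have 2: "Poly_Mapping.single (m + m' - e) (of_nat (Poly_Mapping.lookup m' v) * c * c')
        = Poly_Mapping.single (m + (m' - e)) (of_nat (Poly_Mapping.lookup m' v) * c * c')"
      using shift[of m' m] by (cases "Poly_Mapping.lookup m' v = 0") (auto simp: add.commute)
    have e: "Poly_Mapping.single v (Suc 0) = e" by (simp add: e_def)
    show ?case
      using 1 2
      by (simp add: mpderiv_single mult_single lookup_add algebra_simps single_add e)
  qed (auto simp: mpderiv_add algebra_simps)
qed (auto simp: mpderiv_add algebra_simps)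

lemma mpderiv_mvar: "mpderiv v (mvar w) = (if v = w then 1 else 0)"
  by (auto simp: mvar_def mpderiv_single lookup_single when_def)

lemma mpderiv_mconst [simp]: "mpderiv v (mconst c) = 0"
  by (simp add: mconst_def mpderiv_single)

lemma derivation_mpderiv: "derivation (mpderiv v)"
  by (simp add: derivation_def mpderiv_add mpderiv_mult)

lemma mpderiv_mem:
  fixes f :: "('v::linorder, 'a::idom) mpoly"
  assumes "f \<in> mpolys I"
  shows "mpderiv v f \<in> mpolys I"
  using assms
  by (induction rule: mpolys_induct)
     (auto simp: mpderiv_add mpderiv_mult mpderiv_mvar
       intro: mpolys.add_mem mpolys.mult_mem mpolys.zero_mem mpolys.one_mem)

lemma mpderiv_absent:
  fixes f :: "('v::linorder, 'a::idom) mpoly"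
  assumes "f \<in> mpolys I" "v \<notin> I"
  shows "mpderiv v f = 0"
  using assms by (induction rule: mpolys_induct) (auto simp: mpderiv_add mpderiv_mult mpderiv_mvar)

lemma meval_partial_derivative:
  fixes f :: "('v::linorder, real) mpoly"
  shows "((\<lambda>t. meval (u(i := t)) f) has_real_derivative meval u (mpderiv i f)) (at (u i))"
proof -
  have "f \<in> mpolys UNIV" by (simp add: mpolys_def)
  then show ?thesis
  proof (induction rule: mpolys_induct)
    case (var v)
    show ?case by (cases "v = i") (auto simp: mpderiv_mvar)
  next
    case (add f g)
    then show ?case by (auto simp: mpderiv_add intro!: derivative_eq_intros)
  next
    case (mult f g)
    moreover have "(\<lambda>a. if a = i then u i else u a) = u" by auto
    ultimately show ?case
      by (auto simp: mpderiv_mult algebra_simps intro!: derivative_eq_intros)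
  qed auto
qed

lemma meval_substitution: "meval x (mconst.heval s f) = meval (\<lambda>v. meval x (s v)) f"
  by (induction f rule: mpoly_sum_induct) (auto simp: mono_eval_def)

lemma substitution_chain_rule:
  fixes f :: "('v::linorder, 'a::idom) mpoly" and s :: "'v \<Rightarrow> ('w::linorder, 'a) mpoly"
  assumes "derivation d" "\<And>c. d (mconst c) = 0" "finite I" "f \<in> mpolys I"
  shows "d (mconst.heval s f) = (\<Sum>i\<in>I. mconst.heval s (mpderiv i f) * d (s i))"
  using assms(4)
proof (induction rule: mpolys_induct)
  case (var v)
  have "(\<Sum>i\<in>I. mconst.heval s (mpderiv i (mvar v)) * d (s i)) = (\<Sum>i\<in>I. if i = v then d (s v) else 0)"
    by (intro sum.cong) (auto simp: mpderiv_mvar)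
  then show ?case using var \<open>finite I\<close> by simp
next
  case (add f g)
  then show ?case
    using assms(1) by (simp add: derivation_def mpderiv_add distrib_right sum.distrib)
next
  case (mult f g)
  then show ?case
    using assms(1)
    by (simp add: derivation_def mpderiv_mult sum.distrib sum_distrib_left sum_distrib_right algebra_simps)
qed (use assms in auto)

section \<open>Zeros\<close>

lemma meval_const_poly:
  assumes "p \<in> polys_over (mpolys I)" "\<And>v. v \<in> I \<Longrightarrow> x v = x' v"
  shows "meval x (poly p (mvar y)) = poly (map_poly (meval x') p) (x y)"
  using assms(1)
proof (induction p)
  case (pCons a p)
  have "a \<in> mpolys I" "p \<in> polys_over (mpolys I)"
    using pCons.prems unfolding polys_over_def by (auto simp: coeff_pCons split: nat.splits)
  then show ?case using pCons.IH meval.heval_cong[of a I x x'] assms(2)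
    by (simp add: map_poly_pCons)
qed simp

text \<open>
  Make the leading coefficient in one variable nonzero by induction, then avoid the finitely many roots in
  that variable.
\<close>
lemma nonzero_on_real_box:
  fixes f :: "('v::linorder, complex) mpoly" and p :: "'v \<Rightarrow> real"
  assumes "finite I" "f \<in> mpolys I" "f \<noteq> 0" "\<eta> > 0"
  shows "\<exists>w. (\<forall>v. \<bar>w v - p v\<bar> < \<eta>) \<and> meval (\<lambda>v. complex_of_real (w v)) f \<noteq> 0"
  using assms(1-3)
proof (induction I arbitrary: f rule: finite_induct)
  case empty
  then obtain c where c: "f = mconst c" by (auto simp: mpolys_empty)
  then have "c \<noteq> 0" using empty mconst.hom_zero by auto
  then show ?case using c \<open>\<eta> > 0\<close> by (intro exI[of _ p]) auto
next
  case (insert y I)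
  obtain q where q: "q \<in> polys_over (mpolys I)" "f = poly q (mvar y)"
    using insert.prems by (auto simp: adjoin_def simp flip: adjoin_mvar)
  have "q \<noteq> 0" using q insert.prems by auto
  then obtain w where w: "\<forall>v. \<bar>w v - p v\<bar> < \<eta>" "meval (\<lambda>v. complex_of_real (w v)) (lead_coeff q) \<noteq> 0"
    using insert.IH[of "lead_coeff q"] q mpolys.coeff_mem by auto
  define r where "r = map_poly (meval (\<lambda>v. complex_of_real (w v))) q"
  have "coeff r (degree q) \<noteq> 0" unfolding r_def using w by (subst coeff_map_poly) auto
  then have "r \<noteq> 0" by auto
  then have "finite {x. poly r x = 0}" by (rule poly_roots_finite)
  then have "finite (complex_of_real -` {x. poly r x = 0})"
    by (intro finite_vimageI) (auto simp: inj_on_def)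
  moreover have "infinite {p y - \<eta><..<p y + \<eta>}" using \<open>\<eta> > 0\<close> by simp
  ultimately obtain t where t: "t \<in> {p y - \<eta><..<p y + \<eta>}" "poly r (complex_of_real t) \<noteq> 0"
    by (metis (mono_tags, lifting) finite_subset mem_Collect_eq subsetI vimageI2)
  have "meval (\<lambda>v. complex_of_real ((w(y := t)) v)) f = poly r (complex_of_real ((w(y := t)) y))"
    unfolding q(2) r_def by (rule meval_const_poly[OF q(1)]) (use insert.hyps in auto)
  then show ?case using t w by (intro exI[of _ "w(y := t)"]) auto
qed

lemma meval_tendsto:
  fixes x :: "nat \<Rightarrow> 'v \<Rightarrow> 'a::{real_normed_field}"
  assumes "\<And>v. (\<lambda>k. x k v) \<longlonglongrightarrow> l v"
  shows "(\<lambda>k. meval (x k) f) \<longlonglongrightarrow> meval l f"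
  unfolding meval_def by (intro tendsto_intros assms)

section \<open>The Zariski topology\<close>

definition vanishing :: "'v set \<Rightarrow> ('v \<Rightarrow> complex) set \<Rightarrow> ('v, complex) mpoly set" where
  "vanishing I S = {f \<in> mpolys I. \<forall>x\<in>S. meval x f = 0}"

text \<open>
  Being generated by a family that is closed under finite intersections, the topology has the complements of
  hypersurfaces as a basis.
\<close>
lemma openin_zariski:
  fixes I :: "'v::linorder set"
  shows "openin (zariski I) U \<longleftrightarrow> U \<subseteq> affine_space I \<and>
    (\<forall>x\<in>U. \<exists>f\<in>vanishing I (affine_space I - U). meval x f \<noteq> 0)"
proof
  assume "openin (zariski I) U"
  then have "generate_topology_on ((\<lambda>f. affine_space I - hypersurface I f) ` mpolys I) U"
    unfolding zariski_def by (simp add: openin_topology_generated_by_iff)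
  then show "U \<subseteq> affine_space I \<and> (\<forall>x\<in>U. \<exists>f\<in>vanishing I (affine_space I - U). meval x f \<noteq> 0)"
  proof (induction rule: generate_topology_on.induct)
    case (Int a b)
    have "\<exists>f\<in>vanishing I (affine_space I - a \<inter> b). meval x f \<noteq> 0" if x: "x \<in> a \<inter> b" for x
    proof -
      obtain f where "f \<in> vanishing I (affine_space I - a)" "meval x f \<noteq> 0" using Int x by blast
      moreover obtain g where "g \<in> vanishing I (affine_space I - b)" "meval x g \<noteq> 0" using Int x by blast
      ultimately show ?thesis
        by (intro bexI[of _ "f * g"]) (auto simp: vanishing_def intro: mpolys.mult_mem)
    qed
    then show ?case using Int by blast
  next
    case (UN K)
    then show ?case unfolding vanishing_def by fastforce
  next
    case (Basis s)
    then show ?case by (auto simp: vanishing_def hypersurface_def)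
  qed auto
next
  assume U: "U \<subseteq> affine_space I \<and> (\<forall>x\<in>U. \<exists>f\<in>vanishing I (affine_space I - U). meval x f \<noteq> 0)"
  have eq: "U = \<Union>((\<lambda>f. affine_space I - hypersurface I f) ` vanishing I (affine_space I - U))"
    using U by (fastforce simp: vanishing_def hypersurface_def)
  have "openin (zariski I) (affine_space I - hypersurface I f)" if "f \<in> mpolys I" for f
    unfolding zariski_def by (rule topology_generated_by_Basis) (use that in auto)
  then show "openin (zariski I) U"
    by (subst eq, intro openin_Union) (auto simp: vanishing_def)
qed

lemma topspace_zariski [simp]: "topspace (zariski (I :: 'v::linorder set)) = affine_space I"
proof
  show "topspace (zariski I) \<subseteq> affine_space I" unfolding topspace_def using openin_zariski by blast
  have "openin (zariski I) (affine_space I)"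
    unfolding openin_zariski by (auto simp: vanishing_def intro!: bexI[of _ 1] mpolys.one_mem)
  then show "affine_space I \<subseteq> topspace (zariski I)" by (rule openin_subset)
qed

lemma closedin_zariski:
  fixes I :: "'v::linorder set"
  shows "closedin (zariski I) Z \<longleftrightarrow> Z \<subseteq> affine_space I \<and>
    (\<forall>x\<in>affine_space I. (\<forall>f\<in>vanishing I Z. meval x f = 0) \<longrightarrow> x \<in> Z)"
proof (cases "Z \<subseteq> affine_space I")
  case True
  then have "affine_space I - (affine_space I - Z) = Z" by auto
  then show ?thesis using True unfolding closedin_def openin_zariski by auto
qed (auto simp: closedin_def)

lemma closure_zariski:
  fixes I :: "'v::linorder set"
  assumes "S \<subseteq> affine_space I"
  shows "zariski I closure_of S = {x \<in> affine_space I. \<forall>f\<in>vanishing I S. meval x f = 0}" (is "_ = ?Z")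
proof (rule closure_of_unique)
  show "S \<subseteq> ?Z" using assms by (auto simp: vanishing_def)
  have "vanishing I S \<subseteq> vanishing I ?Z" by (auto simp: vanishing_def)
  then show "closedin (zariski I) ?Z" unfolding closedin_zariski by blast
  fix T assume T: "S \<subseteq> T" "closedin (zariski I) T"
  then have "vanishing I T \<subseteq> vanishing I S" by (auto simp: vanishing_def)
  then show "?Z \<subseteq> T" using T(2) unfolding closedin_zariski by blast
qed

lemma vanishing_between:
  fixes I :: "'v::linorder set"
  assumes "S \<subseteq> affine_space I" "S \<subseteq> T" "T \<subseteq> zariski I closure_of S"
  shows "vanishing I T = vanishing I S"
  using assms(2,3) unfolding closure_zariski[OF assms(1)] by (fastforce simp: vanishing_def)

lemma closedin_hypersurface:
  fixes I :: "'v::linorder set"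
  assumes "f \<in> mpolys I"
  shows "closedin (zariski I) (hypersurface I f)"
  unfolding closedin_zariski using assms by (auto simp: hypersurface_def vanishing_def)

lemma vanishing_ideal: "ideal_of (mpolys I) (vanishing (I :: 'v::linorder set) S)"
  unfolding ideal_of_def vanishing_def
  by (auto intro: mpolys.zero_mem mpolys.add_mem mpolys.mult_mem)

section \<open>Irreducible sets\<close>

lemma irreducible_in_zariski:
  fixes I :: "'v::linorder set"
  shows "irreducible_in (zariski I) S \<longleftrightarrow> S \<subseteq> affine_space I \<and> S \<noteq> {} \<and>
    (\<forall>f\<in>mpolys I. \<forall>g\<in>mpolys I. f * g \<in> vanishing I S \<longrightarrow> f \<in> vanishing I S \<or> g \<in> vanishing I S)"
    (is "_ \<longleftrightarrow> ?R")
proof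
  assume irr: "irreducible_in (zariski I) S"
  have "f \<in> vanishing I S \<or> g \<in> vanishing I S"
    if "f \<in> mpolys I" "g \<in> mpolys I" "f * g \<in> vanishing I S" for f g
  proof -
    have "S \<subseteq> hypersurface I f \<union> hypersurface I g"
      using irr that by (auto simp: irreducible_in_def vanishing_def hypersurface_def)
    then have "S \<subseteq> hypersurface I f \<or> S \<subseteq> hypersurface I g"
      using irr that closedin_hypersurface unfolding irreducible_in_def by blast
    then show ?thesis using that by (auto simp: vanishing_def hypersurface_def)
  qed
  then show ?R using irr by (auto simp: irreducible_in_def)
next
  assume R: ?R
  have "S \<subseteq> A \<or> S \<subseteq> B"
    if AB: "closedin (zariski I) A" "closedin (zariski I) B" "S \<subseteq> A \<union> B" for A B
  proof (rule ccontr)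
    assume "\<not> ?thesis"
    then obtain x y where xy: "x \<in> S" "x \<notin> A" "y \<in> S" "y \<notin> B" by blast
    obtain f where f: "f \<in> vanishing I A" "meval x f \<noteq> 0"
      using AB(1) xy R unfolding closedin_zariski by blast
    obtain g where g: "g \<in> vanishing I B" "meval y g \<noteq> 0"
      using AB(2) xy R unfolding closedin_zariski by blast
    have "f * g \<in> vanishing I S" using f g AB(3) by (auto simp: vanishing_def intro: mpolys.mult_mem)
    moreover have "f \<in> mpolys I" "g \<in> mpolys I" using f g by (auto simp: vanishing_def)
    ultimately have "f \<in> vanishing I S \<or> g \<in> vanishing I S" using R by blast
    then show False using f(2) g(2) xy by (auto simp: vanishing_def)
  qed
  then show "irreducible_in (zariski I) S" using R by (simp add: irreducible_in_def)
qed

lemma irreducible_between_closure: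
  fixes I :: "'v::linorder set"
  assumes "irreducible_in (zariski I) S" "S \<subseteq> T" "T \<subseteq> zariski I closure_of S"
  shows "irreducible_in (zariski I) T"
proof -
  have S: "S \<subseteq> affine_space I" using assms(1) by (simp add: irreducible_in_zariski)
  have "T \<subseteq> affine_space I" using assms(3) closure_of_subset_topspace[of "zariski I" S] by auto
  moreover have "T \<noteq> {}" using assms by (auto simp: irreducible_in_zariski)
  ultimately show ?thesis
    using assms(1) vanishing_between[OF S assms(2,3)] unfolding irreducible_in_zariski by simp
qed

lemma meval_restrict:
  fixes f :: "('v, 'a::comm_ring_1) mpoly"
  assumes "f \<in> mpolys I"
  shows "meval (restrict p I) f = meval p f"
  by (rule meval.heval_cong[OF assms]) auto

lemma irreducible_projection:
  fixes I :: "'v::linorder set"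
  assumes "irreducible_in (zariski J) S" "I \<subseteq> J"
  shows "irreducible_in (zariski I) ((\<lambda>p. restrict p I) ` S)"
proof -
  have sub: "mpolys I \<subseteq> (mpolys J :: ('v, complex) mpoly set)" using mpolys_mono[OF assms(2)] .
  have "f \<in> vanishing I ((\<lambda>p. restrict p I) ` S) \<longleftrightarrow> f \<in> vanishing J S" if "f \<in> mpolys I" for f
    using that sub by (auto simp: vanishing_def meval_restrict)
  then show ?thesis
    using assms sub unfolding irreducible_in_zariski
    by (auto simp: affine_space_def mpolys.mult_mem subset_iff)
qed

lemma irreducible_in_finite_Union:
  assumes "irreducible_in T S" "finite \<A>" "\<And>A. A \<in> \<A> \<Longrightarrow> closedin T A" "S \<subseteq> \<Union>\<A>"
  shows "\<exists>A\<in>\<A>. S \<subseteq> A"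
  using assms(2-4)
proof (induction \<A> rule: finite_induct)
  case empty
  then show ?case using assms(1) by (simp add: irreducible_in_def)
next
  case (insert A \<A>)
  have "closedin T (\<Union>\<A>)" using insert by (intro closedin_Union) auto
  then have "S \<subseteq> A \<or> S \<subseteq> \<Union>\<A>"
    using insert.prems assms(1) unfolding irreducible_in_def by auto
  then show ?case using insert by blast
qed

text \<open>
  Noetherian induction: when a reducible set is split into two proper relatively closed parts, both parts have
  larger vanishing ideals.
\<close>
lemma finite_irreducible_cover:
  fixes I :: "'v::linorder set"
  assumes "finite I" "S \<subseteq> affine_space I"
  shows "\<exists>\<C>. finite \<C> \<and> \<Union>\<C> = S \<and> (\<forall>C\<in>\<C>. irreducible_in (zariski I) C)"
proof -
  define r where "r = {(S', S :: ('v \<Rightarrow> complex) set). vanishing I S \<subset> vanishing I S'}"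
  have "wf r"
    unfolding wf_iff_no_infinite_down_chain
  proof (rule notI, elim exE)
    fix s assume "\<forall>i. (s (Suc i), s i) \<in> r"
    then have s: "\<And>i. vanishing I (s i) \<subset> vanishing I (s (Suc i))" by (simp add: r_def)
    have "noetherian (mpolys I :: ('v, complex) mpoly set)" by (rule noetherian_mpolys[OF assms(1)])
    moreover have "incseq (\<lambda>i. vanishing I (s i))" unfolding incseq_Suc_iff using s by blast
    ultimately obtain K where K: "\<forall>k\<ge>K. vanishing I (s k) = vanishing I (s K)"
      using vanishing_ideal unfolding noetherian_def by (metis (mono_tags, lifting))
    have "vanishing I (s (Suc K)) = vanishing I (s K)" by (rule K[rule_format]) simp
    then show False using s by blast
  qed
  then show ?thesis using assms(2)
  proof (induction S rule: wf_induct_rule)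
    case (less S)
    show ?case
    proof (cases "S = {} \<or> irreducible_in (zariski I) S")
      case True
      then show ?thesis by (elim disjE) (auto intro: exI[of _ "{}"] exI[of _ "{S}"])
    next
      case False
      then obtain A B where AB: "closedin (zariski I) A" "closedin (zariski I) B" "S \<subseteq> A \<union> B"
          "\<not> S \<subseteq> A" "\<not> S \<subseteq> B"
        using less.prems unfolding irreducible_in_def by auto
      have *: "\<exists>\<C>. finite \<C> \<and> \<Union>\<C> = S \<inter> Z \<and> (\<forall>C\<in>\<C>. irreducible_in (zariski I) C)"
        if Z: "closedin (zariski I) Z" "\<not> S \<subseteq> Z" for Z
      proof -
        obtain x where x: "x \<in> S" "x \<notin> Z" using Z by blast
        then obtain f where f: "f \<in> vanishing I Z" "meval x f \<noteq> 0"
          using Z(1) less.prems unfolding closedin_zariski by blast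
        have "f \<in> vanishing I (S \<inter> Z)" "f \<notin> vanishing I S" using f x by (auto simp: vanishing_def)
        moreover have "vanishing I S \<subseteq> vanishing I (S \<inter> Z)" by (auto simp: vanishing_def)
        ultimately have rel: "(S \<inter> Z, S) \<in> r" by (auto simp: r_def)
        have "S \<inter> Z \<subseteq> affine_space I" using less.prems by blast
        then show ?thesis by (rule less.IH[OF rel])
      qed
      from *[OF AB(1,4)] obtain \<C>
        where C: "finite \<C> \<and> \<Union>\<C> = S \<inter> A \<and> (\<forall>C\<in>\<C>. irreducible_in (zariski I) C)" ..
      from *[OF AB(2,5)] obtain \<D>
        where D: "finite \<D> \<and> \<Union>\<D> = S \<inter> B \<and> (\<forall>C\<in>\<D>. irreducible_in (zariski I) C)" ..
      have "\<Union>(\<C> \<union> \<D>) = (S \<inter> A) \<union> (S \<inter> B)" using C D by (simp only: Union_Un_distrib)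
      also have "\<dots> = S" using AB(3) by blast
      finally have "\<Union>(\<C> \<union> \<D>) = S" .
      moreover have "finite (\<C> \<union> \<D>)" "\<forall>C\<in>\<C> \<union> \<D>. irreducible_in (zariski I) C" using C D by auto
      ultimately show ?thesis by blast
    qed
  qed
qed

text \<open>
  Replace the members of a finite irreducible cover of \<open>Y\<close> by their closures in \<open>Y\<close>. Every irreducible subset of \<open>Y\<close> lies
  in one of these, so the components are the maximal ones among them.
\<close>
lemma irreducible_components_zariski:
  fixes I :: "'v::linorder set"
  assumes "finite I" and Y: "Y \<subseteq> affine_space I"
  shows "finite (irreducible_components (zariski I) Y)"
    and "\<Union>(irreducible_components (zariski I) Y) = Y"
proof -
  obtain \<C> where C: "finite \<C>" "\<Union>\<C> = Y" "\<And>C. C \<in> \<C> \<Longrightarrow> irreducible_in (zariski I) C"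
    using finite_irreducible_cover[OF assms] by blast
  define cl where "cl C = zariski I closure_of C \<inter> Y" for C
  have sub: "C \<subseteq> cl C" if "C \<in> \<C>" for C
    using that C closure_of_subset[of C "zariski I"] Y unfolding cl_def by auto
  have irr: "irreducible_in (zariski I) (cl C)" if "C \<in> \<C>" for C
    by (rule irreducible_between_closure[OF C(3)[OF that] sub[OF that]]) (simp add: cl_def)
  have absorb: "\<exists>C\<in>\<C>. D \<subseteq> cl C" if D: "D \<subseteq> Y" "irreducible_in (zariski I) D" for D
  proof -
    have "D \<subseteq> \<Union>((\<lambda>C. zariski I closure_of C) ` \<C>)"
      using D(1) C(2) sub unfolding cl_def by blast
    then have "\<exists>A\<in>(\<lambda>C. zariski I closure_of C) ` \<C>. D \<subseteq> A"
      using C(1) by (intro irreducible_in_finite_Union[OF D(2)]) auto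
    then show ?thesis using D(1) by (auto simp: cl_def)
  qed
  have "irreducible_components (zariski I) Y \<subseteq> cl ` \<C>"
  proof
    fix K assume "K \<in> irreducible_components (zariski I) Y"
    then have K: "K \<subseteq> Y" "irreducible_in (zariski I) K"
      and max: "\<And>D. K \<subseteq> D \<Longrightarrow> D \<subseteq> Y \<Longrightarrow> irreducible_in (zariski I) D \<Longrightarrow> D = K"
      unfolding irreducible_components_def by auto
    obtain C where "C \<in> \<C>" "K \<subseteq> cl C" using absorb[OF K] by blast
    then show "K \<in> cl ` \<C>" using max[of "cl C"] irr by (auto simp: cl_def)
  qed
  then show "finite (irreducible_components (zariski I) Y)" using C(1) finite_subset by blast
  have "p \<in> \<Union>(irreducible_components (zariski I) Y)" if p: "p \<in> Y" for p
  proof -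
    obtain C where pC: "C \<in> \<C>" "p \<in> C" using p C by blast
    obtain M where M: "M \<in> cl ` \<C>" "cl C \<subseteq> M" "\<forall>M'\<in>cl ` \<C>. M \<subseteq> M' \<longrightarrow> M = M'"
      using finite_has_maximal2[of "cl ` \<C>" "cl C"] C(1) pC by blast
    have "M \<in> irreducible_components (zariski I) Y"
      unfolding irreducible_components_def
    proof (intro CollectI conjI allI impI)
      show "M \<subseteq> Y" "irreducible_in (zariski I) M" using M(1) irr by (auto simp: cl_def)
      fix D assume D: "M \<subseteq> D \<and> D \<subseteq> Y \<and> irreducible_in (zariski I) D"
      then obtain C' where "C' \<in> \<C>" "D \<subseteq> cl C'" using absorb by blast
      then show "D = M" using M(3) D by blast
    qed
    then show ?thesis using M(2) sub pC by blast
  qed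
  moreover have "\<Union>(irreducible_components (zariski I) Y) \<subseteq> Y"
    unfolding irreducible_components_def by blast
  ultimately show "\<Union>(irreducible_components (zariski I) Y) = Y" by blast
qed

section \<open>Codimension one\<close>

lemma nonzero_point:
  fixes f :: "('v::linorder, complex) mpoly"
  assumes "finite I" "f \<in> mpolys I" "f \<noteq> 0"
  shows "\<exists>x\<in>affine_space I. meval x f \<noteq> 0"
proof -
  obtain w :: "'v \<Rightarrow> real" where "meval (\<lambda>v. complex_of_real (w v)) f \<noteq> 0"
    using nonzero_on_real_box[OF assms, of 1 "\<lambda>_. 0"] by auto
  then show ?thesis
    by (intro bexI[of _ "restrict (\<lambda>v. complex_of_real (w v)) I"])
       (auto simp: meval_restrict[OF assms(2)] affine_space_def)
qed

lemma vanishing_affine_space: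
  fixes I :: "'v::linorder set"
  assumes "finite I"
  shows "vanishing I (affine_space I) = {0}"
  using nonzero_point[OF assms] by (auto simp: vanishing_def mpolys.zero_mem)

lemma affine_space_irreducible:
  fixes I :: "'v::linorder set"
  assumes "finite I"
  shows "irreducible_in (zariski I) (affine_space I)"
proof -
  have "(affine_space I :: ('v \<Rightarrow> complex) set) \<noteq> {}" by (auto simp: affine_space_def PiE_eq_empty_iff)
  then show ?thesis unfolding irreducible_in_zariski vanishing_affine_space[OF assms] by auto
qed

lemma irreducible_vanishing_factor:
  fixes I :: "'v::linorder set"
  assumes I: "finite I" and V: "irreducible_in (zariski I) V" and h: "h \<in> vanishing I V" "h \<noteq> 0"
  shows "\<exists>f\<in>vanishing I V. irreducible f"
proof -
  interpret factorial_subring "mpolys I :: ('v, complex) mpoly set" by (rule factorial_mpolys[OF I])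
  have "h \<in> mpolys I" using h by (simp add: vanishing_def)
  then show ?thesis using h(2,1)
  proof (induction h rule: factor_induct)
    case (unit u)
    then obtain w where w: "1 = u * w" by auto
    obtain x where "x \<in> V" using V by (auto simp: irreducible_in_zariski)
    then have "meval x u = 0" using unit by (simp add: vanishing_def)
    then show ?case using arg_cong[OF w, of "meval x"] by simp
  next
    case (irreducible p a)
    then have "p \<in> vanishing I V \<or> a \<in> vanishing I V" using V unfolding irreducible_in_zariski by blast
    then show ?case using irreducible by blast
  qed
qed

text \<open>
  The hypotheses say that \<open>V\<close> is the whole hypersurface of \<open>f\<close>. A proper irreducible closed set that contains \<open>V\<close> lies
  in the hypersurface of some irreducible polynomial. That polynomial vanishes on \<open>V\<close>, so it is divisible by \<open>f\<close>,
  and the two are associated.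
\<close>
lemma codimension_1I:
  fixes I :: "'v::linorder set"
  assumes I: "finite I" and V: "closedin (zariski I) V" "irreducible_in (zariski I) V"
    and f: "f \<in> vanishing I V" "irreducible f" and dvd: "\<And>g. g \<in> vanishing I V \<Longrightarrow> f dvd g"
  shows "codimension (zariski I) V = 1"
proof -
  define chain where "chain k Z \<longleftrightarrow> Z 0 = V \<and>
     (\<forall>i\<le>k. closedin (zariski I) (Z i) \<and> irreducible_in (zariski I) (Z i)) \<and> (\<forall>i<k. Z i \<subset> Z (Suc i))"
    for k :: nat and Z :: "nat \<Rightarrow> ('v \<Rightarrow> complex) set"
  have f0: "f \<noteq> 0" using f(2) by auto
  have "V \<noteq> affine_space I" using f(1) f0 vanishing_affine_space[OF I] by auto
  then have "V \<subset> affine_space I" using V(1) by (auto simp: closedin_zariski)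
  then have "chain 1 (\<lambda>i. if i = 0 then V else affine_space I)"
    unfolding chain_def using V affine_space_irreducible[OF I] closedin_topspace[of "zariski I"] by auto
  then have 1: "\<exists>Z. chain 1 Z" by blast
  have "k \<le> 1" if "chain k Z" for k Z
  proof (rule ccontr)
    assume "\<not> k \<le> 1"
    then have Z1: "closedin (zariski I) (Z 1)" "irreducible_in (zariski I) (Z 1)" "V \<subset> Z 1" "Z 1 \<subset> Z 2"
      "Z 2 \<subseteq> affine_space I"
      using that unfolding chain_def by (auto simp: irreducible_in_zariski numeral_2_eq_2)
    obtain x where "x \<in> Z 2" "x \<notin> Z 1" using Z1 by blast
    then obtain h where h: "h \<in> vanishing I (Z 1)" "meval x h \<noteq> 0"
      using Z1 unfolding closedin_zariski by blast
    have "h \<noteq> 0" using h(2) by auto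
    then obtain f' where f': "f' \<in> vanishing I (Z 1)" "irreducible f'"
      using irreducible_vanishing_factor[OF I Z1(2) h(1)] by blast
    have "f' \<in> vanishing I V" using f'(1) Z1(3) by (auto simp: vanishing_def)
    then obtain u where u: "f' = f * u" using dvd by (auto elim: dvdE)
    then have "u dvd 1" using f'(2) f(2) by (auto simp: irreducible_def)
    then obtain w where w: "1 = u * w" by auto
    have "f = f' * w" unfolding u mult.assoc w[symmetric] by simp
    then have "meval x f = 0" if "x \<in> Z 1" for x using f'(1) that by (auto simp: vanishing_def)
    then have "meval x g = 0" if "x \<in> Z 1" "g \<in> vanishing I V" for x g
      using dvd[OF that(2)] that(1) by (auto elim!: dvdE)
    then have "Z 1 \<subseteq> V" using V(1) Z1(1) unfolding closedin_zariski by blast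
    then show False using Z1(3) by blast
  qed
  then have "Sup {enat k | k. \<exists>Z. chain k Z} = 1"
    using 1 by (intro antisym Sup_least Sup_upper) (auto simp: one_enat_def)
  then show ?thesis unfolding codimension_def chain_def .
qed

section \<open>Boundaries of upper sets\<close>

definition box_around :: "'v set \<Rightarrow> ('v \<Rightarrow> real) \<Rightarrow> real \<Rightarrow> ('v \<Rightarrow> real) set" where
  "box_around K p \<eta> = {w \<in> affine_space K. \<forall>v\<in>K. \<bar>w v - p v\<bar> < \<eta>}"

lemma openin_box: "finite K \<Longrightarrow> openin (product_topology (\<lambda>_. euclideanreal) K) (box_around K p \<eta>)"
proof -
  assume "finite K"
  have "box_around K p \<eta> = (\<Pi>\<^sub>E v\<in>K. {p v - \<eta><..<p v + \<eta>})"
  proof -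
    have iff: "\<bar>x - q\<bar> < \<eta> \<longleftrightarrow> x \<in> {q - \<eta><..<q + \<eta>}" for x q :: real by auto
    show ?thesis
      by (rule set_eqI) (unfold box_around_def affine_space_def mem_Collect_eq PiE_iff iff, blast)
  qed
  then show ?thesis using \<open>finite K\<close> by (simp add: openin_PiE)
qed

lemma frontier_by_boxes:
  assumes K: "finite K" and C: "C \<subseteq> affine_space K"
  shows "z \<in> product_topology (\<lambda>_. euclideanreal) K frontier_of C \<longleftrightarrow> z \<in> affine_space K \<and>
    (\<forall>\<eta>>0. box_around K z \<eta> \<inter> C \<noteq> {} \<and> \<not> box_around K z \<eta> \<subseteq> C)" (is "?L \<longleftrightarrow> ?R")
proof -
  let ?X = "product_topology (\<lambda>_. euclideanreal) K"
  have top: "topspace ?X = affine_space K" by (simp add: affine_space_def)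
  have contains: "\<exists>\<eta>>0. box_around K z \<eta> \<subseteq> T" if T: "openin ?X T" "z \<in> T" for T
  proof -
    obtain U where U: "\<And>v. v \<in> K \<Longrightarrow> open (U v)" "z \<in> Pi\<^sub>E K U" "Pi\<^sub>E K U \<subseteq> T"
      using T unfolding openin_product_topology_alt by fastforce
    have "\<forall>v\<in>K. \<exists>e>0. \<forall>x. \<bar>x - z v\<bar> < e \<longrightarrow> x \<in> U v"
      using U unfolding open_dist dist_real_def by (meson PiE_mem)
    then obtain e where e: "\<And>v. v \<in> K \<Longrightarrow> e v > 0" "\<And>v x. v \<in> K \<Longrightarrow> \<bar>x - z v\<bar> < e v \<Longrightarrow> x \<in> U v"
      by metis
    define \<eta> where "\<eta> = Min (insert 1 (e ` K))"
    have "\<eta> > 0" "\<And>v. v \<in> K \<Longrightarrow> \<eta> \<le> e v" using K e by (auto simp: \<eta>_def)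
    moreover have "box_around K z \<eta> \<subseteq> Pi\<^sub>E K U"
    proof
      fix w assume w: "w \<in> box_around K z \<eta>"
      show "w \<in> Pi\<^sub>E K U"
      proof (rule PiE_I)
        fix v assume v: "v \<in> K"
        then have "\<bar>w v - z v\<bar> < e v" using w \<open>v \<in> K \<Longrightarrow> \<eta> \<le> e v\<close> by (fastforce simp: box_around_def)
        then show "w v \<in> U v" using e(2) v by blast
      qed (use w in \<open>auto simp: box_around_def affine_space_def PiE_iff extensional_def\<close>)
    qed
    ultimately show ?thesis using U(3) by blast
  qed
  have self: "z \<in> box_around K z \<eta>" if "z \<in> affine_space K" "\<eta> > 0" for \<eta>
    using that by (simp add: box_around_def)
  have cl: "z \<in> ?X closure_of C \<longleftrightarrow> z \<in> affine_space K \<and> (\<forall>\<eta>>0. box_around K z \<eta> \<inter> C \<noteq> {})"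
    unfolding in_closure_of top
  proof safe
    fix \<eta> :: real assume *: "z \<in> affine_space K" "\<forall>T. z \<in> T \<and> openin ?X T \<longrightarrow> (\<exists>y. y \<in> C \<and> y \<in> T)"
      "\<eta> > 0" "box_around K z \<eta> \<inter> C = {}"
    then show False using openin_box[OF K, of z \<eta>] self by blast
  next
    fix T assume *: "\<forall>\<eta>>0. box_around K z \<eta> \<inter> C \<noteq> {}" "z \<in> T" "openin ?X T"
    then obtain \<eta> where "\<eta> > 0" "box_around K z \<eta> \<subseteq> T" using contains by blast
    then show "\<exists>y. y \<in> C \<and> y \<in> T" using * by blast
  qed
  have int: "z \<in> ?X interior_of C \<longleftrightarrow> z \<in> affine_space K \<and> (\<exists>\<eta>>0. box_around K z \<eta> \<subseteq> C)"
  proof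
    assume "z \<in> ?X interior_of C"
    then obtain T where T: "openin ?X T" "z \<in> T" "T \<subseteq> C" by (auto simp: interior_of_def)
    then show "z \<in> affine_space K \<and> (\<exists>\<eta>>0. box_around K z \<eta> \<subseteq> C)" using contains[OF T(1,2)] C by blast
  next
    assume "z \<in> affine_space K \<and> (\<exists>\<eta>>0. box_around K z \<eta> \<subseteq> C)"
    then show "z \<in> ?X interior_of C" unfolding interior_of_def using openin_box[OF K] self by blast
  qed
  show ?thesis unfolding frontier_of_def using cl int by blast
qed

definition upper_set :: "'v set \<Rightarrow> ('v \<Rightarrow> real) set \<Rightarrow> bool" where
  "upper_set K C \<longleftrightarrow> C \<subseteq> affine_space K \<and>
     (\<forall>z\<in>C. \<forall>z'\<in>affine_space K. (\<forall>v\<in>K. z v \<le> z' v) \<longrightarrow> z' \<in> C)"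

definition boundary :: "'v set \<Rightarrow> ('v \<Rightarrow> real) set \<Rightarrow> ('v \<Rightarrow> real) set" where
  "boundary K C = product_topology (\<lambda>_. euclideanreal) K frontier_of C"

text \<open>
  Move from a point just below \<open>z\<^sub>0\<close> to one just above, one coordinate at a time. The step in which the
  interior of \<open>C\<close> is entered moves in the direction of some coordinate \<open>v\<close>; all nearby parallel
  segments cross the boundary, so the projection of the boundary along \<open>v\<close> contains an open box.
\<close>
lemma boundary_projects_onto_box:
  assumes K: "finite K" and C: "upper_set K C" and z0: "z0 \<in> boundary K C" and \<delta>: "\<delta> > 0"
  shows "\<exists>v\<in>K. \<exists>p. \<exists>\<eta>>0. \<forall>w\<in>affine_space K. (\<forall>u\<in>K - {v}. \<bar>w u - p u\<bar> < \<eta>) \<longrightarrow>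
           (\<exists>t. w(v := t) \<in> boundary K C \<inter> box_around K z0 \<delta>)"
proof -
  have CK: "C \<subseteq> affine_space K" and up: "\<And>z z'. z \<in> C \<Longrightarrow> z' \<in> affine_space K \<Longrightarrow> (\<And>v. v \<in> K \<Longrightarrow> z v \<le> z' v) \<Longrightarrow> z' \<in> C"
    using C by (auto simp: upper_set_def)
  note fr = frontier_by_boxes[OF K CK, folded boundary_def]
  define r where "r = \<delta> / 3"
  have r: "r > 0" using \<delta> by (simp add: r_def)
  define P where "P J u = (if u \<in> J then z0 u + r else z0 u - r)" for J u
  define inside where "inside q \<longleftrightarrow> (\<exists>\<eta>>0. box_around K q \<eta> \<subseteq> C)" for q
  have "inside (P K)"
  proof -
    obtain c where c: "c \<in> C" "c \<in> box_around K z0 (r / 2)" using z0 r unfolding fr by (metis disjoint_iff half_gt_zero)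
    have "box_around K (P K) (r / 2) \<subseteq> C"
    proof
      fix w assume w: "w \<in> box_around K (P K) (r / 2)"
      show "w \<in> C"
      proof (rule up[OF c(1)])
        show "w \<in> affine_space K" using w by (simp add: box_around_def)
        fix v assume v: "v \<in> K"
        have "\<bar>w v - P K v\<bar> < r / 2" "\<bar>c v - z0 v\<bar> < r / 2" using w c v by (auto simp: box_around_def)
        moreover have "P K v = z0 v + r" using v by (simp add: P_def)
        ultimately show "c v \<le> w v" by linarith
      qed
    qed
    then show ?thesis unfolding inside_def using r by (metis half_gt_zero)
  qed
  moreover have "\<not> inside (P {})"
  proof
    assume "inside (P {})"
    then obtain \<eta> where \<eta>: "\<eta> > 0" "box_around K (P {}) \<eta> \<subseteq> C" by (auto simp: inside_def)
    have "restrict (P {}) K \<in> box_around K (P {}) \<eta>" using \<eta> by (auto simp: box_around_def affine_space_def)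
    then have low: "restrict (P {}) K \<in> C" using \<eta> by blast
    have "box_around K z0 r \<subseteq> C"
    proof
      fix w assume w: "w \<in> box_around K z0 r"
      show "w \<in> C"
      proof (rule up[OF low])
        show "w \<in> affine_space K" using w by (simp add: box_around_def)
        fix v assume "v \<in> K"
        then have "\<bar>w v - z0 v\<bar> < r" using w by (simp add: box_around_def)
        then show "restrict (P {}) K v \<le> w v" using \<open>v \<in> K\<close> by (simp add: P_def)
      qed
    qed
    then show False using z0 r unfolding fr by blast
  qed
  moreover have "\<exists>J v. J \<subseteq> K \<and> v \<in> K \<and> v \<notin> J \<and> \<not> inside (P J) \<and> inside (P (insert v J))"
    if "\<not> inside (P {})" "inside (P K')" "finite K'" "K' \<subseteq> K" for K'
    using that(3,1,2,4) by (induction K' rule: finite_induct) blast+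
  ultimately obtain J v where J: "J \<subseteq> K" "v \<in> K" "v \<notin> J" "\<not> inside (P J)" "inside (P (insert v J))"
    using K by blast
  then obtain \<eta>0 where \<eta>0: "\<eta>0 > 0" "box_around K (P (insert v J)) \<eta>0 \<subseteq> C" by (auto simp: inside_def)
  define \<epsilon> where "\<epsilon> = min (\<eta>0 / 2) (r / 2)"
  have \<epsilon>: "\<epsilon> > 0" "2 * \<epsilon> \<le> \<eta>0" "2 * \<epsilon> \<le> r" using \<eta>0 r by (auto simp: \<epsilon>_def)
  define p where "p u = P J u - \<epsilon>" for u
  have "\<exists>t. w(v := t) \<in> boundary K C \<inter> box_around K z0 \<delta>"
    if w: "w \<in> affine_space K" and near: "\<And>u. u \<in> K \<Longrightarrow> u \<noteq> v \<Longrightarrow> \<bar>w u - p u\<bar> < \<epsilon>" for w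
  proof -
    have aff: "w(v := t) \<in> affine_space K" for t
      using w J(2) by (auto simp: affine_space_def PiE_iff extensional_def)
    define lo hi where "lo = z0 v - r - \<epsilon>" and "hi = z0 v + r - \<epsilon>"
    have lo: "w(v := t) \<notin> C" if "t \<le> lo" for t
    proof
      assume t: "w(v := t) \<in> C"
      define \<eta> where "\<eta> = Min (insert 1 ((\<lambda>u. P J u - (w(v := t)) u) ` K))"
      have less: "(w(v := t)) u < P J u" if "u \<in> K" for u
        using near[OF that] \<open>t \<le> lo\<close> J(3) \<epsilon> by (auto simp: p_def lo_def P_def)
      have "\<eta> > 0" using K less by (auto simp: \<eta>_def)
      have \<eta>_le: "\<eta> \<le> P J u - (w(v := t)) u" if "u \<in> K" for u
        unfolding \<eta>_def using K that by (intro Min_le) auto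
      have "box_around K (P J) \<eta> \<subseteq> C"
      proof
        fix x assume x: "x \<in> box_around K (P J) \<eta>"
        show "x \<in> C"
        proof (rule up[OF t])
          show "x \<in> affine_space K" using x by (simp add: box_around_def)
          fix u assume "u \<in> K"
          then have "\<bar>x u - P J u\<bar> < \<eta>" using x by (simp add: box_around_def)
          then show "(w(v := t)) u \<le> x u" using \<eta>_le[OF \<open>u \<in> K\<close>] by linarith
        qed
      qed
      then show False using J(4) \<open>\<eta> > 0\<close> by (auto simp: inside_def)
    qed
    have hi: "w(v := hi) \<in> C"
    proof -
      have "\<bar>(w(v := hi)) u - P (insert v J) u\<bar> < \<eta>0" if "u \<in> K" for u
        using near[OF that] \<epsilon> by (auto simp: p_def hi_def P_def abs_less_iff split: if_splits)
      then show ?thesis using \<eta>0 aff by (auto simp: box_around_def)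
    qed
    define S where "S = {t. w(v := t) \<in> C}"
    define t where "t = Inf S"
    have bdd: "bdd_below S" unfolding S_def using lo by (intro bdd_belowI[of _ lo]) (auto intro: ccontr)
    have mono: "s \<in> S \<Longrightarrow> s \<le> s' \<Longrightarrow> s' \<in> S" for s s'
      unfolding S_def using up[of "w(v := s)" "w(v := s')"] aff by auto
    have above: "t < s \<Longrightarrow> s \<in> S" for s
      using hi bdd mono unfolding t_def by (metis S_def cInf_less_iff empty_iff less_imp_le mem_Collect_eq)
    have below: "s < t \<Longrightarrow> s \<notin> S" for s
      unfolding t_def using cInf_lower[OF _ bdd] by force
    have t: "lo \<le> t" "t \<le> hi"
    proof -
      show "lo \<le> t" using above[of "(t + lo) / 2"] lo[of "(t + lo) / 2"] by (force simp: S_def)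
      show "t \<le> hi" unfolding t_def using hi bdd by (intro cInf_lower) (auto simp: S_def)
    qed
    have "w(v := t) \<in> boundary K C"
      unfolding fr
    proof (intro conjI allI impI aff)
      fix \<eta> :: real assume \<eta>: "\<eta> > 0"
      have b: "w(v := s) \<in> box_around K (w(v := t)) \<eta>" if "\<bar>s - t\<bar> < \<eta>" for s
        using that aff \<eta> by (auto simp: box_around_def)
      show "box_around K (w(v := t)) \<eta> \<inter> C \<noteq> {}"
        using above[of "t + \<eta> / 2"] b[of "t + \<eta> / 2"] \<eta> by (auto simp: S_def)
      show "\<not> box_around K (w(v := t)) \<eta> \<subseteq> C"
        using below[of "t - \<eta> / 2"] b[of "t - \<eta> / 2"] \<eta> by (auto simp: S_def)
    qed
    moreover have "w(v := t) \<in> box_around K z0 \<delta>"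
    proof -
      have "\<bar>(w(v := t)) u - z0 u\<bar> < \<delta>" if "u \<in> K" for u
        using near[OF that] \<epsilon> t r unfolding r_def
        by (auto simp: p_def lo_def hi_def P_def r_def abs_less_iff split: if_splits)
      then show ?thesis using aff by (auto simp: box_around_def)
    qed
    ultimately show ?thesis by blast
  qed
  then show ?thesis using J(2) \<epsilon>(1) by (intro bexI[of _ v] exI[of _ p] exI[of _ \<epsilon>]) auto
qed

text \<open>
  The common zeros of each pair have codimension at least two. By elimination, their projection along the coordinate \<open>v\<close> lies in the zero set of
  a nonzero polynomial. The product of these finitely many polynomials is nonzero somewhere on the box onto which the
  boundary projects along \<open>v\<close>.
\<close>
lemma boundary_not_covered:
  fixes K :: "'v::linorder set"
  assumes K: "finite K" and C: "upper_set K C" and z0: "z0 \<in> boundary K C" and \<delta>: "\<delta> > 0"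
    and F: "finite F" "\<And>f g. (f, g) \<in> F \<Longrightarrow> f \<in> mpolys K \<and> g \<in> mpolys K \<and> irreducible f \<and> \<not> f dvd g"
  shows "\<exists>z\<in>boundary K C \<inter> box_around K z0 \<delta>. \<forall>(f, g)\<in>F.
           meval (complexify K z) f \<noteq> 0 \<or> meval (complexify K z) g \<noteq> 0"
proof -
  obtain v p \<eta> where v: "v \<in> K" and \<eta>: "\<eta> > 0"
    and proj: "\<And>w. w \<in> affine_space K \<Longrightarrow> (\<And>u. u \<in> K - {v} \<Longrightarrow> \<bar>w u - p u\<bar> < \<eta>) \<Longrightarrow>
           (\<exists>t. w(v := t) \<in> boundary K C \<inter> box_around K z0 \<delta>)"
    using boundary_projects_onto_box[OF K C z0 \<delta>] by blast
  have ins: "insert v (K - {v}) = K" using v by auto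
  have "\<exists>c\<in>mpolys (K - {v}). c \<noteq> 0 \<and> (\<exists>a b. c = a * fst x + b * snd x)" if "x \<in> F" for x
    using mpoly_elimination[of "K - {v}" v "fst x" "snd x", unfolded ins] K F(2)[of "fst x" "snd x"] that
    by simp
  then obtain c where c: "\<And>x. x \<in> F \<Longrightarrow> c x \<in> mpolys (K - {v})" "\<And>x. x \<in> F \<Longrightarrow> c x \<noteq> 0"
    "\<And>x. x \<in> F \<Longrightarrow> \<exists>a b. c x = a * fst x + b * snd x" by metis
  have "prod c F \<in> mpolys (K - {v})" "prod c F \<noteq> 0"
    using c F(1) by (auto intro: mpolys.prod_mem)
  then obtain w where w: "\<forall>u. \<bar>w u - p u\<bar> < \<eta>" "meval (\<lambda>u. complex_of_real (w u)) (prod c F) \<noteq> 0"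
    using nonzero_on_real_box[of "K - {v}" "prod c F" \<eta> p] K \<eta> by auto
  have "restrict w K \<in> affine_space K" by (simp add: affine_space_def)
  from proj[OF this] w obtain t where t: "(restrict w K)(v := t) \<in> boundary K C \<inter> box_around K z0 \<delta>" by auto
  define z where "z = (restrict w K)(v := t)"
  have "meval (complexify K z) f \<noteq> 0 \<or> meval (complexify K z) g \<noteq> 0" if fg: "(f, g) \<in> F" for f g
  proof (rule ccontr)
    assume n: "\<not> ?thesis"
    obtain a b where ab: "c (f, g) = a * f + b * g" using c(3)[OF fg] by auto
    have "meval (\<lambda>u. complex_of_real (w u)) (c (f, g)) = meval (complexify K z) (c (f, g))"
      by (rule meval.heval_cong[OF c(1)[OF fg]]) (auto simp: complexify_def z_def)
    also have "\<dots> = 0" using n by (simp add: ab)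
    finally show False using w(2) fg F(1) by auto
  qed
  then show ?thesis using t unfolding z_def by blast
qed

lemma vanishing_at_limit:
  fixes K :: "'v::linorder set"
  assumes K: "finite K" and z0: "z0 \<in> affine_space K"
    and ex: "\<And>\<delta>. \<delta> > 0 \<Longrightarrow> \<exists>z\<in>box_around K z0 \<delta>. meval (complexify K z) h = 0"
  shows "meval (complexify K z0) h = 0"
proof -
  have "\<forall>k. \<exists>z. z \<in> box_around K z0 (1 / real (Suc k)) \<and> meval (complexify K z) h = 0"
    using ex by (metis of_nat_0_less_iff zero_less_Suc zero_less_divide_1_iff)
  then obtain z where z: "\<And>k. z k \<in> box_around K z0 (1 / real (Suc k))"
    "\<And>k. meval (complexify K (z k)) h = 0" by metis
  have "(\<lambda>k. complexify K (z k) v) \<longlonglongrightarrow> complexify K z0 v" for v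
  proof (cases "v \<in> K")
    case True
    have "(\<lambda>k. z k v) \<longlonglongrightarrow> z0 v"
    proof (rule LIMSEQ_I)
      fix e :: real assume "e > 0"
      then obtain N where N: "1 / real (Suc N) < e" using nat_approx_posE by blast
      have "norm (z k v - z0 v) < e" if "k \<ge> N" for k
      proof -
        have "\<bar>z k v - z0 v\<bar> < 1 / real (Suc k)" using z(1)[of k] True by (simp add: box_around_def)
        also have "\<dots> \<le> 1 / real (Suc N)" using that by (simp add: frac_le)
        finally show ?thesis using N by simp
      qed
      then show "\<exists>N. \<forall>k\<ge>N. norm (z k v - z0 v) < e" by blast
    qed
    then show ?thesis using True by (simp add: complexify_def tendsto_of_real)
  qed (simp add: complexify_def)
  then have "(\<lambda>k. meval (complexify K (z k)) h) \<longlonglongrightarrow> meval (complexify K z0) h"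
    by (rule meval_tendsto)
  then show ?thesis using z(2) LIMSEQ_unique[OF _ tendsto_const[of 0]] by simp
qed

section \<open>Limits of normalised monomials\<close>

definition dot :: "'e set \<Rightarrow> ('e \<Rightarrow> real) \<Rightarrow> ('e \<Rightarrow> real) \<Rightarrow> real" where
  "dot E a y = (\<Sum>e\<in>E. a e * y e)"

lemma dot_sum: "dot E a (\<lambda>e. \<Sum>j\<in>B. c j * V j e) = (\<Sum>j\<in>B. c j * dot E a (V j))"
  unfolding dot_def sum_distrib_left by (subst sum.swap) (simp add: mult_ac)

lemma dot_add: "dot E a (\<lambda>e. x e + y e) = dot E a x + dot E a y"
  by (simp add: dot_def algebra_simps sum.distrib)

lemma dot_diff: "dot E a (\<lambda>e. x e - y e) = dot E a x - dot E a y"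
  by (simp add: dot_def algebra_simps sum_subtractf)

lemma dot_scale: "dot E a (\<lambda>e. c * x e) = c * dot E a x"
  by (simp add: dot_def sum_distrib_left mult_ac)

text \<open>
  A linear map with image in a finite-dimensional space has a linear generalised inverse, here built up one functional
  at a time. It replaces a point \<open>y\<close> by one that depends continuously on the values of the functionals at \<open>y\<close>, even if \<open>y\<close>
  itself is unbounded.
\<close>
lemma generalised_inverse:
  assumes "finite B"
  shows "\<exists>V. \<forall>y. \<forall>i\<in>B. dot E (a i) (\<lambda>e. \<Sum>j\<in>B. dot E (a j) y * V j e) = dot E (a i) y"
  using assms
proof (induction B rule: finite_induct)
  case (insert i0 B)
  then obtain V where V: "\<And>y i. i \<in> B \<Longrightarrow> dot E (a i) (\<lambda>e. \<Sum>j\<in>B. dot E (a j) y * V j e) = dot E (a i) y"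
    by blast
  define s where "s y e = (\<Sum>j\<in>B. dot E (a j) y * V j e)" for y e
  have V: "dot E (a i) (s y) = dot E (a i) y" if "i \<in> B" for y i
    using V[OF that] by (simp add: s_def[abs_def])
  show ?case
  proof (cases "\<forall>y. (\<forall>j\<in>B. dot E (a j) y = 0) \<longrightarrow> dot E (a i0) y = 0")
    case True
    have "dot E (a i0) (\<lambda>e. y e - s y e) = 0" for y
      using True[rule_format, of "\<lambda>e. y e - s y e"] V by (simp add: dot_diff)
    then have "dot E (a i) (s y) = dot E (a i) y" if "i \<in> insert i0 B" for y i
      using that V by (auto simp: dot_diff)
    moreover have "(\<Sum>j\<in>insert i0 B. dot E (a j) y * (V(i0 := \<lambda>_. 0)) j e) = s y e" for y e
      using insert.hyps by (auto simp: s_def intro!: sum.cong)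
    ultimately show ?thesis by (intro exI[of _ "V(i0 := \<lambda>_. 0)"]) (simp only:, blast)
  next
    case False
    then obtain x where x: "\<And>j. j \<in> B \<Longrightarrow> dot E (a j) x = 0" "dot E (a i0) x \<noteq> 0" by blast
    define x1 where "x1 e = (1 / dot E (a i0) x) * x e" for e
    have x1: "\<And>j. j \<in> B \<Longrightarrow> dot E (a j) x1 = 0" "dot E (a i0) x1 = 1"
      unfolding x1_def[abs_def] dot_scale using x by auto
    define W where "W j = (if j = i0 then x1 else (\<lambda>e. V j e - dot E (a i0) (V j) * x1 e))" for j
    have W: "(\<Sum>j\<in>insert i0 B. dot E (a j) y * W j e) =
        s y e + (dot E (a i0) y - dot E (a i0) (s y)) * x1 e" for y e
    proof -
      have "(\<Sum>j\<in>B. dot E (a j) y * W j e) =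
          (\<Sum>j\<in>B. dot E (a j) y * V j e - (dot E (a j) y * dot E (a i0) (V j)) * x1 e)"
        using insert.hyps by (intro sum.cong) (auto simp: W_def algebra_simps)
      also have "\<dots> = s y e - dot E (a i0) (s y) * x1 e"
        unfolding s_def[abs_def] dot_sum by (simp add: sum_subtractf sum_distrib_right)
      finally show ?thesis using insert.hyps by (simp add: W_def algebra_simps)
    qed
    have "dot E (a i) (\<lambda>e. s y e + (dot E (a i0) y - dot E (a i0) (s y)) * x1 e) = dot E (a i) y"
      if "i \<in> insert i0 B" for y i
      using that V x1 by (auto simp: dot_add dot_scale)
    then show ?thesis by (intro exI[of _ W]) (simp only: W, blast)
  qed
qed auto

lemma finite_convergent_subsequence:
  fixes p :: "nat \<Rightarrow> 'm \<Rightarrow> real"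
  assumes "finite A" "\<And>k m. m \<in> A \<Longrightarrow> p k m \<in> {0..1}"
  shows "\<exists>\<sigma> l. strict_mono \<sigma> \<and> (\<forall>m\<in>A. (\<lambda>k. p (\<sigma> k) m) \<longlonglongrightarrow> l m)"
  using assms
proof (induction A rule: finite_induct)
  case empty
  then show ?case by (intro exI[of _ id]) (auto simp: strict_mono_def)
next
  case (insert a A)
  then have "\<exists>\<sigma> l. strict_mono \<sigma> \<and> (\<forall>m\<in>A. (\<lambda>k. p (\<sigma> k) m) \<longlonglongrightarrow> l m)" by blast
  then obtain \<sigma> l where \<sigma>: "strict_mono \<sigma>" "\<And>m. m \<in> A \<Longrightarrow> (\<lambda>k. p (\<sigma> k) m) \<longlonglongrightarrow> l m" by blast
  have "\<forall>k. p (\<sigma> k) a \<in> {0..1}" using insert.prems by blast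
  then obtain l' \<rho> where \<rho>: "strict_mono \<rho>" "((\<lambda>k. p (\<sigma> k) a) \<circ> \<rho>) \<longlonglongrightarrow> l'"
    using seq_compactE[OF compact_imp_seq_compact[OF compact_Icc]] by metis
  have "(\<lambda>k. p ((\<sigma> \<circ> \<rho>) k) m) \<longlonglongrightarrow> (l(a := l')) m" if "m \<in> insert a A" for m
    using that \<rho>(2) insert.hyps LIMSEQ_subseq_LIMSEQ[OF \<sigma>(2) \<rho>(1)] by (auto simp: o_def)
  then show ?case using strict_mono_o[OF \<sigma>(1) \<rho>(1)] by blast
qed

definition expo :: "('e \<Rightarrow>\<^sub>0 nat) \<Rightarrow> 'e \<Rightarrow> real" where
  "expo m e = real (Poly_Mapping.lookup m e)"

lemma mono_eval_exp:
  assumes "finite E" "Poly_Mapping.keys m \<subseteq> E" "\<And>e. e \<in> E \<Longrightarrow> u e = exp (y e)"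
  shows "mono_eval u m = exp (dot E (expo m) y)"
  unfolding mono_eval_superset[OF assms(1,2)] dot_def exp_sum[OF assms(1)]
  using assms(3) by (intro prod.cong) (auto simp: expo_def exp_of_nat_mult)

text \<open>
  If a polynomial takes values on the positive orthant that are small compared with the sum of its monomials,
  then pass to a subsequence along which the monomials, divided by their sum, converge. Those with positive
  limit are the ones on which some weight \<open>\<omega>\<close> is maximal, and their limits are proportional to their values at
  a positive point.
\<close>
lemma small_values_give_face:
  fixes A :: "('e \<Rightarrow>\<^sub>0 nat) set" and c :: "('e \<Rightarrow>\<^sub>0 nat) \<Rightarrow> real" and u :: "nat \<Rightarrow> 'e \<Rightarrow> real"
  assumes A: "finite A" and E: "finite E" "\<And>m. m \<in> A \<Longrightarrow> Poly_Mapping.keys m \<subseteq> E"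
    and u: "\<And>k e. u k e > 0"
    and small: "\<And>k. (\<Sum>m\<in>A. c m * mono_eval (u k) m) < (1 / real (Suc k)) * (\<Sum>m\<in>A. mono_eval (u k) m)"
  shows "\<exists>B y \<omega> M. B \<subseteq> A \<and> B \<noteq> {} \<and> (\<forall>m\<in>B. dot E (expo m) \<omega> = M) \<and> (\<forall>m\<in>A - B. dot E (expo m) \<omega> < M) \<and>
    (\<Sum>m\<in>B. c m * exp (dot E (expo m) y)) \<le> 0"
proof -
  have A_ne: "A \<noteq> {}" using small[of 0] by auto
  define S where "S k = (\<Sum>m\<in>A. mono_eval (u k) m)" for k
  have pos: "mono_eval (u k) m > 0" for k m unfolding mono_eval_def using u by (intro prod_pos) auto
  have S: "S k > 0" for k unfolding S_def using A A_ne pos by (intro sum_pos) auto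
  define p where "p k m = mono_eval (u k) m / S k" for k m
  have ppos: "p k m > 0" for k m using pos S by (simp add: p_def)
  have psum: "(\<Sum>m\<in>A. p k m) = 1" for k
    using S[of k] by (simp add: p_def flip: sum_divide_distrib) (simp add: S_def)
  have p01: "p k m \<in> {0..1}" if "m \<in> A" for k m
  proof -
    have "p k m \<le> (\<Sum>m\<in>A. p k m)" using A that ppos by (intro member_le_sum) (auto intro: less_imp_le)
    then show ?thesis using ppos[of k m] psum[of k] by (simp add: less_imp_le)
  qed
  obtain \<sigma> l where \<sigma>: "strict_mono \<sigma>" and l: "\<And>m. m \<in> A \<Longrightarrow> (\<lambda>k. p (\<sigma> k) m) \<longlonglongrightarrow> l m"
    using finite_convergent_subsequence[of A p] A p01 by metis
  have l0: "l m \<ge> 0" if "m \<in> A" for m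
    using LIMSEQ_le_const[OF l[OF that]] ppos by (meson less_imp_le)
  have "(\<lambda>k. \<Sum>m\<in>A. p (\<sigma> k) m) \<longlonglongrightarrow> (\<Sum>m\<in>A. l m)" by (intro tendsto_sum l)
  then have lsum: "(\<Sum>m\<in>A. l m) = 1" using LIMSEQ_unique[OF _ tendsto_const] by (simp add: psum)
  define B where "B = {m \<in> A. l m > 0}"
  have BA: "B \<subseteq> A" "finite B" using A by (auto simp: B_def)
  have "\<exists>m\<in>A. l m \<noteq> 0" using lsum by (metis sum.neutral zero_neq_one)
  then obtain b where b: "b \<in> B" using l0 unfolding B_def by (metis (mono_tags, lifting) less_eq_real_def mem_Collect_eq)
  define Y where "Y k e = ln (u k e)" for k e
  define a where "a m e = expo m e - expo b e" for m e
  have dot_a: "dot E (a m) y = dot E (expo m) y - dot E (expo b) y" for m y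
    by (simp add: a_def dot_def algebra_simps sum_subtractf)
  have mono_Y: "mono_eval (u k) m = exp (dot E (expo m) (Y k))" if "m \<in> A" for k m
    using mono_eval_exp[OF E(1) E(2)[OF that], of "u k" "Y k"] u by (simp add: Y_def)
  have bA: "b \<in> A" using b BA by auto
  have phi: "dot E (a m) (Y k) = ln (p k m / p k b)" if "m \<in> A" for k m
  proof -
    have "p k m / p k b = exp (dot E (expo m) (Y k) - dot E (expo b) (Y k))"
      using S[of k] mono_Y[OF that, of k] mono_Y[OF bA, of k] by (simp add: p_def exp_diff)
    then show ?thesis by (simp add: dot_a)
  qed
  have lb: "l b > 0" using b by (simp add: B_def)
  have ratio: "(\<lambda>k. p (\<sigma> k) m / p (\<sigma> k) b) \<longlonglongrightarrow> l m / l b" if "m \<in> A" for m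
    using l[OF that] l[OF bA] lb by (intro tendsto_divide) auto
  have lim_B: "(\<lambda>k. dot E (a m) (Y (\<sigma> k))) \<longlonglongrightarrow> ln (l m / l b)" if "m \<in> B" for m
    unfolding phi[OF subsetD[OF BA(1) that]]
    using ratio[OF subsetD[OF BA(1) that]] that lb by (intro tendsto_ln) (auto simp: B_def)
  have lim_out: "filterlim (\<lambda>k. dot E (a m) (Y (\<sigma> k))) at_bot sequentially" if "m \<in> A - B" for m
  proof -
    have mA: "m \<in> A" and "l m = 0" using that l0 by (auto simp: B_def less_le)
    then have "(\<lambda>k. p (\<sigma> k) m / p (\<sigma> k) b) \<longlonglongrightarrow> 0" using ratio[OF mA] by simp
    then have "filterlim (\<lambda>k. p (\<sigma> k) m / p (\<sigma> k) b) (at_right 0) sequentially"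
      by (rule tendsto_imp_filterlim_at_right) (use ppos in simp)
    then show ?thesis unfolding phi[OF mA] by (rule filterlim_compose[OF ln_at_0])
  qed
  obtain V where V: "\<And>y i. i \<in> B \<Longrightarrow> dot E (a i) (\<lambda>e. \<Sum>j\<in>B. dot E (a j) y * V j e) = dot E (a i) y"
    using generalised_inverse[OF BA(2), of E a] by blast
  \<comment> \<open>the functionals have limits on \<open>B\<close>; the generalised inverse turns these limits into a point\<close>
  define y where "y e = (\<Sum>j\<in>B. ln (l j / l b) * V j e)" for e
  have y: "dot E (a i) y = ln (l i / l b)" if "i \<in> B" for i
  proof -
    have "(\<lambda>k. \<Sum>j\<in>B. dot E (a j) (Y (\<sigma> k)) * dot E (a i) (V j)) \<longlonglongrightarrow>
        (\<Sum>j\<in>B. ln (l j / l b) * dot E (a i) (V j))"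
      by (intro tendsto_intros lim_B)
    moreover have "(\<Sum>j\<in>B. dot E (a j) (Y (\<sigma> k)) * dot E (a i) (V j)) = dot E (a i) (Y (\<sigma> k))" for k
      using V[OF that, of "Y (\<sigma> k)"] by (simp add: dot_sum)
    moreover have "(\<Sum>j\<in>B. ln (l j / l b) * dot E (a i) (V j)) = dot E (a i) y"
      unfolding y_def[abs_def] dot_sum ..
    ultimately show ?thesis using LIMSEQ_unique lim_B[OF that] by (metis (no_types, lifting) ext)
  qed
  \<comment> \<open>the unbounded part of the sequence, on which the exponents in \<open>B\<close> agree\<close>
  define \<Omega> where "\<Omega> k e = Y (\<sigma> k) e - (\<Sum>j\<in>B. dot E (a j) (Y (\<sigma> k)) * V j e)" for k e
  have \<Omega>_B: "dot E (a i) (\<Omega> k) = 0" if "i \<in> B" for i k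
    unfolding \<Omega>_def[abs_def] dot_diff using V[OF that] by simp
  have "eventually (\<lambda>k. \<forall>m\<in>A - B. dot E (a m) (\<Omega> k) < 0) sequentially"
  proof (rule eventually_ball_finite)
    show "finite (A - B)" using A by simp
    show "\<forall>m\<in>A - B. eventually (\<lambda>k. dot E (a m) (\<Omega> k) < 0) sequentially"
    proof
      fix m assume m: "m \<in> A - B"
      have "(\<lambda>k. \<Sum>j\<in>B. dot E (a j) (Y (\<sigma> k)) * dot E (a m) (V j)) \<longlonglongrightarrow>
        (\<Sum>j\<in>B. ln (l j / l b) * dot E (a m) (V j))" (is "_ \<longlonglongrightarrow> ?L")
        by (intro tendsto_intros lim_B)
      then have "eventually (\<lambda>k. (\<Sum>j\<in>B. dot E (a j) (Y (\<sigma> k)) * dot E (a m) (V j)) > ?L - 1) sequentially"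
        by (rule order_tendstoD) simp
      moreover have "eventually (\<lambda>k. dot E (a m) (Y (\<sigma> k)) < ?L - 1) sequentially"
        using lim_out[OF m] by (simp add: filterlim_at_bot_dense)
      ultimately show "eventually (\<lambda>k. dot E (a m) (\<Omega> k) < 0) sequentially"
        by eventually_elim (simp add: \<Omega>_def[abs_def] dot_diff dot_sum)
    qed
  qed
  then obtain k where k: "\<And>m. m \<in> A - B \<Longrightarrow> dot E (a m) (\<Omega> k) < 0"
    using eventually_happens'[OF sequentially_bot] by blast
  have "(\<Sum>m\<in>A. c m * l m) \<le> 0"
  proof (rule LIMSEQ_le)
    show "(\<lambda>k. \<Sum>m\<in>A. c m * p (\<sigma> k) m) \<longlonglongrightarrow> (\<Sum>m\<in>A. c m * l m)" by (intro tendsto_intros l)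
    show "(\<lambda>k. 1 / real (Suc k)) \<longlonglongrightarrow> 0" by (rule LIMSEQ_Suc) (rule lim_1_over_n)
    have "(\<Sum>m\<in>A. c m * p (\<sigma> k) m) \<le> 1 / real (Suc k)" for k
    proof -
      have "(\<Sum>m\<in>A. c m * p (\<sigma> k) m) = (\<Sum>m\<in>A. c m * mono_eval (u (\<sigma> k)) m) / S (\<sigma> k)"
        by (simp add: p_def sum_divide_distrib)
      also have "\<dots> \<le> 1 / real (Suc (\<sigma> k))"
        using small[of "\<sigma> k"] S[of "\<sigma> k"] by (simp add: S_def pos_divide_le_eq)
      also have "\<dots> \<le> 1 / real (Suc k)"
        using seq_suble[OF \<sigma>, of k] by (intro divide_left_mono) auto
      finally show ?thesis .
    qed
    then show "\<exists>N. \<forall>k\<ge>N. (\<Sum>m\<in>A. c m * p (\<sigma> k) m) \<le> 1 / real (Suc k)" by blast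
  qed
  moreover have "(\<Sum>m\<in>A. c m * l m) = (\<Sum>m\<in>B. c m * l m)"
    using A l0 by (intro sum.mono_neutral_right) (auto simp: B_def less_le)
  moreover have "(\<Sum>m\<in>B. c m * exp (dot E (expo m) y)) = exp (dot E (expo b) y) / l b * (\<Sum>m\<in>B. c m * l m)"
    unfolding sum_distrib_left
  proof (intro sum.cong refl)
    fix m assume m: "m \<in> B"
    have "exp (dot E (expo m) y) = exp (dot E (expo b) y) * exp (dot E (a m) y)"
      by (simp add: dot_a flip: exp_add)
    also have "exp (dot E (a m) y) = l m / l b" using y[OF m] m lb by (simp add: B_def)
    finally show "c m * exp (dot E (expo m) y) = exp (dot E (expo b) y) / l b * (c m * l m)" by simp
  qed
  ultimately have le: "(\<Sum>m\<in>B. c m * exp (dot E (expo m) y)) \<le> 0"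
    using lb by (simp add: mult_le_0_iff divide_le_0_iff)
  have "\<forall>m\<in>B. dot E (expo m) (\<Omega> k) = dot E (expo b) (\<Omega> k)" using \<Omega>_B[of _ k] by (simp add: dot_a)
  moreover have "\<forall>m\<in>A - B. dot E (expo m) (\<Omega> k) < dot E (expo b) (\<Omega> k)" using k by (simp add: dot_a)
  ultimately show ?thesis using BA b le by blast
qed

text \<open>
  Going to infinity in the direction \<open>\<omega>\<close> and rescaling by \<open>exp (- s M)\<close> isolates the terms in \<open>B\<close>.
\<close>
lemma face_nonneg:
  assumes A: "finite A" "B \<subseteq> A"
    and \<omega>: "\<And>m. m \<in> B \<Longrightarrow> dot E (expo m) \<omega> = M" "\<And>m. m \<in> A - B \<Longrightarrow> dot E (expo m) \<omega> < M"
    and nonneg: "\<And>y. (\<Sum>m\<in>A. c m * exp (dot E (expo m) y)) \<ge> 0"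
  shows "(\<Sum>m\<in>B. c m * exp (dot E (expo m) y)) \<ge> 0"
proof -
  define g where "g s m = c m * exp (dot E (expo m) y) * exp (real s * (dot E (expo m) \<omega> - M))" for s m
  have lim: "(\<lambda>s. g s m) \<longlonglongrightarrow> (if m \<in> B then c m * exp (dot E (expo m) y) else 0)" if "m \<in> A" for m
  proof (cases "m \<in> B")
    case True
    then show ?thesis by (simp add: g_def \<omega>)
  next
    case False
    define q where "q = exp (dot E (expo m) \<omega> - M)"
    have "0 \<le> q" "q < 1" using \<omega>(2)[of m] that False by (auto simp: q_def)
    then have "(\<lambda>s. q ^ s) \<longlonglongrightarrow> 0" by (rule LIMSEQ_realpow_zero)
    then have "(\<lambda>s. c m * exp (dot E (expo m) y) * q ^ s) \<longlonglongrightarrow> c m * exp (dot E (expo m) y) * 0"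
      by (rule tendsto_mult_left)
    then show ?thesis using False by (simp add: g_def q_def exp_of_nat_mult)
  qed
  have "(\<Sum>m\<in>A. g s m) \<ge> 0" for s
  proof -
    have "(\<Sum>m\<in>A. g s m) =
        exp (- (real s * M)) * (\<Sum>m\<in>A. c m * exp (dot E (expo m) (\<lambda>e. y e + real s * \<omega> e)))"
      unfolding sum_distrib_left
    proof (intro sum.cong refl)
      fix m
      have "exp (- (real s * M)) * (c m * exp (dot E (expo m) (\<lambda>e. y e + real s * \<omega> e))) =
         c m * (exp (dot E (expo m) y) * (exp (real s * dot E (expo m) \<omega>) * exp (- (real s * M))))"
        by (simp add: dot_add dot_scale exp_add)
      also have "exp (real s * dot E (expo m) \<omega>) * exp (- (real s * M)) = exp (real s * (dot E (expo m) \<omega> - M))"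
        by (simp add: algebra_simps flip: exp_add)
      finally have "exp (- (real s * M)) * (c m * exp (dot E (expo m) (\<lambda>e. y e + real s * \<omega> e))) = g s m"
        by (simp only: g_def mult.assoc)
      then show "g s m = exp (- (real s * M)) * (c m * exp (dot E (expo m) (\<lambda>e. y e + real s * \<omega> e)))" ..
    qed
    then show ?thesis using nonneg by simp
  qed
  moreover have "(\<lambda>s. \<Sum>m\<in>A. g s m) \<longlonglongrightarrow> (\<Sum>m\<in>A. if m \<in> B then c m * exp (dot E (expo m) y) else 0)"
    by (intro tendsto_sum lim)
  ultimately have "(\<Sum>m\<in>A. if m \<in> B then c m * exp (dot E (expo m) y) else 0) \<ge> 0"
    by (meson LIMSEQ_le_const)
  moreover have "(\<Sum>m\<in>A. if m \<in> B then c m * exp (dot E (expo m) y) else 0) =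
      (\<Sum>m\<in>B. c m * exp (dot E (expo m) y))"
    using A by (simp add: sum.If_cases Int_absorb1)
  ultimately show ?thesis by simp
qed

lemma singular_at_minimum:
  fixes f :: "('e::linorder, real) mpoly"
  assumes nonneg: "\<And>u. (\<And>e. u e > 0) \<Longrightarrow> meval u f \<ge> 0" and x: "\<And>e. x e > 0" and "meval x f = 0"
  shows "meval x (mpderiv i f) = 0"
proof (rule DERIV_local_min[OF meval_partial_derivative[of x i f]])
  show "0 < x i" by (rule x)
  show "\<forall>t. \<bar>x i - t\<bar> < x i \<longrightarrow> meval (x(i := x i)) f \<le> meval (x(i := t)) f"
  proof (intro allI impI)
    fix t assume "\<bar>x i - t\<bar> < x i"
    then have "t > 0" by linarith
    then have "meval (x(i := t)) f \<ge> 0" using x by (intro nonneg) auto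
    then show "meval (x(i := x i)) f \<le> meval (x(i := t)) f" using \<open>meval x f = 0\<close> by simp
  qed
qed

section \<open>The second Symanzik polynomial is linear in the kinematic parameters\<close>

definition exponent_of :: "'v feynman_data \<Rightarrow> edge set \<Rightarrow> (nat \<Rightarrow>\<^sub>0 nat)" where
  "exponent_of G S = (\<Sum>e\<in>{e \<in> {1..num_int G}. Internal e \<notin> S}. Poly_Mapping.single e 1)"

definition separates :: "'v feynman_data \<Rightarrow> edge set \<Rightarrow> nat \<Rightarrow> nat \<Rightarrow> bool" where
  "separates G S i j \<longleftrightarrow> (\<exists>C D. components_of G S = {C, D} \<and> C \<noteq> D \<and> i \<in> legs G C \<and> j \<in> legs G D)"

definition leg_pairs :: "'v feynman_data \<Rightarrow> (nat \<times> nat) set" where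
  "leg_pairs G = {(i, j). 1 \<le> i \<and> i < j \<and> j \<le> num_ext G}"

text \<open>
  The coefficient of the monomial \<open>m\<close> in the polynomial that the parameter \<open>v\<close> is multiplied with.
\<close>
definition param_count :: "'v feynman_data \<Rightarrow> var \<Rightarrow> (nat \<Rightarrow>\<^sub>0 nat) \<Rightarrow> nat" where
  "param_count G v m = (case v of
     Schwinger _ \<Rightarrow> 0
   | Mass e \<Rightarrow> card {T \<in> spanning_trees G. Poly_Mapping.single e 1 + exponent_of G T = m}
   | Momentum i j \<Rightarrow> card {S \<in> spanning_2forests G. separates G S i j \<and> exponent_of G S = m})"

definition support :: "'v feynman_data \<Rightarrow> (nat \<Rightarrow>\<^sub>0 nat) set" where
  "support G = {m. \<exists>v\<in>kin_vars G. param_count G v m \<noteq> 0}"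

definition coef :: "'v feynman_data \<Rightarrow> (var \<Rightarrow> 'a::comm_ring_1) \<Rightarrow> (nat \<Rightarrow>\<^sub>0 nat) \<Rightarrow> 'a" where
  "coef G z m = (\<Sum>v\<in>kin_vars G. z v * of_nat (param_count G v m))"

lemma finite_leg_pairs: "finite (leg_pairs G)"
  by (rule finite_subset[of _ "{1..num_ext G} \<times> {1..num_ext G}"]) (auto simp: leg_pairs_def)

lemma kin_vars_eq: "kin_vars G = Mass ` {1..num_int G} \<union> (\<lambda>(i, j). Momentum i j) ` leg_pairs G"
  by (auto simp: kin_vars_def leg_pairs_def)

lemma finite_kin_vars: "finite (kin_vars G)"
  by (simp add: kin_vars_eq finite_leg_pairs)

lemma finite_edges: "finite (edges G)"
  by (simp add: edges_def)

lemma finite_trees: "finite (spanning_trees G)"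
  by (rule finite_subset[of _ "Pow (edges G)"]) (auto simp: spanning_trees_def finite_edges)

lemma finite_forests: "finite (spanning_2forests G)"
  by (rule finite_subset[of _ "Pow (edges G)"]) (auto simp: spanning_2forests_def finite_edges)

lemma compl_monomial_single:
  "compl_monomial G S = (Poly_Mapping.single (exponent_of G S) 1 :: (nat, 'a::comm_ring_1) mpoly)"
proof -
  have "(\<Prod>e\<in>E. mvar e :: (nat, 'a) mpoly) =
      Poly_Mapping.single (\<Sum>e\<in>E. Poly_Mapping.single e 1) 1" if "finite E" for E
    using that by (induction E rule: finite_induct) (auto simp: mvar_def mult_single)
  then show ?thesis unfolding compl_monomial_def exponent_of_def by auto
qed

lemma keys_exponent_of: "Poly_Mapping.keys (exponent_of G S) \<subseteq> {1..num_int G}"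
  unfolding exponent_of_def using keys_sum by fastforce

lemma equiv_linked: "equiv (verts G) (linked G S)"
proof -
  define r where "r = {(a, b). \<exists>e\<in>S. ends G e = Upair a b}"
  have "sym r" by (auto simp: r_def sym_def) (metis Upair_inject)
  then have "sym (r\<^sup>*)" by (rule sym_rtrancl)
  moreover have "linked G S = {(u, v) \<in> verts G \<times> verts G. (u, v) \<in> r\<^sup>*}" by (simp add: linked_def r_def)
  ultimately show ?thesis
    unfolding equiv_def refl_on_def sym_def trans_def by (auto intro: rtrancl_trans)
qed

text \<open>
  External edges belong to the subgraph, so both ends of such an edge lie in the same component.
\<close>
lemma components_legs_disjoint:
  assumes G: "feynman_graph G" and S: "External ` {1..num_ext G} \<subseteq> S"
    and CD: "C \<in> components_of G S" "D \<in> components_of G S" and i: "i \<in> legs G C" "i \<in> legs G D"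
  shows "C = D"
proof -
  have "i \<in> {1..num_ext G}" using i by (simp add: legs_def)
  then have iN: "External i \<in> S" "External i \<in> edges G" using S unfolding edges_def by blast+
  obtain a b where ab: "ends G (External i) = Upair a b" by (metis uprod_exhaust)
  have "{a, b} \<subseteq> verts G" using G iN ab unfolding feynman_graph_def by fastforce
  moreover have "(a, b) \<in> {(a, b). \<exists>e\<in>S. ends G e = Upair a b}\<^sup>*" "(b, a) \<in> {(a, b). \<exists>e\<in>S. ends G e = Upair a b}\<^sup>*"
    using iN ab by (auto intro!: r_into_rtrancl bexI[of _ "External i"])
  ultimately have linked: "(u, w) \<in> linked G S" if "u \<in> {a, b}" "w \<in> {a, b}" for u w
    using that by (auto simp: linked_def)
  obtain u w where "u \<in> {a, b}" "u \<in> C" "w \<in> {a, b}" "w \<in> D" using i ab by (auto simp: legs_def)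
  then show ?thesis
    using quotient_eqI[OF equiv_linked, of C G S D u w] CD linked unfolding components_of_def by blast
qed

text \<open>
  As no leg is attached to both components, only entries off the diagonal occur. The right-hand side does not depend
  on the order of the two components.
\<close>
lemma separated_sum:
  fixes z :: "var \<Rightarrow> 'a::comm_ring_1"
  assumes G: "feynman_graph G" and S: "External ` {1..num_ext G} \<subseteq> S"
    and CD: "components_of G S = {C, D}" "C \<noteq> D"
  shows "(\<Sum>i\<in>legs G C. \<Sum>j\<in>legs G D. kmat G z i j) =
    (\<Sum>(i, j)\<in>leg_pairs G. if separates G S i j then z (Momentum i j) else 0)"
proof -
  have disj: "legs G C \<inter> legs G D = {}"
    using components_legs_disjoint[OF G S, of C D] CD by auto
  have fin: "finite (legs G C)" "finite (legs G D)" by (auto simp: legs_def)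
  have sep: "separates G S i j \<longleftrightarrow> (i \<in> legs G C \<and> j \<in> legs G D) \<or> (i \<in> legs G D \<and> j \<in> legs G C)" for i j
    unfolding separates_def CD(1) using CD(2) by (auto simp: doubleton_eq_iff)
  define T where "T = {(i, j) \<in> leg_pairs G. separates G S i j}"
  have bij: "bij_betw (\<lambda>(i, j). (min i j, max i j)) (legs G C \<times> legs G D) T"
    unfolding bij_betw_def
  proof
    show "inj_on (\<lambda>(i, j). (min i j, max i j)) (legs G C \<times> legs G D)"
    proof (rule inj_onI, clarify)
      fix i j i' j'
      assume mem: "i \<in> legs G C" "j \<in> legs G D" "i' \<in> legs G C" "j' \<in> legs G D"
        and eq: "min i j = min i' j'" "max i j = max i' j'"
      have "(i = i' \<and> j = j') \<or> (i = j' \<and> j = i')"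
        using eq unfolding min_def max_def by presburger
      then show "i = i' \<and> j = j'" using mem disj by blast
    qed
    show "(\<lambda>(i, j). (min i j, max i j)) ` (legs G C \<times> legs G D) = T"
    proof
      show "(\<lambda>(i, j). (min i j, max i j)) ` (legs G C \<times> legs G D) \<subseteq> T"
      proof clarify
        fix i j assume ij: "i \<in> legs G C" "j \<in> legs G D"
        then have "i \<noteq> j" using disj by blast
        moreover have "i \<in> {1..num_ext G}" "j \<in> {1..num_ext G}" using ij by (auto simp: legs_def)
        ultimately show "(min i j, max i j) \<in> T"
          using ij by (cases "i < j") (auto simp: T_def sep leg_pairs_def)
      qed
      show "T \<subseteq> (\<lambda>(i, j). (min i j, max i j)) ` (legs G C \<times> legs G D)"
      proof
        fix x assume "x \<in> T"
        then obtain i j where x: "x = (i, j)" "i < j" "separates G S i j" by (auto simp: T_def leg_pairs_def)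
        from x(3)[unfolded sep] show "x \<in> (\<lambda>(i, j). (min i j, max i j)) ` (legs G C \<times> legs G D)"
        proof
          assume "i \<in> legs G C \<and> j \<in> legs G D"
          then show ?thesis using x(1,2) by (intro image_eqI[of _ _ "(i, j)"]) auto
        next
          assume "i \<in> legs G D \<and> j \<in> legs G C"
          then show ?thesis using x(1,2) by (intro image_eqI[of _ _ "(j, i)"]) auto
        qed
      qed
    qed
  qed
  have "(\<Sum>i\<in>legs G C. \<Sum>j\<in>legs G D. kmat G z i j) = (\<Sum>(i, j)\<in>legs G C \<times> legs G D. kmat G z i j)"
    by (rule sum.cartesian_product)
  also have "\<dots> = (\<Sum>x\<in>legs G C \<times> legs G D. (\<lambda>(i, j). z (Momentum i j)) (case x of (i, j) \<Rightarrow> (min i j, max i j)))"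
    using disj by (intro sum.cong) (auto simp: kmat_def)
  also have "\<dots> = (\<Sum>(i, j)\<in>T. z (Momentum i j))"
    by (rule sum.reindex_bij_betw[OF bij])
  also have "\<dots> = (\<Sum>(i, j)\<in>leg_pairs G. if separates G S i j then z (Momentum i j) else 0)"
    unfolding T_def by (rule sum.mono_neutral_cong_left) (auto simp: finite_leg_pairs split: if_splits)
  finally show ?thesis .
qed

lemma forest_coeff_eq:
  fixes z :: "var \<Rightarrow> 'a::comm_ring_1"
  assumes G: "feynman_graph G" and S: "S \<in> spanning_2forests G"
  shows "forest_coeff G z S = (\<Sum>(i, j)\<in>leg_pairs G. if separates G S i j then z (Momentum i j) else 0)"
proof -
  have S': "External ` {1..num_ext G} \<subseteq> S" "card (components_of G S) = 2"
    using S by (auto simp: spanning_2forests_def)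
  obtain C D where CD: "components_of G S = {C, D}" "C \<noteq> D" using S'(2) by (auto simp: card_2_iff)
  show ?thesis
    unfolding forest_coeff_def
  proof (rule the_equality)
    show "\<exists>C D. components_of G S = {C, D} \<and> C \<noteq> D \<and>
        (\<Sum>(i, j)\<in>leg_pairs G. if separates G S i j then z (Momentum i j) else 0) =
        (\<Sum>i\<in>legs G C. \<Sum>j\<in>legs G D. kmat G z i j)"
      by (intro exI[of _ C] exI[of _ D] conjI CD separated_sum[OF G S'(1) CD, symmetric])
  next
    fix c assume "\<exists>C D. components_of G S = {C, D} \<and> C \<noteq> D \<and>
        c = (\<Sum>i\<in>legs G C. \<Sum>j\<in>legs G D. kmat G z i j)"
    then obtain C' D' where *: "components_of G S = {C', D'}" "C' \<noteq> D'"
        "c = (\<Sum>i\<in>legs G C'. \<Sum>j\<in>legs G D'. kmat G z i j)" by blast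
    show "c = (\<Sum>(i, j)\<in>leg_pairs G. if separates G S i j then z (Momentum i j) else 0)"
      unfolding *(3) by (rule separated_sum[OF G S'(1) *(1,2)])
  qed
qed

lemma sum_if_card:
  fixes c :: "'a::comm_ring_1"
  assumes "finite X"
  shows "(\<Sum>T\<in>X. if P T then c else 0) = c * of_nat (card {T \<in> X. P T})"
  using assms by (simp add: sum.inter_filter[symmetric] mult.commute)

lemma lookup_symanzik_F:
  fixes z :: "var \<Rightarrow> 'a::comm_ring_1"
  assumes G: "feynman_graph G"
  shows "Poly_Mapping.lookup (symanzik_F G z) m = coef G z m"
proof -
  have 1: "(\<Sum>S\<in>spanning_2forests G. mconst (forest_coeff G z S) * compl_monomial G S) =
      (\<Sum>S\<in>spanning_2forests G. Poly_Mapping.single (exponent_of G S) (forest_coeff G z S))"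
    by (simp add: compl_monomial_single mconst_def mult_single)
  have 2: "(\<Sum>e\<in>{1..num_int G}. mconst (z (Mass e)) * mvar e) * symanzik_U G =
      (\<Sum>e\<in>{1..num_int G}. \<Sum>T\<in>spanning_trees G.
         Poly_Mapping.single (Poly_Mapping.single e 1 + exponent_of G T) (z (Mass e)))"
    unfolding symanzik_U_def
    by (simp add: compl_monomial_single mconst_def mvar_def mult_single sum_product)
  have "Poly_Mapping.lookup (symanzik_F G z) m =
      (\<Sum>S\<in>spanning_2forests G. if exponent_of G S = m then forest_coeff G z S else 0) +
      (\<Sum>e\<in>{1..num_int G}. \<Sum>T\<in>spanning_trees G.
         if Poly_Mapping.single e 1 + exponent_of G T = m then z (Mass e) else 0)"
    unfolding symanzik_F_def 1 2 lookup_add lookup_sum lookup_single when_def ..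
  also have "(\<Sum>S\<in>spanning_2forests G. if exponent_of G S = m then forest_coeff G z S else 0) =
      (\<Sum>S\<in>spanning_2forests G. \<Sum>(i, j)\<in>leg_pairs G.
         if separates G S i j \<and> exponent_of G S = m then z (Momentum i j) else 0)"
  proof (intro sum.cong refl)
    fix S assume "S \<in> spanning_2forests G"
    then show "(if exponent_of G S = m then forest_coeff G z S else 0) =
        (\<Sum>(i, j)\<in>leg_pairs G. if separates G S i j \<and> exponent_of G S = m then z (Momentum i j) else 0)"
      by (auto simp: forest_coeff_eq[OF G] intro!: sum.neutral)
  qed
  also have "\<dots> = (\<Sum>(i, j)\<in>leg_pairs G. \<Sum>S\<in>spanning_2forests G.
         if separates G S i j \<and> exponent_of G S = m then z (Momentum i j) else 0)"
    by (subst sum.swap) (simp add: case_prod_unfold)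
  also have "\<dots> = (\<Sum>(i, j)\<in>leg_pairs G. z (Momentum i j) * of_nat (param_count G (Momentum i j) m))"
    by (simp add: sum_if_card finite_forests param_count_def)
  also have "(\<Sum>e\<in>{1..num_int G}. \<Sum>T\<in>spanning_trees G.
         if Poly_Mapping.single e 1 + exponent_of G T = m then z (Mass e) else 0) =
      (\<Sum>e\<in>{1..num_int G}. z (Mass e) * of_nat (param_count G (Mass e) m))"
    by (simp add: sum_if_card finite_trees param_count_def)
  finally have eq: "Poly_Mapping.lookup (symanzik_F G z) m =
     (\<Sum>(i, j)\<in>leg_pairs G. z (Momentum i j) * of_nat (param_count G (Momentum i j) m)) +
     (\<Sum>e\<in>{1..num_int G}. z (Mass e) * of_nat (param_count G (Mass e) m))" .
  have "coef G z m = (\<Sum>v\<in>Mass ` {1..num_int G}. z v * of_nat (param_count G v m)) +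
      (\<Sum>v\<in>(\<lambda>(i, j). Momentum i j) ` leg_pairs G. z v * of_nat (param_count G v m))"
    unfolding coef_def kin_vars_eq by (intro sum.union_disjoint) (auto simp: finite_leg_pairs)
  also have "(\<Sum>v\<in>Mass ` {1..num_int G}. z v * of_nat (param_count G v m)) =
      (\<Sum>e\<in>{1..num_int G}. z (Mass e) * of_nat (param_count G (Mass e) m))"
    by (subst sum.reindex) (auto simp: inj_on_def)
  also have "(\<Sum>v\<in>(\<lambda>(i, j). Momentum i j) ` leg_pairs G. z v * of_nat (param_count G v m)) =
      (\<Sum>(i, j)\<in>leg_pairs G. z (Momentum i j) * of_nat (param_count G (Momentum i j) m))"
    by (subst sum.reindex) (auto simp: inj_on_def case_prod_unfold)
  finally show ?thesis using eq by (simp add: add.commute)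
qed

lemma support_subset: "support G \<subseteq> exponent_of G ` spanning_2forests G \<union>
    (\<lambda>(e, T). Poly_Mapping.single e 1 + exponent_of G T) ` ({1..num_int G} \<times> spanning_trees G)"
proof
  fix m assume "m \<in> support G"
  then obtain v where v: "v \<in> kin_vars G" "param_count G v m \<noteq> 0" by (auto simp: support_def)
  show "m \<in> exponent_of G ` spanning_2forests G \<union>
    (\<lambda>(e, T). Poly_Mapping.single e 1 + exponent_of G T) ` ({1..num_int G} \<times> spanning_trees G)"
  proof (cases v)
    case (Schwinger e)
    then show ?thesis using v by (simp add: param_count_def)
  next
    case (Mass e)
    then have "card {T \<in> spanning_trees G. Poly_Mapping.single e 1 + exponent_of G T = m} \<noteq> 0"
      using v(2) by (simp add: param_count_def)
    then have "{T \<in> spanning_trees G. Poly_Mapping.single e 1 + exponent_of G T = m} \<noteq> {}"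
      by (rule contrapos_nn) (simp only: card.empty)
    moreover have "e \<in> {1..num_int G}" using v Mass by (auto simp: kin_vars_def)
    ultimately show ?thesis by force
  next
    case (Momentum i j)
    then have "card {S \<in> spanning_2forests G. separates G S i j \<and> exponent_of G S = m} \<noteq> 0"
      using v(2) by (simp add: param_count_def)
    then have "{S \<in> spanning_2forests G. separates G S i j \<and> exponent_of G S = m} \<noteq> {}"
      by (rule contrapos_nn) (simp only: card.empty)
    then show ?thesis by force
  qed
qed

lemma finite_support: "finite (support G)"
  by (rule finite_subset[OF support_subset]) (simp add: finite_forests finite_trees)

lemma keys_support:
  assumes "m \<in> support G"
  shows "Poly_Mapping.keys m \<subseteq> {1..num_int G}"
proof -
  have *: "Poly_Mapping.keys (Poly_Mapping.single e 1 + exponent_of G T) \<subseteq> {1..num_int G}"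
    if "e \<in> {1..num_int G}" for e T
    using keys_add[of "Poly_Mapping.single e 1" "exponent_of G T"] keys_exponent_of[of G T] that by auto
  consider S where "m = exponent_of G S"
    | e T where "e \<in> {1..num_int G}" "m = Poly_Mapping.single e 1 + exponent_of G T"
    using subsetD[OF support_subset assms] by auto
  then show ?thesis
  proof cases
    case 1
    then show ?thesis using keys_exponent_of by blast
  next
    case 2
    then show ?thesis using * by blast
  qed
qed

lemma coef_outside_support: "m \<notin> support G \<Longrightarrow> coef G z m = 0"
  by (auto simp: coef_def support_def)

lemma keys_symanzik_F: "feynman_graph G \<Longrightarrow> Poly_Mapping.keys (symanzik_F G z) \<subseteq> support G"
  using coef_outside_support by (fastforce simp: in_keys_iff lookup_symanzik_F)

lemma meval_symanzik_F:
  fixes z :: "var \<Rightarrow> 'a::comm_ring_1"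
  assumes "feynman_graph G"
  shows "meval u (symanzik_F G z) = (\<Sum>m\<in>support G. coef G z m * mono_eval u m)"
  using meval.heval_superset[OF finite_support keys_symanzik_F[OF assms]]
  by (simp add: lookup_symanzik_F[OF assms])

definition face_exponents :: "'v feynman_data \<Rightarrow> (nat \<Rightarrow>\<^sub>0 real) set \<Rightarrow> (nat \<Rightarrow>\<^sub>0 nat) set" where
  "face_exponents G Q = {m \<in> support G. real_exponent m \<in> Q}"

lemma face_exponents_subset: "face_exponents G Q \<subseteq> support G"
  by (auto simp: face_exponents_def)

lemma finite_face_exponents: "finite (face_exponents G Q)"
  using face_exponents_subset finite_support by (rule finite_subset)

lemma restrict_symanzik_F:
  fixes z :: "var \<Rightarrow> 'a::comm_ring_1"
  assumes G: "feynman_graph G"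
  shows "restrict_poly Q (symanzik_F G z) = (\<Sum>m\<in>face_exponents G Q. Poly_Mapping.single m (coef G z m))"
  unfolding restrict_poly_def lookup_symanzik_F[OF G]
  by (rule sum.mono_neutral_left)
     (use keys_symanzik_F[OF G, of z] finite_face_exponents[of G Q] in
       \<open>auto simp: face_exponents_def in_keys_iff lookup_symanzik_F[OF G]\<close>)

text \<open>
  The coefficient of each of these monomials is a nonzero linear form in \<open>z\<close>.
\<close>
lemma generic_support_eq:
  assumes G: "feynman_graph G"
  shows "generic_support G = support G"
proof
  show "generic_support G \<subseteq> support G"
    unfolding generic_support_def using keys_symanzik_F[OF G] by blast
  show "support G \<subseteq> generic_support G"
  proof
    fix a assume "a \<in> support G"
    then obtain v where v: "v \<in> kin_vars G" "param_count G v a \<noteq> 0" by (auto simp: support_def)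
    define f :: "(var, complex) mpoly" where
      "f = (\<Sum>v\<in>kin_vars G. mvar v * mconst (of_nat (param_count G v a)))"
    have f: "f \<in> mpolys (kin_vars G)"
      unfolding f_def by (intro mpolys.sum_mem mpolys.mult_mem mvar_mem mconst_mem)
    have ev: "meval z f = coef G z a" for z by (simp add: f_def coef_def)
    define U where "U = affine_space (kin_vars G) - hypersurface (kin_vars G) f"
    have "openin (zariski (kin_vars G)) U"
      unfolding U_def using closedin_hypersurface[OF f] by (metis openin_diff openin_topspace topspace_zariski)
    moreover have "restrict (\<lambda>w. if w = v then 1 else 0) (kin_vars G) \<in> U"
    proof -
      have "coef G (restrict (\<lambda>w. if w = v then 1 else 0) (kin_vars G)) a =
          (\<Sum>w\<in>kin_vars G. if w = v then of_nat (param_count G v a) else (0::complex))"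
        unfolding coef_def by (intro sum.cong) auto
      also have "\<dots> \<noteq> 0" using v by (simp add: finite_kin_vars)
      finally show ?thesis by (simp add: U_def hypersurface_def ev affine_space_def)
    qed
    moreover have "\<forall>z\<in>U. a \<in> Poly_Mapping.keys (symanzik_F G z)"
      by (auto simp: U_def hypersurface_def ev in_keys_iff lookup_symanzik_F[OF G])
    ultimately show "a \<in> generic_support G" unfolding generic_support_def by blast
  qed
qed

section \<open>Boundary points have a singular face at a positive point\<close>

lemma mono_eval_pos: "(\<And>e. u e > 0) \<Longrightarrow> mono_eval u m > (0::real)"
  unfolding mono_eval_def by (intro prod_pos) auto

lemma mono_eval_nonneg: "(\<And>e. e \<in> Poly_Mapping.keys m \<Longrightarrow> u e \<ge> 0) \<Longrightarrow> mono_eval u m \<ge> (0::real)"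
  unfolding mono_eval_def by (intro prod_nonneg) auto

lemma mono_eval_cong: "(\<And>e. e \<in> Poly_Mapping.keys m \<Longrightarrow> u e = u' e) \<Longrightarrow> mono_eval u m = mono_eval u' m"
  unfolding mono_eval_def by (intro prod.cong) auto

lemma mono_eval_of_real: "mono_eval (\<lambda>e. of_real (u e)) m = (of_real (mono_eval u m) :: complex)"
  by (simp add: mono_eval_def)

lemma copositive_cone_upper:
  assumes G: "feynman_graph G"
  shows "upper_set (kin_vars G) (copositive_cone G)"
  unfolding upper_set_def
proof (intro conjI ballI impI)
  show "copositive_cone G \<subseteq> affine_space (kin_vars G)" by (auto simp: copositive_cone_def)
  fix z z' :: "var \<Rightarrow> real"
  assume z: "z \<in> copositive_cone G" "z' \<in> affine_space (kin_vars G)" "\<forall>v\<in>kin_vars G. z v \<le> z' v"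
  have "meval u (symanzik_F G z') \<ge> 0" if u: "\<forall>e\<in>{1..num_int G}. u e \<ge> 0" for u
  proof -
    have "0 \<le> meval u (symanzik_F G z)" using z(1) u by (simp add: copositive_cone_def)
    also have "\<dots> \<le> meval u (symanzik_F G z')"
      unfolding meval_symanzik_F[OF G] coef_def
      using z(3) u by (intro sum_mono mult_right_mono mono_eval_nonneg) (auto dest!: subsetD[OF keys_support])
    finally show ?thesis .
  qed
  then show "z' \<in> copositive_cone G" using z(2) by (simp add: copositive_cone_def)
qed

lemma coef_lipschitz:
  fixes z z' :: "var \<Rightarrow> real"
  assumes "z' \<in> box_around (kin_vars G) z \<eta>"
  shows "\<bar>coef G z' m - coef G z m\<bar> \<le> \<eta> * (\<Sum>v\<in>kin_vars G. real (param_count G v m))"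
proof -
  have "\<bar>coef G z' m - coef G z m\<bar> = \<bar>\<Sum>v\<in>kin_vars G. (z' v - z v) * real (param_count G v m)\<bar>"
    by (simp add: coef_def algebra_simps sum_subtractf)
  also have "\<dots> \<le> (\<Sum>v\<in>kin_vars G. \<bar>(z' v - z v) * real (param_count G v m)\<bar>)" by (rule sum_abs)
  also have "\<dots> \<le> (\<Sum>v\<in>kin_vars G. \<eta> * real (param_count G v m))"
  proof (rule sum_mono)
    fix v assume "v \<in> kin_vars G"
    then have "\<bar>z' v - z v\<bar> \<le> \<eta>" using assms by (simp add: box_around_def less_imp_le)
    then show "\<bar>(z' v - z v) * real (param_count G v m)\<bar> \<le> \<eta> * real (param_count G v m)"
      by (simp add: abs_mult mult_right_mono)
  qed
  finally show ?thesis by (simp add: sum_distrib_left)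
qed

lemma meval_lipschitz:
  fixes z z' :: "var \<Rightarrow> real"
  assumes G: "feynman_graph G"
  defines "L \<equiv> (\<Sum>m\<in>support G. \<Sum>v\<in>kin_vars G. real (param_count G v m))"
  assumes z': "z' \<in> box_around (kin_vars G) z \<eta>" "\<eta> > 0" and u: "\<And>e. u e > 0"
  shows "\<bar>meval u (symanzik_F G z') - meval u (symanzik_F G z)\<bar> \<le> \<eta> * L * (\<Sum>m\<in>support G. mono_eval u m)"
proof -
  have "\<bar>meval u (symanzik_F G z') - meval u (symanzik_F G z)\<bar> =
      \<bar>\<Sum>m\<in>support G. (coef G z' m - coef G z m) * mono_eval u m\<bar>"
    by (simp add: meval_symanzik_F[OF G] algebra_simps sum_subtractf)
  also have "\<dots> \<le> (\<Sum>m\<in>support G. \<bar>(coef G z' m - coef G z m) * mono_eval u m\<bar>)" by (rule sum_abs)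
  also have "\<dots> \<le> (\<Sum>m\<in>support G. \<eta> * L * mono_eval u m)"
  proof (rule sum_mono)
    fix m assume m: "m \<in> support G"
    have "(\<Sum>v\<in>kin_vars G. real (param_count G v m)) \<le> L"
      unfolding L_def using m finite_support by (intro member_le_sum) (auto intro: sum_nonneg)
    then have "\<bar>coef G z' m - coef G z m\<bar> \<le> \<eta> * L"
      using coef_lipschitz[OF z'(1), of m] z'(2) by (meson mult_left_mono less_imp_le order_trans)
    then show "\<bar>(coef G z' m - coef G z m) * mono_eval u m\<bar> \<le> \<eta> * L * mono_eval u m"
      using mono_eval_pos[of u m] u by (simp add: abs_mult)
  qed
  finally show ?thesis by (simp add: sum_distrib_left)
qed

text \<open>
  The point where the polynomial is negative may have vanishing coordinates; it is moved into the interior of the orthant.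
\<close>
lemma negative_at_positive_point:
  assumes G: "feynman_graph G" and z: "z \<in> affine_space (kin_vars G)" "z \<notin> copositive_cone G"
  shows "\<exists>u. (\<forall>e. u e > 0) \<and> meval u (symanzik_F G z) < (0::real)"
proof -
  obtain u where u: "\<forall>e\<in>{1..num_int G}. u e \<ge> 0" "meval u (symanzik_F G z) < 0"
    using z unfolding copositive_cone_def by (auto simp: not_le)
  define w where "w k e = (if e \<in> {1..num_int G} then u e else 0) + 1 / real (Suc k)" for k e
  have pos: "w k e > 0" for k e using u(1) by (auto simp: w_def intro: add_nonneg_pos)
  have "(\<lambda>k. w k e) \<longlonglongrightarrow> (if e \<in> {1..num_int G} then u e else 0) + 0" for e
    unfolding w_def by (intro tendsto_intros LIMSEQ_Suc lim_1_over_n)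
  then have "(\<lambda>k. meval (w k) (symanzik_F G z)) \<longlonglongrightarrow>
      meval (\<lambda>e. (if e \<in> {1..num_int G} then u e else 0) + 0) (symanzik_F G z)"
    by (rule meval_tendsto)
  also have "meval (\<lambda>e. (if e \<in> {1..num_int G} then u e else 0) + 0) (symanzik_F G z) = meval u (symanzik_F G z)"
    unfolding meval_symanzik_F[OF G] using keys_support
    by (intro sum.cong refl arg_cong[of _ _ "(*) _"] mono_eval_cong) (auto dest!: subsetD[OF keys_support])
  finally have "eventually (\<lambda>k. meval (w k) (symanzik_F G z) < 0) sequentially"
    using u(2) by (rule order_tendstoD)
  then obtain k where "meval (w k) (symanzik_F G z) < 0" using eventually_happens'[OF sequentially_bot] by blast
  then show ?thesis using pos by blast
qed

lemma lookup_scaleR: "Poly_Mapping.lookup (r *\<^sub>R (p :: 'a \<Rightarrow>\<^sub>0 real)) e = r * Poly_Mapping.lookup p e"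
proof -
  have "finite {i. r *\<^sub>R Poly_Mapping.lookup p i \<noteq> 0}"
    by (rule finite_subset[OF _ finite_keys[of p]]) (auto simp: in_keys_iff)
  then show ?thesis unfolding scaleR_poly_mapping_def by simp
qed

text \<open>The points where a linear functional is maximal form a face.\<close>
lemma weight_face:
  fixes A :: "(nat \<Rightarrow>\<^sub>0 nat) set"
  assumes BA: "B \<subseteq> A" "B \<noteq> {}"
    and \<omega>: "\<And>m. m \<in> B \<Longrightarrow> dot E (expo m) \<omega> = M" "\<And>m. m \<in> A - B \<Longrightarrow> dot E (expo m) \<omega> < M"
  shows "\<exists>Q. Q face_of convex hull (real_exponent ` A) \<and> Q \<noteq> {} \<and> {m \<in> A. real_exponent m \<in> Q} = B"
proof -
  define l where "l p = dot E (Poly_Mapping.lookup p) \<omega>" for p :: "nat \<Rightarrow>\<^sub>0 real"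
  define P where "P = convex hull (real_exponent ` A)"
  have l_lin: "l (u *\<^sub>R p + v *\<^sub>R q) = u * l p + v * l q" for u v p q
    by (simp add: l_def dot_def lookup_add lookup_scaleR sum_distrib_left algebra_simps sum.distrib)
  have l_exp: "l (real_exponent m) = dot E (expo m) \<omega>" for m
    by (simp add: l_def real_exponent_def expo_def[abs_def] Poly_Mapping.map.rep_eq when_def dot_def)
      (auto intro!: sum.cong)
  have "real_exponent ` A \<subseteq> {p. l p \<le> M}" using \<omega> l_exp by (force simp: less_le)
  moreover have "convex {p. l p \<le> M}"
    unfolding convex_def l_lin
  proof (intro ballI allI impI, clarify)
    fix p q u v assume *: "l p \<le> M" "l q \<le> M" "0 \<le> u" "0 \<le> v" "u + v = (1::real)"
    have "u * l p + v * l q \<le> u * M + v * M" using * by (intro add_mono mult_left_mono) auto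
    then show "l (u *\<^sub>R p + v *\<^sub>R q) \<le> M" using * l_lin by (simp flip: distrib_right)
  qed
  ultimately have le: "l p \<le> M" if "p \<in> P" for p
    using that hull_minimal[of "real_exponent ` A" "{p. l p \<le> M}" convex] unfolding P_def by blast
  define Q where "Q = {p \<in> P. l p = M}"
  have "Q face_of P"
    unfolding face_of_def
  proof (intro conjI ballI impI)
    show "Q \<subseteq> P" by (auto simp: Q_def)
    show "convex Q"
      unfolding convex_def
    proof (intro ballI allI impI)
      fix p q u v assume *: "p \<in> Q" "q \<in> Q" "0 \<le> u" "0 \<le> v" "u + v = (1::real)"
      have "convex P" by (simp add: P_def)
      then have "u *\<^sub>R p + v *\<^sub>R q \<in> P" using * unfolding convex_def Q_def by blast
      then show "u *\<^sub>R p + v *\<^sub>R q \<in> Q" using * by (simp add: Q_def l_lin flip: distrib_right)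
    qed
    fix a b x assume *: "a \<in> P" "b \<in> P" "x \<in> Q" "x \<in> open_segment a b"
    then obtain t where t: "0 < t" "t < 1" "x = (1 - t) *\<^sub>R a + t *\<^sub>R b" by (auto simp: in_segment)
    have eq: "(1 - t) * (M - l a) + t * (M - l b) = 0"
    proof -
      have "l x = M" using *(3) by (simp add: Q_def)
      then have "(1 - t) * l a + t * l b = M" unfolding t(3) l_lin .
      then show ?thesis by (simp add: algebra_simps)
    qed
    have "0 \<le> (1 - t) * (M - l a)" "0 \<le> t * (M - l b)" using le * t by auto
    then have "(1 - t) * (M - l a) = 0" "t * (M - l b) = 0" using eq by linarith+
    then show "a \<in> Q" "b \<in> Q" using t * by (auto simp: Q_def)
  qed
  moreover have "{m \<in> A. real_exponent m \<in> Q} = B"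
  proof -
    have "real_exponent m \<in> Q \<longleftrightarrow> m \<in> B" if "m \<in> A" for m
      using that \<omega>(1)[of m] \<omega>(2)[of m] hull_inc[of "real_exponent m" "real_exponent ` A" convex]
      by (auto simp: Q_def P_def l_exp)
    then show ?thesis using BA by auto
  qed
  moreover have "Q \<noteq> {}" using calculation BA by auto
  ultimately show ?thesis unfolding P_def by blast
qed

text \<open>
  Arbitrarily close to \<open>z\<close> there are parameters outside the cone, for which the polynomial is negative at some positive point.
  As the coefficients depend on the parameters in a Lipschitz way, \<open>\<F>\<^sub>z\<close> itself has values at these points that are
  small compared with the sum of the monomials. In the limit they give a face on which the restriction of \<open>\<F>\<^sub>z\<close> has
  a zero at a positive point, and the restriction inherits nonnegativity from \<open>\<F>\<^sub>z\<close>.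
\<close>
lemma boundary_point_singular:
  assumes G: "feynman_graph G" and z: "z \<in> copositive_boundary G"
  shows "\<exists>Q x. Q face_of newton_polytope G \<and> Q \<noteq> {} \<and> face_exponents G Q \<noteq> {} \<and> (\<forall>e. x e > 0) \<and>
    meval x (restrict_poly Q (symanzik_F G z)) = (0::real) \<and>
    (\<forall>i. meval x (mpderiv i (restrict_poly Q (symanzik_F G z))) = 0)"
proof -
  let ?K = "kin_vars G" and ?A = "support G" and ?E = "{1..num_int G}"
  note fr = frontier_by_boxes[OF finite_kin_vars, of "copositive_cone G" G]
  have sub: "copositive_cone G \<subseteq> affine_space ?K" by (auto simp: copositive_cone_def)
  have zK: "z \<in> affine_space ?K" and meets: "\<And>\<eta>. \<eta> > 0 \<Longrightarrow> box_around ?K z \<eta> \<inter> copositive_cone G \<noteq> {}"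
    and leaves: "\<And>\<eta>. \<eta> > 0 \<Longrightarrow> \<not> box_around ?K z \<eta> \<subseteq> copositive_cone G"
    using z fr[OF sub] unfolding copositive_boundary_def by blast+
  define L where "L = (\<Sum>m\<in>?A. \<Sum>v\<in>?K. real (param_count G v m))"
  have L: "L \<ge> 0" unfolding L_def by (intro sum_nonneg) auto
  have nonneg: "meval u (symanzik_F G z) \<ge> 0" if u: "\<And>e. u e > 0" for u
  proof (rule field_le_epsilon)
    fix \<epsilon> :: real assume \<epsilon>: "\<epsilon> > 0"
    define S where "S = (\<Sum>m\<in>?A. mono_eval u m)"
    have S: "S \<ge> 0" unfolding S_def using u by (intro sum_nonneg less_imp_le mono_eval_pos) auto
    define \<eta> where "\<eta> = \<epsilon> / (L * S + 1)"
    have pos: "L * S + 1 > 0" using L S by (simp add: add_nonneg_pos)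
    then have \<eta>: "\<eta> > 0" using \<epsilon> by (simp add: \<eta>_def)
    then obtain z' where z': "z' \<in> box_around ?K z \<eta>" "z' \<in> copositive_cone G" using meets by blast
    have "0 \<le> meval u (symanzik_F G z')" using z'(2) u by (auto simp: copositive_cone_def less_imp_le)
    moreover have "\<bar>meval u (symanzik_F G z') - meval u (symanzik_F G z)\<bar> \<le> \<eta> * L * S"
      unfolding S_def L_def by (rule meval_lipschitz[OF G z'(1) \<eta> u])
    moreover have "\<eta> * L * S \<le> \<epsilon>"
    proof -
      have "\<eta> * L * S \<le> \<eta> * (L * S + 1)" using \<eta> by (simp add: algebra_simps)
      also have "\<dots> = \<epsilon>" using pos by (simp add: \<eta>_def)
      finally show ?thesis .
    qed
    ultimately show "0 \<le> meval u (symanzik_F G z) + \<epsilon>" by linarith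
  qed
  have "\<exists>u. (\<forall>e. u e > 0) \<and> meval u (symanzik_F G z) < (1 / real (Suc k)) * (\<Sum>m\<in>?A. mono_eval u m)" for k
  proof -
    define \<eta> where "\<eta> = (1 / real (Suc k)) / (L + 1)"
    have \<eta>: "\<eta> > 0" using L by (simp add: \<eta>_def)
    obtain z' where z': "z' \<in> box_around ?K z \<eta>" "z' \<notin> copositive_cone G" using leaves[OF \<eta>] by blast
    have "z' \<in> affine_space ?K" using z'(1) by (simp add: box_around_def)
    from negative_at_positive_point[OF G this z'(2)] obtain u
      where u: "\<forall>e. u e > 0" "meval u (symanzik_F G z') < 0" by blast
    define S where "S = (\<Sum>m\<in>?A. mono_eval u m)"
    have S: "S \<ge> 0" unfolding S_def using u(1) by (intro sum_nonneg less_imp_le mono_eval_pos) auto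
    have "\<bar>meval u (symanzik_F G z') - meval u (symanzik_F G z)\<bar> \<le> \<eta> * L * S"
      unfolding S_def L_def by (rule meval_lipschitz[OF G z'(1) \<eta>]) (use u in auto)
    moreover have "\<eta> * L * S \<le> (1 / real (Suc k)) * S"
    proof (rule mult_right_mono[OF _ S])
      have "\<eta> * L \<le> \<eta> * (L + 1)" using \<eta> by (simp add: algebra_simps)
      also have "\<dots> = 1 / real (Suc k)" using L by (simp add: \<eta>_def)
      finally show "\<eta> * L \<le> 1 / real (Suc k)" .
    qed
    ultimately have "meval u (symanzik_F G z) < (1 / real (Suc k)) * S" using u(2) by linarith
    then show ?thesis using u(1) unfolding S_def by blast
  qed
  then have "\<forall>k. \<exists>u. (\<forall>e. u e > 0) \<and> meval u (symanzik_F G z) < (1 / real (Suc k)) * (\<Sum>m\<in>?A. mono_eval u m)"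
    by (rule allI)
  from choice[OF this] obtain u where
    u': "\<forall>k. (\<forall>e. u k e > 0) \<and> meval (u k) (symanzik_F G z) < (1 / real (Suc k)) * (\<Sum>m\<in>?A. mono_eval (u k) m)" ..
  have u: "u k e > 0"
    "(\<Sum>m\<in>?A. coef G z m * mono_eval (u k) m) < (1 / real (Suc k)) * (\<Sum>m\<in>?A. mono_eval (u k) m)" for k e
    using u'[rule_format, of k] unfolding meval_symanzik_F[OF G] by blast+
  have "\<exists>B y \<omega> M. B \<subseteq> ?A \<and> B \<noteq> {} \<and> (\<forall>m\<in>B. dot ?E (expo m) \<omega> = M) \<and>
      (\<forall>m\<in>?A - B. dot ?E (expo m) \<omega> < M) \<and> (\<Sum>m\<in>B. coef G z m * exp (dot ?E (expo m) y)) \<le> 0"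
    by (rule small_values_give_face[where u = u]) (rule finite_support finite_atLeastAtMost keys_support u | assumption)+
  then obtain B y \<omega> M where *: "B \<subseteq> ?A \<and> B \<noteq> {} \<and> (\<forall>m\<in>B. dot ?E (expo m) \<omega> = M) \<and>
      (\<forall>m\<in>?A - B. dot ?E (expo m) \<omega> < M) \<and> (\<Sum>m\<in>B. coef G z m * exp (dot ?E (expo m) y)) \<le> 0"
    by (elim exE)
  then have B: "B \<subseteq> ?A" "B \<noteq> {}"
    and le: "(\<Sum>m\<in>B. coef G z m * exp (dot ?E (expo m) y)) \<le> 0" by simp_all
  have \<omega>: "\<And>m. m \<in> B \<Longrightarrow> dot ?E (expo m) \<omega> = M" "\<And>m. m \<in> ?A - B \<Longrightarrow> dot ?E (expo m) \<omega> < M"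
    using * by simp_all
  obtain Q where Q: "Q face_of newton_polytope G" "Q \<noteq> {}" "face_exponents G Q = B"
    using weight_face[OF B \<omega>] unfolding newton_polytope_def generic_support_eq[OF G] face_exponents_def by blast
  have f: "meval u (restrict_poly Q (symanzik_F G z)) = (\<Sum>m\<in>B. coef G z m * mono_eval u m)" for u
    by (simp add: restrict_symanzik_F[OF G] Q(3))
  have exp_eval: "mono_eval (\<lambda>e. exp (y e)) m = exp (dot ?E (expo m) y)" if "m \<in> ?A" for m and y :: "nat \<Rightarrow> real"
    using keys_support[OF that] by (intro mono_eval_exp) auto
  have pos_B: "(\<Sum>m\<in>B. coef G z m * exp (dot ?E (expo m) y)) \<ge> 0" for y
  proof (rule face_nonneg[OF finite_support B(1) \<omega>])
    fix y
    have "0 \<le> meval (\<lambda>e. exp (y e)) (symanzik_F G z)" by (rule nonneg) simp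
    then show "0 \<le> (\<Sum>m\<in>?A. coef G z m * exp (dot ?E (expo m) y))"
      by (simp add: meval_symanzik_F[OF G] exp_eval)
  qed
  have eval_exp: "meval (\<lambda>e. exp (y e)) (restrict_poly Q (symanzik_F G z)) =
      (\<Sum>m\<in>B. coef G z m * exp (dot ?E (expo m) y))" for y
    unfolding f using B(1) exp_eval by (intro sum.cong) auto
  have ge: "meval u (restrict_poly Q (symanzik_F G z)) \<ge> 0" if "\<And>e. u e > 0" for u
    using eval_exp[of "\<lambda>e. ln (u e)"] pos_B[of "\<lambda>e. ln (u e)"] that by simp
  have zero: "meval (\<lambda>e. exp (y e)) (restrict_poly Q (symanzik_F G z)) = 0"
    using eval_exp[of y] pos_B[of y] le by simp
  have "meval (\<lambda>e. exp (y e)) (mpderiv i (restrict_poly Q (symanzik_F G z))) = 0" for i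
    by (rule singular_at_minimum[OF ge _ zero]) auto
  then show ?thesis using Q B zero by (intro exI[of _ Q] exI[of _ "\<lambda>e. exp (y e)"]) auto
qed

section \<open>Components through a positive point do not dominate\<close>

lemma finite_incidence_vars: "finite (incidence_vars G)"
  by (simp add: incidence_vars_def finite_kin_vars)

lemma incidence_variety_cong:
  assumes G: "feynman_graph G" and "face_exponents G Q = face_exponents G Q'"
  shows "incidence_variety G Q = incidence_variety G Q'"
  unfolding incidence_variety_def restrict_symanzik_F[OF G] assms(2) ..

lemma incidence_variety_subset: "incidence_variety G Q \<subseteq> affine_space (incidence_vars G)"
  by (auto simp: incidence_variety_def)

text \<open>
  If \<open>C\<close> dominates the space with coordinates \<open>K\<close>, then the vector field with all coordinates equal to one lifts to a rational
  vector field \<open>d / c\<close> tangent to \<open>C\<close>: extend the derivation to the other coordinates one after the other.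
\<close>
lemma tangent_lift:
  fixes K E :: "'v::linorder set"
  assumes fin: "finite K" "finite E" and disj: "K \<inter> E = {}"
    and C: "irreducible_in (zariski (K \<union> E)) C"
    and dom: "\<forall>h\<in>mpolys K \<inter> vanishing (K \<union> E) C. h = 0"
  shows "\<exists>d c. derivation d \<and> (\<forall>a. d (mconst a) = 0) \<and> c \<in> mpolys (K \<union> E) \<and> c \<notin> vanishing (K \<union> E) C \<and>
     (\<forall>v\<in>K. d (mvar v) = c) \<and> (\<forall>h\<in>vanishing (K \<union> E) C. d h \<in> vanishing (K \<union> E) C) \<and>
     (\<forall>h\<in>mpolys (K \<union> E). d h \<in> mpolys (K \<union> E))"
proof -
  define P where "P = vanishing (K \<union> E) C"
  have P_ideal: "ideal_of (mpolys (K \<union> E)) P" unfolding P_def by (rule vanishing_ideal)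
  have P_prime: "a \<in> P \<or> b \<in> P" if "a \<in> mpolys (K \<union> E)" "b \<in> mpolys (K \<union> E)" "a * b \<in> P" for a b
    using C that unfolding irreducible_in_zariski P_def by blast
  obtain x0 where x0: "x0 \<in> C" using C by (auto simp: irreducible_in_zariski)
  have P_proper: "of_nat n \<notin> P" if "n > 0" for n
  proof
    assume "of_nat n \<in> P"
    then have "meval x0 (of_nat n) = 0" using x0 by (auto simp: P_def vanishing_def)
    moreover have "meval x0 (of_nat n) = of_nat n" by (induction n) auto
    ultimately show False using that by simp
  qed
  have "\<exists>d c. derivation d \<and> (\<forall>a. d (mconst a) = 0) \<and> c \<in> mpolys (K \<union> F) \<and> c \<notin> P \<and>
     (\<forall>v\<in>K. d (mvar v) = c) \<and> (\<forall>h\<in>P \<inter> mpolys (K \<union> F). d h \<in> P) \<and>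
     (\<forall>J. K \<union> F \<subseteq> J \<longrightarrow> (\<forall>h\<in>mpolys J. d h \<in> mpolys J))"
    if "finite F" "F \<subseteq> E" for F
    using that
  proof (induction F rule: finite_induct)
    case empty
    define d where "d h = (\<Sum>v\<in>K. mpderiv v h)" for h :: "('v, complex) mpoly"
    have "derivation d"
      by (simp add: derivation_def d_def mpderiv_add mpderiv_mult sum.distrib sum_distrib_left sum_distrib_right)
    moreover have "\<forall>v\<in>K. d (mvar v) = 1"
      using fin by (auto simp: d_def mpderiv_mvar)
    moreover have "d h \<in> P" if h: "h \<in> P \<inter> mpolys (K \<union> {})" for h
    proof -
      have "h = 0" using dom h by (simp add: P_def)
      then show ?thesis using P_ideal by (simp add: d_def ideal_of_def)
    qed
    moreover have "d h \<in> mpolys J" if "h \<in> mpolys J" for h J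
      using that unfolding d_def by (intro mpolys.sum_mem mpderiv_mem)
    moreover have "1 \<notin> P" using P_proper[of 1] by simp
    moreover have "\<forall>a. d (mconst a) = 0" by (simp add: d_def)
    ultimately show ?case using mpolys.one_mem by (intro exI[of _ d] exI[of _ 1]) auto
  next
    case (insert y F)
    have "F \<subseteq> E" using insert.prems by blast
    from insert.IH[OF this] obtain d c where
      *: "derivation d" "\<forall>a. d (mconst a) = 0" "c \<in> mpolys (K \<union> F)" "c \<notin> P" "\<forall>v\<in>K. d (mvar v) = c"
      "\<forall>h\<in>P \<inter> mpolys (K \<union> F). d h \<in> P" "\<forall>J. K \<union> F \<subseteq> J \<longrightarrow> (\<forall>h\<in>mpolys J. d h \<in> mpolys J)"
      by (elim exE conjE) (rule that; assumption)
    have d: "derivation d" "\<And>a. d (mconst a) = 0" and c: "c \<in> mpolys (K \<union> F)" "c \<notin> P"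
      "\<And>v. v \<in> K \<Longrightarrow> d (mvar v) = c" and dP: "\<And>h. h \<in> P \<inter> mpolys (K \<union> F) \<Longrightarrow> d h \<in> P"
      and dJ: "\<And>J h. K \<union> F \<subseteq> J \<Longrightarrow> h \<in> mpolys J \<Longrightarrow> d h \<in> mpolys J"
      by (rule *(1), rule *(2)[rule_format], rule *(3), rule *(4), erule *(5)[rule_format],
          erule *(6)[rule_format], erule (1) *(7)[rule_format])
    have y: "y \<notin> K \<union> F" "y \<notin> K" using insert disj by auto
    define S where "S = (mpolys (K \<union> insert y F) :: ('v, complex) mpoly set)"
    have adj: "adjoin (mpolys (K \<union> F)) (mvar y) = S" by (simp add: adjoin_mvar S_def)
    have S_sub: "S \<subseteq> mpolys (K \<union> E)" unfolding S_def using insert.prems by (intro mpolys_mono) auto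
    have R_sub: "mpolys (K \<union> F) \<subseteq> S" unfolding S_def by (intro mpolys_mono) auto
    have "\<exists>e b. e \<in> S \<and> b \<in> S \<and> e \<notin> P \<inter> S \<and> (\<forall>h\<in>P \<inter> S. e * d h + b * mpderiv y h \<in> P \<inter> S)"
    proof (rule extend_derivation[where R = "mpolys (K \<union> F)" and Y = "mvar y" and P = "P \<inter> S" and d = d
          and dY = "mpderiv y", unfolded adj])
      show "subring (mpolys (K \<union> F) :: ('v, complex) mpoly set)" by unfold_locales
      show "ideal_of S (P \<inter> S)"
        using P_ideal S_sub unfolding ideal_of_def S_def
        by (auto intro: mpolys.zero_mem mpolys.add_mem mpolys.mult_mem)
      show "a \<in> P \<inter> S \<or> b \<in> P \<inter> S" if "a \<in> S" "b \<in> S" "a * b \<in> P \<inter> S" for a b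
        using that P_prime[of a b] S_sub by blast
      show "of_nat n \<notin> P \<inter> S" if "n > 0" for n using P_proper[OF that] by blast
      show "d h \<in> P \<inter> S" if "h \<in> mpolys (K \<union> F) \<inter> (P \<inter> S)" for h
        using that dP[of h] dJ[of "K \<union> insert y F" h] unfolding S_def by auto
      show "d h \<in> S" if "h \<in> S" for h using that dJ[of "K \<union> insert y F" h] unfolding S_def by auto
      show "mpderiv y h = 0" if "h \<in> mpolys (K \<union> F)" for h :: "('v, complex) mpoly"
        using mpderiv_absent[OF that y(1)] .
      show "mpderiv y h \<in> S" if "h \<in> S" for h using that mpderiv_mem unfolding S_def by blast
    qed (auto simp: d derivation_mpderiv mpderiv_mvar)
    then obtain e b where eb: "e \<in> S" "b \<in> S" "e \<notin> P"
      and ebP: "\<And>h. h \<in> P \<inter> S \<Longrightarrow> e * d h + b * mpderiv y h \<in> P" by blast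
    define d' where "d' h = e * d h + b * mpderiv y h" for h
    have "derivation d'"
    proof -
      have "derivation (mpderiv y :: ('v, complex) mpoly \<Rightarrow> _)" by (rule derivation_mpderiv)
      then show ?thesis using d(1) by (simp add: derivation_def d'_def algebra_simps)
    qed
    moreover have "\<forall>a. d' (mconst a) = 0" using d(2) by (simp add: d'_def)
    moreover have "e * c \<in> S" using eb c R_sub mpolys.mult_mem unfolding S_def by blast
    moreover have "e * c \<notin> P" using P_prime[of e c] eb c R_sub S_sub by blast
    moreover have "\<forall>v\<in>K. d' (mvar v) = e * c" using c(3) y by (auto simp: d'_def mpderiv_mvar)
    moreover have "\<forall>h\<in>P \<inter> S. d' h \<in> P" using ebP by (simp add: d'_def)
    moreover have "d' h \<in> mpolys J" if J: "K \<union> insert y F \<subseteq> J" "h \<in> mpolys J" for J h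
    proof -
      have "e \<in> mpolys J" "b \<in> mpolys J" using eb mpolys_mono[OF J(1)] unfolding S_def by auto
      moreover have "d h \<in> mpolys J" using dJ J by auto
      ultimately show ?thesis unfolding d'_def using mpderiv_mem[OF J(2)]
        by (intro mpolys.add_mem mpolys.mult_mem)
    qed
    ultimately show ?case unfolding S_def by blast
  qed
  from this[OF fin(2) order.refl] obtain d c where
    dc: "derivation d" "\<forall>a. d (mconst a) = 0" "c \<in> mpolys (K \<union> E)" "c \<notin> P"
     "\<forall>v\<in>K. d (mvar v) = c" "\<forall>h\<in>P \<inter> mpolys (K \<union> E). d h \<in> P"
     "\<forall>J. K \<union> E \<subseteq> J \<longrightarrow> (\<forall>h\<in>mpolys J. d h \<in> mpolys J)"
    by (elim exE conjE) (rule that; assumption)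
  moreover have "P \<subseteq> mpolys (K \<union> E)" by (auto simp: P_def vanishing_def)
  ultimately show ?thesis unfolding P_def by (intro exI[of _ d] exI[of _ c]) blast
qed

text \<open>
  Differentiating the equation of the restricted hypersurface along a lift of the vector field with all
  coordinates equal to one gives the vanishing of the sum of all its parameter polynomials, because the
  derivatives in the Schwinger directions vanish on the incidence variety. That sum is positive at a positive point.
\<close>
lemma component_not_dominant:
  assumes G: "feynman_graph G"
    and C: "irreducible_in (zariski (incidence_vars G)) C" "C \<subseteq> incidence_variety G Q"
    and p: "p \<in> C" "\<And>e. e \<in> {1..num_int G} \<Longrightarrow> p (Schwinger e) = complex_of_real (x e)" "\<And>e. x e > 0"
    and Q: "face_exponents G Q \<noteq> {}"
  shows "\<exists>h\<in>mpolys (kin_vars G). h \<noteq> 0 \<and> h \<in> vanishing (incidence_vars G) C"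
proof (rule ccontr)
  assume no: "\<not> ?thesis"
  let ?K = "kin_vars G" and ?E = "{1..num_int G}" and ?B = "face_exponents G Q"
  have vars: "incidence_vars G = ?K \<union> Schwinger ` ?E" by (auto simp: incidence_vars_def)
  have disj: "?K \<inter> Schwinger ` ?E = {}" by (auto simp: kin_vars_def)
  define P where "P = vanishing (incidence_vars G) C"
  have fin: "finite (Schwinger ` ?E)" by simp
  have dom: "\<forall>h\<in>mpolys ?K \<inter> vanishing (?K \<union> Schwinger ` ?E) C. h = 0"
    using no unfolding vars by blast
  from tangent_lift[OF finite_kin_vars fin disj C(1)[unfolded vars] dom, folded vars, folded P_def]
  obtain d c where
    *: "derivation d" "\<forall>a. d (mconst a) = 0" "c \<in> mpolys (incidence_vars G)" "c \<notin> P"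
     "\<forall>v\<in>?K. d (mvar v) = c" "\<forall>h\<in>P. d h \<in> P"
    by (elim exE conjE) (rule that; assumption)
  have d: "derivation d" "\<And>a. d (mconst a) = 0" and c: "c \<in> mpolys (incidence_vars G)" "c \<notin> P"
    "\<And>v. v \<in> ?K \<Longrightarrow> d (mvar v) = c" "\<And>h. h \<in> P \<Longrightarrow> d h \<in> P"
    by (rule *(1), rule *(2)[rule_format], rule *(3), rule *(4), erule *(5)[rule_format], erule *(6)[rule_format])
  define g where "g v = (\<Sum>m\<in>?B. Poly_Mapping.single m (of_nat (param_count G v m)) :: (nat, complex) mpoly)" for v
  define s where "s e = (mvar (Schwinger e) :: (var, complex) mpoly)" for e
  have keys_B: "Poly_Mapping.keys m \<subseteq> ?E" if "m \<in> ?B" for m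
    using that keys_support face_exponents_subset by blast
  have g_mem: "g v \<in> mpolys ?E" for v
    unfolding g_def using keys_B by (intro mpolys.sum_mem) (auto simp: mpolys_def)
  have s_mem: "mconst.heval s h \<in> mpolys (incidence_vars G)" if "h \<in> mpolys ?E" for h
    using that
    by (induction rule: mpolys_induct)
       (auto simp: s_def vars intro!: mconst_mem mvar_mem mpolys.add_mem mpolys.mult_mem)
  \<comment> \<open>\<open>\<Phi>\<close> is the equation of the restricted hypersurface, \<open>\<Psi>\<close> its derivative along the vector field of ones\<close>
  define \<Phi> where "\<Phi> = (\<Sum>v\<in>?K. mvar v * mconst.heval s (g v))"
  define \<Psi> where "\<Psi> = (\<Sum>v\<in>?K. mconst.heval s (g v))"
  have restr: "restrict_poly Q (symanzik_F G z) = (\<Sum>v\<in>?K. mconst (z v) * g v)" for z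
  proof -
    have "(\<Sum>v\<in>?K. mconst (z v) * g v) =
        (\<Sum>v\<in>?K. \<Sum>m\<in>?B. Poly_Mapping.single m (z v * of_nat (param_count G v m)))"
      by (simp add: g_def sum_distrib_left mconst_def mult_single)
    also have "\<dots> = (\<Sum>m\<in>?B. \<Sum>v\<in>?K. Poly_Mapping.single m (z v * of_nat (param_count G v m)))"
      by (rule sum.swap)
    also have "\<dots> = (\<Sum>m\<in>?B. Poly_Mapping.single m (coef G z m))"
    proof (intro sum.cong refl)
      fix m :: "nat \<Rightarrow>\<^sub>0 nat"
      have "(\<Sum>v\<in>V. Poly_Mapping.single m (f v)) = Poly_Mapping.single m (\<Sum>v\<in>V. f v)" for V and f :: "var \<Rightarrow> complex"
        by (induction V rule: infinite_finite_induct) (auto simp: single_add)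
      then show "(\<Sum>v\<in>?K. Poly_Mapping.single m (z v * of_nat (param_count G v m))) = Poly_Mapping.single m (coef G z m)"
        by (simp add: coef_def)
    qed
    finally show ?thesis using restrict_symanzik_F[OF G, of Q z] by simp
  qed
  have eval_s: "meval q (mconst.heval s h) = meval (\<lambda>e. q (Schwinger e)) h" for q h
    by (simp add: meval_substitution s_def)
  have deriv_sum: "mpderiv i (\<Sum>v\<in>V. mconst (z v) * g v) = (\<Sum>v\<in>V. mconst (z v) * mpderiv i (g v))" for i V and z :: "var \<Rightarrow> complex"
    by (induction V rule: infinite_finite_induct) (auto simp: mpderiv_add mpderiv_mult)
  have onC: "(\<Sum>v\<in>?K. q v * meval (\<lambda>e. q (Schwinger e)) (g v)) = 0"
      "\<And>i. i \<in> ?E \<Longrightarrow> (\<Sum>v\<in>?K. q v * meval (\<lambda>e. q (Schwinger e)) (mpderiv i (g v))) = 0"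
    if "q \<in> C" for q
    using that C(2) unfolding incidence_variety_def Let_def restr deriv_sum by auto
  have "\<Phi> \<in> mpolys (incidence_vars G)" unfolding \<Phi>_def
    by (intro mpolys.sum_mem mpolys.mult_mem mvar_mem s_mem g_mem) (auto simp: vars)
  then have "\<Phi> \<in> P" using onC(1) by (auto simp: P_def vanishing_def \<Phi>_def eval_s)
  then have "d \<Phi> \<in> P" by (rule c(4))
  moreover have d_sum: "d (\<Sum>v\<in>V. f v) = (\<Sum>v\<in>V. d (f v))" for V and f :: "var \<Rightarrow> (var, complex) mpoly"
    using d(1) by (induction V rule: infinite_finite_induct) (auto simp: derivation_def derivation_zero)
  have "d \<Phi> = c * \<Psi> + (\<Sum>v\<in>?K. mvar v * (\<Sum>i\<in>?E. mconst.heval s (mpderiv i (g v)) * d (s i)))"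
  proof -
    have "d \<Phi> = (\<Sum>v\<in>?K. d (mvar v) * mconst.heval s (g v) + mvar v * d (mconst.heval s (g v)))"
      unfolding \<Phi>_def d_sum using d(1) by (simp add: derivation_def)
    also have "\<dots> = (\<Sum>v\<in>?K. c * mconst.heval s (g v) +
        mvar v * (\<Sum>i\<in>?E. mconst.heval s (mpderiv i (g v)) * d (s i)))"
      by (intro sum.cong refl) (simp add: c(3) substitution_chain_rule[OF d(1,2) finite_atLeastAtMost g_mem])
    finally show ?thesis by (simp add: \<Psi>_def sum.distrib sum_distrib_left)
  qed
  moreover have "meval q (\<Sum>v\<in>?K. mvar v * (\<Sum>i\<in>?E. mconst.heval s (mpderiv i (g v)) * d (s i))) = 0"
    if "q \<in> C" for q
  proof -
    have "meval q (\<Sum>v\<in>?K. mvar v * (\<Sum>i\<in>?E. mconst.heval s (mpderiv i (g v)) * d (s i))) =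
       (\<Sum>v\<in>?K. \<Sum>i\<in>?E. (q v * meval (\<lambda>e. q (Schwinger e)) (mpderiv i (g v))) * meval q (d (s i)))"
      by (simp add: eval_s sum_distrib_left mult.assoc)
    also have "\<dots> = (\<Sum>i\<in>?E. (\<Sum>v\<in>?K. q v * meval (\<lambda>e. q (Schwinger e)) (mpderiv i (g v))) * meval q (d (s i)))"
      unfolding sum_distrib_right by (rule sum.swap)
    also have "\<dots> = 0" using onC(2)[OF that] by simp
    finally show ?thesis .
  qed
  ultimately have "meval q (c * \<Psi>) = 0" if "q \<in> C" for q
    using that unfolding P_def vanishing_def by auto
  moreover have \<Psi>_mem: "\<Psi> \<in> mpolys (incidence_vars G)" unfolding \<Psi>_def by (intro mpolys.sum_mem s_mem g_mem)
  ultimately have "c * \<Psi> \<in> P" using c(1) by (auto simp: P_def vanishing_def intro: mpolys.mult_mem)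
  then have "\<Psi> \<in> P" using C(1) c(1,2) \<Psi>_mem unfolding irreducible_in_zariski P_def by blast
  then have "meval p \<Psi> = 0" using p(1) by (simp add: P_def vanishing_def)
  moreover have "meval p \<Psi> = of_real (\<Sum>v\<in>?K. \<Sum>m\<in>?B. real (param_count G v m) * mono_eval x m)"
  proof -
    have "mono_eval (\<lambda>e. p (Schwinger e)) m = of_real (mono_eval x m)" if "m \<in> ?B" for m
    proof -
      have "mono_eval (\<lambda>e. p (Schwinger e)) m = mono_eval (\<lambda>e. of_real (x e)) m"
        by (rule mono_eval_cong) (use keys_B[OF that] p(2) in blast)
      then show ?thesis by (simp only: mono_eval_of_real)
    qed
    moreover have "meval p \<Psi> = (\<Sum>v\<in>?K. meval (\<lambda>e. p (Schwinger e)) (g v))"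
      by (simp only: \<Psi>_def meval.heval_sum eval_s)
    ultimately show ?thesis by (simp add: g_def)
  qed
  ultimately have zero: "(\<Sum>v\<in>?K. \<Sum>m\<in>?B. real (param_count G v m) * mono_eval x m) = 0"
    by (simp only: of_real_eq_0_iff)
  obtain m where m: "m \<in> ?B" using Q by blast
  then obtain v where v: "v \<in> ?K" "param_count G v m \<noteq> 0"
    using face_exponents_subset by (fastforce simp: support_def)
  have pos: "mono_eval x m > 0" for m using p(3) by (rule mono_eval_pos)
  have nonneg: "0 \<le> real (param_count G v m) * mono_eval x m" for v m
    using pos[of m] by (simp add: less_imp_le)
  have "0 < real (param_count G v m) * mono_eval x m" using v(2) pos by simp
  also have "\<dots> \<le> (\<Sum>m\<in>?B. real (param_count G v m) * mono_eval x m)"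
    using m nonneg finite_face_exponents by (intro member_le_sum) auto
  also have "\<dots> \<le> (\<Sum>v\<in>?K. \<Sum>m\<in>?B. real (param_count G v m) * mono_eval x m)"
    using v(1) finite_kin_vars by (intro member_le_sum) (auto intro!: sum_nonneg nonneg)
  finally show False using zero by simp
qed

section \<open>The boundary and the principal Landau determinant\<close>

lemma real_singular_point_in_incidence_variety:
  fixes x :: "nat \<Rightarrow> real"
  assumes G: "feynman_graph G" and x: "\<And>e. x e > 0"
    and zero: "meval x (restrict_poly Q (symanzik_F G z)) = 0"
    and crit: "\<And>i. meval x (mpderiv i (restrict_poly Q (symanzik_F G z))) = 0"
  shows "\<exists>p\<in>incidence_variety G Q. restrict p (kin_vars G) = complexify (kin_vars G) z \<and>
    (\<forall>e\<in>{1..num_int G}. p (Schwinger e) = complex_of_real (x e))"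
proof -
  let ?K = "kin_vars G" and ?E = "{1..num_int G}" and ?B = "face_exponents G Q"
  define p where "p = restrict (\<lambda>v. case v of Schwinger e \<Rightarrow> complex_of_real (x e) | _ \<Rightarrow> of_real (z v)) (incidence_vars G)"
  have pE: "p (Schwinger e) = of_real (x e)" if "e \<in> ?E" for e
    using that by (simp add: p_def incidence_vars_def)
  have pK: "restrict p ?K = complexify ?K z"
    by (rule ext) (auto simp: p_def complexify_def incidence_vars_def kin_vars_def)
  have coef: "coef G (complexify ?K z) m = of_real (coef G z m)" for m
    unfolding coef_def complexify_def by (simp cong: sum.cong)
  have mono: "mono_eval (\<lambda>e. p (Schwinger e)) m = of_real (mono_eval x m)" if "Poly_Mapping.keys m \<subseteq> ?E" for m
  proof -
    have "mono_eval (\<lambda>e. p (Schwinger e)) m = mono_eval (\<lambda>e. of_real (x e)) m"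
      by (rule mono_eval_cong) (use that pE in blast)
    then show ?thesis by (simp only: mono_eval_of_real)
  qed
  have keys_B: "Poly_Mapping.keys m \<subseteq> ?E" if "m \<in> ?B" for m
    using that keys_support face_exponents_subset by blast
  have keys_sub: "Poly_Mapping.keys (m - k) \<subseteq> Poly_Mapping.keys m" for m k :: "nat \<Rightarrow>\<^sub>0 nat"
    by (auto simp: in_keys_iff lookup_minus)
  have deriv: "mpderiv i (\<Sum>m\<in>B. Poly_Mapping.single m (f m)) =
      (\<Sum>m\<in>B. Poly_Mapping.single (m - Poly_Mapping.single i 1) (of_nat (Poly_Mapping.lookup m i) * f m))"
    for i B and f :: "(nat \<Rightarrow>\<^sub>0 nat) \<Rightarrow> 'c::comm_ring_1"
    by (induction B rule: infinite_finite_induct) (auto simp: mpderiv_add mpderiv_single)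
  have "meval (\<lambda>e. p (Schwinger e)) (restrict_poly Q (symanzik_F G (complexify ?K z))) =
      of_real (meval x (restrict_poly Q (symanzik_F G z)))"
    unfolding restrict_symanzik_F[OF G] using mono[OF keys_B] by (simp add: coef)
  moreover have "meval (\<lambda>e. p (Schwinger e)) (mpderiv i (restrict_poly Q (symanzik_F G (complexify ?K z)))) =
      of_real (meval x (mpderiv i (restrict_poly Q (symanzik_F G z))))" for i
  proof -
    have "mono_eval (\<lambda>e. p (Schwinger e)) (m - k) = of_real (mono_eval x (m - k))" if "m \<in> ?B" for m k
      using keys_B[OF that] keys_sub by (intro mono) blast
    then show ?thesis unfolding restrict_symanzik_F[OF G] deriv by (simp add: coef)
  qed
  moreover have "p (Schwinger e) \<noteq> 0" if "e \<in> ?E" for e using pE[OF that] x[of e] by simp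
  moreover have "p \<in> affine_space (incidence_vars G)" by (simp add: p_def affine_space_def)
  ultimately have "p \<in> incidence_variety G Q"
    using zero crit by (simp add: incidence_variety_def Let_def pK)
  then show ?thesis using pK pE by blast
qed

definition projected_closures :: "'v feynman_data \<Rightarrow> (var \<Rightarrow> complex) set set" where
  "projected_closures G = (\<Union>Q\<in>{Q. Q face_of newton_polytope G \<and> Q \<noteq> {}}. projected_components G Q)"

text \<open>
  The components depend on a face only through the exponents in it, and there are finitely many sets of exponents.
\<close>
lemma finite_projected_closures:
  assumes G: "feynman_graph G"
  shows "finite (projected_closures G)"
proof -
  have fin: "finite (projected_components G Q)" for Q
    unfolding projected_components_def
    by (intro finite_imageI irreducible_components_zariski(1) finite_incidence_vars incidence_variety_subset)
  have "projected_components G Q = projected_components G Q'" if "face_exponents G Q = face_exponents G Q'" for Q Q'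
    unfolding projected_components_def using incidence_variety_cong[OF G that] by simp
  then have eq: "projected_components G Q =
      projected_components G (SOME Q'. face_exponents G Q' = face_exponents G Q)" for Q
    using someI[of "\<lambda>Q'. face_exponents G Q' = face_exponents G Q" Q] by metis
  have "range (projected_components G) \<subseteq>
      (\<lambda>B. projected_components G (SOME Q'. face_exponents G Q' = B)) ` Pow (support G)"
  proof (rule image_subsetI)
    fix Q
    show "projected_components G Q \<in>
        (\<lambda>B. projected_components G (SOME Q'. face_exponents G Q' = B)) ` Pow (support G)"
      by (rule image_eqI[where x = "face_exponents G Q"], rule eq) (simp add: face_exponents_subset)
  qed
  then have "finite (range (projected_components G))"
    by (rule finite_subset) (simp add: finite_support)
  then have "finite (\<Union>(range (projected_components G)))" using fin by auto
  then show ?thesis by (rule finite_subset[rotated]) (auto simp: projected_closures_def)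
qed

lemma boundary_point_in_component:
  assumes G: "feynman_graph G" and z: "z \<in> copositive_boundary G"
  shows "\<exists>V\<in>projected_closures G. complexify (kin_vars G) z \<in> V \<and> closedin (zariski (kin_vars G)) V \<and>
    irreducible_in (zariski (kin_vars G)) V \<and> (\<exists>h\<in>vanishing (kin_vars G) V. h \<noteq> 0)"
proof -
  let ?K = "kin_vars G" and ?I = "incidence_vars G"
  have KI: "?K \<subseteq> ?I" by (auto simp: incidence_vars_def)
  obtain Q x where Q: "Q face_of newton_polytope G" "Q \<noteq> {}" "face_exponents G Q \<noteq> {}" and x: "\<And>e. x e > 0"
    and sing: "meval x (restrict_poly Q (symanzik_F G z)) = (0::real)"
      "\<And>i. meval x (mpderiv i (restrict_poly Q (symanzik_F G z))) = 0"
    using boundary_point_singular[OF G z] by blast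
  obtain p where p: "p \<in> incidence_variety G Q" "restrict p ?K = complexify ?K z"
    "\<And>e. e \<in> {1..num_int G} \<Longrightarrow> p (Schwinger e) = complex_of_real (x e)"
    using real_singular_point_in_incidence_variety[OF G x sing] by blast
  obtain C where C: "C \<in> irreducible_components (zariski ?I) (incidence_variety G Q)" "p \<in> C"
    using irreducible_components_zariski(2)[OF finite_incidence_vars incidence_variety_subset, of G Q] p(1) by blast
  have irr: "irreducible_in (zariski ?I) C" "C \<subseteq> incidence_variety G Q"
    using C(1) by (auto simp: irreducible_components_def)
  define W where "W = (\<lambda>p. restrict p ?K) ` C"
  define V where "V = zariski ?K closure_of W"
  have W: "irreducible_in (zariski ?K) W" unfolding W_def by (rule irreducible_projection[OF irr(1) KI])
  have Waff: "W \<subseteq> affine_space ?K" using W by (simp add: irreducible_in_zariski)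
  have WV: "W \<subseteq> V" unfolding V_def using Waff by (intro closure_of_subset) simp
  obtain h where h: "h \<in> mpolys ?K" "h \<noteq> 0" "h \<in> vanishing ?I C"
    using component_not_dominant[OF G irr C(2) p(3) x Q(3)] by blast
  have "h \<in> vanishing ?K W" using h by (auto simp: vanishing_def W_def meval_restrict)
  then have "h \<in> vanishing ?K V" using vanishing_between[OF Waff WV] by (simp add: V_def)
  moreover have "V \<in> projected_closures G"
    unfolding projected_closures_def projected_components_def V_def W_def using Q C(1) by blast
  moreover have "complexify ?K z \<in> V" using WV p(2) C(2) unfolding W_def by (metis image_eqI subsetD)
  moreover have "irreducible_in (zariski ?K) V"
    by (rule irreducible_between_closure[OF W WV]) (simp add: V_def)
  moreover have "closedin (zariski ?K) V" by (simp add: V_def)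
  ultimately show ?thesis using h(2) by blast
qed

lemma copositive_boundary_eq: "copositive_boundary G = boundary (kin_vars G) (copositive_cone G)"
  by (simp add: copositive_boundary_def boundary_def)

lemma boundary_affine: "z \<in> copositive_boundary G \<Longrightarrow> z \<in> affine_space (kin_vars G)"
  unfolding copositive_boundary_def using frontier_of_subset_topspace[of "product_topology (\<lambda>_. euclideanreal) (kin_vars G)" "copositive_cone G"]
  by (auto simp: affine_space_def)

text \<open>
  On each of the finitely many closures that contain boundary points but are not of codimension one, two polynomials \<open>f\<close>
  and \<open>g\<close> vanish, where \<open>f\<close> is irreducible and does not divide \<open>g\<close>. So arbitrarily close to \<open>z0\<close> there are boundary
  points that lie on none of these closures.
\<close>
lemma boundary_in_landau_locus:
  assumes G: "feynman_graph G" and D: "is_PLD G D" and z0: "z0 \<in> copositive_boundary G"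
  shows "meval (complexify (kin_vars G) z0) D = 0"
proof (rule vanishing_at_limit[OF finite_kin_vars boundary_affine[OF z0]])
  let ?K = "kin_vars G"
  fix \<delta> :: real assume \<delta>: "\<delta> > 0"
  define witness where "witness V p \<longleftrightarrow> fst p \<in> vanishing ?K V \<and> snd p \<in> vanishing ?K V \<and>
      irreducible (fst p) \<and> \<not> fst p dvd snd p" for V p
  define pick where "pick V = (SOME p. witness V p)" for V
  have pick: "witness V (pick V)" if "\<exists>p. witness V p" for V
    unfolding pick_def using that by (rule someI_ex)
  define pairs where "pairs = pick ` {V \<in> projected_closures G. \<exists>p. witness V p}"
  have "\<exists>z\<in>boundary ?K (copositive_cone G) \<inter> box_around ?K z0 \<delta>. \<forall>(f, g)\<in>pairs.
      meval (complexify ?K z) f \<noteq> 0 \<or> meval (complexify ?K z) g \<noteq> 0"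
  proof (rule boundary_not_covered[OF finite_kin_vars copositive_cone_upper[OF G] _ \<delta>])
    show "z0 \<in> boundary ?K (copositive_cone G)" using z0 by (simp add: copositive_boundary_eq)
    show "finite pairs" unfolding pairs_def using finite_projected_closures[OF G] by simp
    show "f \<in> mpolys ?K \<and> g \<in> mpolys ?K \<and> irreducible f \<and> \<not> f dvd g" if fg: "(f, g) \<in> pairs" for f g
    proof -
      obtain V where "(f, g) = pick V" "\<exists>p. witness V p" using fg unfolding pairs_def by blast
      then have "witness V (f, g)" using pick by simp
      then show ?thesis by (simp add: witness_def vanishing_def)
    qed
  qed
  then obtain z where z: "z \<in> copositive_boundary G" "z \<in> box_around ?K z0 \<delta>"
    and avoid: "\<And>f g. (f, g) \<in> pairs \<Longrightarrow> meval (complexify ?K z) f \<noteq> 0 \<or> meval (complexify ?K z) g \<noteq> 0"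
    unfolding copositive_boundary_eq by auto
  obtain V h where V: "V \<in> projected_closures G" "complexify ?K z \<in> V" "closedin (zariski ?K) V"
    "irreducible_in (zariski ?K) V" and h: "h \<in> vanishing ?K V" "h \<noteq> 0"
    using boundary_point_in_component[OF G z(1)] by blast
  have "\<not> witness V p" for p
  proof
    assume "witness V p"
    then have ex: "\<exists>p. witness V p" by blast
    then have "pick V \<in> pairs" using V(1) by (simp add: pairs_def)
    moreover have "meval (complexify ?K z) (fst (pick V)) = 0" "meval (complexify ?K z) (snd (pick V)) = 0"
      using pick[OF ex] V(2) by (auto simp: witness_def vanishing_def)
    ultimately show False using avoid[of "fst (pick V)" "snd (pick V)"] by simp
  qed
  moreover obtain f where f: "f \<in> vanishing ?K V" "irreducible f"
    using irreducible_vanishing_factor[OF finite_kin_vars V(4) h] by blast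
  ultimately have "codimension (zariski ?K) V = 1"
    by (intro codimension_1I[OF finite_kin_vars V(3,4) f]) (auto simp: witness_def)
  then have "complexify ?K z \<in> landau_locus G"
    using V(1,2) unfolding landau_locus_def projected_closures_def by blast
  then have "meval (complexify ?K z) D = 0" using D by (auto simp: is_PLD_def hypersurface_def)
  then show "\<exists>z\<in>box_around ?K z0 \<delta>. meval (complexify ?K z) D = 0" using z(2) by blast
qed

lemma finite_irreducible_factors:
  fixes D :: "('v::linorder, complex) mpoly"
  assumes "finite I" "D \<in> mpolys I" "D \<noteq> 0"
  shows "\<exists>Fs. finite Fs \<and> Fs \<subseteq> mpolys I \<and> (\<forall>f\<in>Fs. irreducible f \<and> f dvd D) \<and>
    (\<forall>x. meval x D = 0 \<longrightarrow> (\<exists>f\<in>Fs. meval x f = 0))"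
proof -
  interpret factorial_subring "mpolys I :: ('v, complex) mpoly set" by (rule factorial_mpolys[OF assms(1)])
  show ?thesis using assms(2,3)
  proof (induction D rule: factor_induct)
    case (unit u)
    then obtain w where w: "1 = u * w" by auto
    have "meval x u \<noteq> 0" for x using arg_cong[OF w, of "meval x"] by auto
    then show ?case by (intro exI[of _ "{}"]) auto
  next
    case (irreducible p a)
    then obtain Fs where "finite Fs" "Fs \<subseteq> mpolys I" "\<forall>f\<in>Fs. irreducible f \<and> f dvd a"
      "\<forall>x. meval x a = 0 \<longrightarrow> (\<exists>f\<in>Fs. meval x f = 0)" by blast
    then show ?case using irreducible.hyps by (intro exI[of _ "insert p Fs"]) auto
  qed
qed

theorem corollary5p9:
  fixes G :: "'v feynman_data" and PLD :: "(var, complex) mpoly"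
  assumes "feynman_graph G"
    and "is_PLD G PLD"
  shows "complexify (kin_vars G) ` copositive_boundary G \<subseteq> hypersurface (kin_vars G) PLD \<and>
    (\<exists>S. finite S \<and> S \<subseteq> landau_discriminants PLD \<and>
         algebraic_boundary G = hypersurface (kin_vars G) (\<Prod>f\<in>S. f))"
proof
  let ?K = "kin_vars G" and ?bd = "complexify (kin_vars G) ` copositive_boundary G"
  note zero = boundary_in_landau_locus[OF assms]
  have bd_aff: "?bd \<subseteq> affine_space ?K" by (auto simp: complexify_def affine_space_def)
  show "?bd \<subseteq> hypersurface ?K PLD" using zero bd_aff by (auto simp: hypersurface_def)
  have closure: "algebraic_boundary G = {x \<in> affine_space ?K. \<forall>f\<in>vanishing ?K ?bd. meval x f = 0}"
    unfolding algebraic_boundary_def by (rule closure_zariski[OF bd_aff])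
  have PLD: "PLD \<in> mpolys ?K" "PLD \<noteq> 0"
    using assms(2) not_squarefreeI[of 0 "0 :: (var, complex) mpoly"] by (auto simp: is_PLD_def)
  obtain Fs where Fs: "finite Fs" "Fs \<subseteq> mpolys ?K" "\<And>f. f \<in> Fs \<Longrightarrow> irreducible f" "\<And>f. f \<in> Fs \<Longrightarrow> f dvd PLD"
    and cover: "\<And>x. meval x PLD = 0 \<Longrightarrow> \<exists>f\<in>Fs. meval x f = 0"
    using finite_irreducible_factors[OF finite_kin_vars PLD] by blast
  \<comment> \<open>for the other factors \<open>f\<close>, the boundary points on the hypersurface of \<open>f\<close> also satisfy a second equation\<close>
  define S where "S = {f \<in> Fs. hypersurface ?K f \<subseteq> algebraic_boundary G}"
  have S: "finite S" "S \<subseteq> Fs" using Fs(1) by (auto simp: S_def)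
  have "\<exists>g\<in>vanishing ?K ?bd. \<not> f dvd g" if f: "f \<in> Fs - S" for f
  proof -
    obtain x where x: "x \<in> hypersurface ?K f" "x \<notin> algebraic_boundary G" using f by (auto simp: S_def)
    then obtain g where g: "g \<in> vanishing ?K ?bd" "meval x g \<noteq> 0"
      unfolding closure by (auto simp: hypersurface_def)
    have "\<not> f dvd g" using x(1) g(2) by (auto simp: hypersurface_def elim!: dvdE)
    then show ?thesis using g(1) by blast
  qed
  then obtain g where g: "\<And>f. f \<in> Fs - S \<Longrightarrow> g f \<in> vanishing ?K ?bd" "\<And>f. f \<in> Fs - S \<Longrightarrow> \<not> f dvd g f"
    by metis
  have prod_zero: "meval x (\<Prod>f\<in>S. f) = 0 \<longleftrightarrow> (\<exists>f\<in>S. meval x f = 0)" for x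
    using S(1) by simp
  have "meval (complexify ?K z0) (\<Prod>f\<in>S. f) = 0" if z0: "z0 \<in> copositive_boundary G" for z0
  proof (rule vanishing_at_limit[OF finite_kin_vars boundary_affine[OF z0]])
    fix \<delta> :: real assume \<delta>: "\<delta> > 0"
    define pairs where "pairs = (\<lambda>f. (f, g f)) ` (Fs - S)"
    have "\<exists>z\<in>boundary ?K (copositive_cone G) \<inter> box_around ?K z0 \<delta>. \<forall>(f, g)\<in>pairs.
        meval (complexify ?K z) f \<noteq> 0 \<or> meval (complexify ?K z) g \<noteq> 0"
    proof (rule boundary_not_covered[OF finite_kin_vars copositive_cone_upper[OF assms(1)] _ \<delta>])
      show "z0 \<in> boundary ?K (copositive_cone G)" using z0 by (simp add: copositive_boundary_eq)
      show "finite pairs" unfolding pairs_def using Fs(1) by simp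
      show "f \<in> mpolys ?K \<and> h \<in> mpolys ?K \<and> irreducible f \<and> \<not> f dvd h" if "(f, h) \<in> pairs" for f h
        using that g Fs(2,3) unfolding pairs_def vanishing_def by auto
    qed
    then obtain z where z: "z \<in> copositive_boundary G" "z \<in> box_around ?K z0 \<delta>"
      and avoid: "\<And>f h. (f, h) \<in> pairs \<Longrightarrow> meval (complexify ?K z) f \<noteq> 0 \<or> meval (complexify ?K z) h \<noteq> 0"
      unfolding copositive_boundary_eq by auto
    obtain f where f: "f \<in> Fs" "meval (complexify ?K z) f = 0" using cover[OF zero[OF z(1)]] by blast
    have "f \<in> S"
    proof (rule ccontr)
      assume "f \<notin> S"
      then have fS: "f \<in> Fs - S" using f by simp
      then have "meval (complexify ?K z) (g f) = 0" using g(1)[OF fS] z(1) by (auto simp: vanishing_def)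
      then show False using avoid[of f "g f"] fS f(2) by (auto simp: pairs_def)
    qed
    then show "\<exists>z\<in>box_around ?K z0 \<delta>. meval (complexify ?K z) (\<Prod>f\<in>S. f) = 0"
      using z(2) f(2) unfolding prod_zero by blast
  qed
  moreover have "(\<Prod>f\<in>S. f) \<in> mpolys ?K" using S(2) Fs(2) by (intro mpolys.prod_mem) auto
  ultimately have "(\<Prod>f\<in>S. f) \<in> vanishing ?K ?bd" by (auto simp: vanishing_def)
  then have "algebraic_boundary G \<subseteq> hypersurface ?K (\<Prod>f\<in>S. f)"
    unfolding closure by (auto simp: hypersurface_def)
  moreover have "hypersurface ?K (\<Prod>f\<in>S. f) \<subseteq> algebraic_boundary G"
    using prod_zero unfolding S_def hypersurface_def by auto
  moreover have "S \<subseteq> landau_discriminants PLD"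
    using S(2) Fs(3,4) by (auto simp: landau_discriminants_def)
  ultimately show "\<exists>S. finite S \<and> S \<subseteq> landau_discriminants PLD \<and>
         algebraic_boundary G = hypersurface ?K (\<Prod>f\<in>S. f)"
    using S(1) by blast
qed

end
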